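(* Let $\gamma>0$, let $\Gamma=\{(x,0):x\in\mathbb{R}\}\subset\mathbb{R}^2$ and let $Q(x,y)=|y|^{\gamma}$ on $\mathbb{R}^2$. Let $u$ be a local minimizer of $$J_Q(\cdot,B_2(0)),\qquad J_Q(w,B_2(0))=\int_{B_2(0)}|\nabla w|^2+Q^2\,\chi_{\{w>0\}}\,dx .$$ Suppose that $\{u>0\}\cap\Gamma=\emptyset$. Then the cusp set $\Sigma$ of $u$ is empty, i.e. there is no point $p\in\partial\{u>0\}\cap\Gamma\cap B_2(0)$ with $$\lim_{r\to0^+}\frac{\mathcal{H}^2(B_r(p)\cap\{u>0\})}{\pi r^2}=0 .$$
   Context: For a domain $\Omega\subset\mathbb{R}^n$ and $u_0\in W^{1,2}(\Omega)$ with $u_0\ge 0$, put $K_{u_0,\Omega}=\{w\in W^{1,2}(\Omega): w-u_0\in W^{1,2}_0(\Omega)\}$. A function $u\in K_{u_0,\Omega}$ (for some such $u_0\ge0$) is a local minimizer of $J_Q(\cdot,\Omega)$ if there is $\epsilon_0>0$ such that $J_Q(u,\Omega)\le J_Q(v,\Omega)$ for every $v\in K_{u,\Omega}$ satisfying $\|\nabla(u-v)\|_{L^2(\Omega)}^2+\|\chi_{\{u>0\}}-\chi_{\{v>0\}}\|_{L^1(\Omega)}<\epsilon_0$. Local minimizers are nonnegative and are identified with their continuous (locally Lipschitz) representatives, so that $\{u>0\}$ is open; the free boundary is $\partial\{u>0\}\cap\Omega$. The cusp set $\Sigma$ is the set of points $p\in\partial\{u>0\}\cap\Gamma\cap\Omega$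 at which $\{u>0\}$ has Lebesgue density $0$. $B_r(p)$ is the open Euclidean ball. *)

theory Defs
  imports "HOL-Analysis.Analysis"
begin

text \<open>
  Sobolev functions are represented by ordinary functions on the whole space, of which only the
  values on \<open>\<Omega>\<close> (up to null sets) matter; \<open>\<Omega>\<close> is meant to be open.
\<close>

primrec C_k :: "nat \<Rightarrow> ('a::euclidean_space \<Rightarrow> real) \<Rightarrow> bool" where
  "C_k 0 f \<longleftrightarrow> continuous_on UNIV f"
| "C_k (Suc k) f \<longleftrightarrow> (\<forall>x. f differentiable (at x)) \<and>
     (\<forall>b\<in>Basis. C_k k (\<lambda>x. frechet_derivative f (at x) b))"

definition test_functions :: "'a::euclidean_space set \<Rightarrow> ('a \<Rightarrow> real) set" where
  "test_functions \<Omega> = {\<phi>. (\<forall>k. C_k k \<phi>) \<and>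
     compact (closure {x. \<phi> x \<noteq> 0}) \<and> closure {x. \<phi> x \<noteq> 0} \<subseteq> \<Omega>}"

definition L2 :: "'a::euclidean_space set \<Rightarrow> ('a \<Rightarrow> 'b::euclidean_space) set" where
  "L2 \<Omega> = {f. f \<in> borel_measurable (lebesgue_on \<Omega>) \<and>
     integrable (lebesgue_on \<Omega>) (\<lambda>x. (norm (f x))\<^sup>2)}"

definition locally_integrable ::
    "'a::euclidean_space set \<Rightarrow> ('a \<Rightarrow> 'b::euclidean_space) \<Rightarrow> bool" where
  "locally_integrable \<Omega> f \<longleftrightarrow> (\<forall>K. compact K \<and> K \<subseteq> \<Omega> \<longrightarrow> integrable (lebesgue_on K) f)"

definition has_weak_gradient ::
    "'a::euclidean_space set \<Rightarrow> ('a \<Rightarrow> real) \<Rightarrow> ('a \<Rightarrow> 'a) \<Rightarrow> bool" where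
  "has_weak_gradient \<Omega> u g \<longleftrightarrow> locally_integrable \<Omega> u \<and> locally_integrable \<Omega> g \<and>
     (\<forall>\<phi>\<in>test_functions \<Omega>. \<forall>b\<in>Basis.
        (LINT x|lebesgue_on \<Omega>. u x * frechet_derivative \<phi> (at x) b) =
        - (LINT x|lebesgue_on \<Omega>. (g x \<bullet> b) * \<phi> x))"

definition W12 :: "'a::euclidean_space set \<Rightarrow> ('a \<Rightarrow> real) set" where
  "W12 \<Omega> = {u. u \<in> L2 \<Omega> \<and> (\<exists>g. g \<in> L2 \<Omega> \<and> has_weak_gradient \<Omega> u g)}"

text \<open>The weak gradient is unique almost everywhere; \<open>weak_grad\<close> picks a representative.\<close>

definition weak_grad :: "'a::euclidean_space set \<Rightarrow> ('a \<Rightarrow> real) \<Rightarrow> 'a \<Rightarrow> 'a" where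
  "weak_grad \<Omega> u = (SOME g. g \<in> L2 \<Omega> \<and> has_weak_gradient \<Omega> u g)"

definition W12_norm_sq :: "'a::euclidean_space set \<Rightarrow> ('a \<Rightarrow> real) \<Rightarrow> ennreal" where
  "W12_norm_sq \<Omega> u =
     (\<integral>\<^sup>+x. ennreal ((u x)\<^sup>2 + (norm (weak_grad \<Omega> u x))\<^sup>2) \<partial>lebesgue_on \<Omega>)"

definition W12_0 :: "'a::euclidean_space set \<Rightarrow> ('a \<Rightarrow> real) set" where
  "W12_0 \<Omega> = {u \<in> W12 \<Omega>. \<exists>\<phi>. (\<forall>n::nat. \<phi> n \<in> test_functions \<Omega>) \<and>
     (\<lambda>n. W12_norm_sq \<Omega> (\<lambda>x. u x - \<phi> n x)) \<longlonglongrightarrow> 0}"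

definition K_class :: "('a::euclidean_space \<Rightarrow> real) \<Rightarrow> 'a set \<Rightarrow> ('a \<Rightarrow> real) set" where
  "K_class u0 \<Omega> = {w \<in> W12 \<Omega>. (\<lambda>x. w x - u0 x) \<in> W12_0 \<Omega>}"

definition pos_set :: "'a set \<Rightarrow> ('a \<Rightarrow> real) \<Rightarrow> 'a set" where
  "pos_set \<Omega> u = {x \<in> \<Omega>. u x > 0}"

definition J :: "('a::euclidean_space \<Rightarrow> real) \<Rightarrow> ('a \<Rightarrow> real) \<Rightarrow> 'a set \<Rightarrow> ennreal" where
  "J Q w \<Omega> = (\<integral>\<^sup>+x. ennreal ((norm (weak_grad \<Omega> w x))\<^sup>2 +
     (Q x)\<^sup>2 * indicat_real (pos_set \<Omega> w) x) \<partial>lebesgue_on \<Omega>)"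

definition local_minimizer ::
    "('a::euclidean_space \<Rightarrow> real) \<Rightarrow> 'a set \<Rightarrow> ('a \<Rightarrow> real) \<Rightarrow> bool" where
  "local_minimizer Q \<Omega> u \<longleftrightarrow>
     (\<exists>u0\<in>W12 \<Omega>. (AE x in lebesgue_on \<Omega>. u0 x \<ge> 0) \<and> u \<in> K_class u0 \<Omega>) \<and>
     (\<exists>\<epsilon>0>0. \<forall>v\<in>K_class u \<Omega>.
        (\<integral>\<^sup>+x. ennreal ((norm (weak_grad \<Omega> (\<lambda>y. u y - v y) x))\<^sup>2) \<partial>lebesgue_on \<Omega>) +
        (\<integral>\<^sup>+x. ennreal \<bar>indicat_real (pos_set \<Omega> u) x - indicat_real (pos_set \<Omega> v) x\<bar>
           \<partial>lebesgue_on \<Omega>) < ennreal \<epsilon>0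
        \<longrightarrow> J Q u \<Omega> \<le> J Q v \<Omega>)"

text \<open>Two-dimensional Hausdorff measure on the plane is Lebesgue measure.\<close>

definition cusp_set ::
    "(real \<times> real) set \<Rightarrow> (real \<times> real) set \<Rightarrow> (real \<times> real \<Rightarrow> real) \<Rightarrow> (real \<times> real) set" where
  "cusp_set \<Omega> \<Gamma> u = {p \<in> frontier (pos_set \<Omega> u) \<inter> \<Gamma> \<inter> \<Omega>.
     ((\<lambda>r. measure lebesgue (ball p r \<inter> pos_set \<Omega> u) / (pi * r\<^sup>2)) \<longlongrightarrow> 0) (at_right 0)}"

end

theory Submission
  imports Defs
begin

text \<open>
  Let \<open>U = {u > 0}\<close>, \<open>p \<in> \<Gamma>\<close>, and let \<open>S r\<close> be the square of half-width \<open>r\<close> around \<open>p\<close>. Put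
  \<open>V r = \<integral> u\<^sup>2\<close>, \<open>F r = \<integral> Q\<^sup>2\<close> (both over \<open>U \<inter> S r\<close>) and \<open>A r = \<bar>U \<inter> S r\<bar>\<close>. Comparing \<open>u\<close> with
  \<open>u - \<zeta>\<^sup>2 u\<^sup>+\<close> for a cutoff \<open>\<zeta>\<close> gives a Caccioppoli inequality that controls the gradient energy and
  also \<open>F s\<close> by \<open>V r / (r - s)\<^sup>2\<close>. Together with the Sobolev inequality \<open>\<integral> f\<^sup>2 \<le> (\<integral> \<bar>\<nabla>f\<bar>)\<^sup>2\<close> in the plane,
  applied to \<open>f = \<zeta> u\<^sup>+\<close>, it yields \<open>V s \<le> C A r V r / (r - s)\<^sup>2\<close>. At a point of density zero the
  factor \<open>A r / r\<^sup>2\<close> tends to \<open>0\<close>, so \<open>V\<close> decays faster than every power of \<open>r\<close>. Since \<open>Q\<close> vanishes only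
  on a line, \<open>A\<close> is bounded by a power of \<open>F\<close>, hence of \<open>V\<close>: the second inequality is then superlinear
  in \<open>V\<close>, and a De Giorgi iteration shows that \<open>V\<close> vanishes for some small radius, so \<open>p\<close> is not in the
  closure of \<open>U\<close>.
\<close>

section \<open>Smooth functions and cutoffs\<close>

text \<open>Squaring the cutoff puts a factor \<open>\<zeta>\<close> into the cross term with the
  gradient, so that this term can be absorbed; the positive part leaves \<open>u\<close> untouched
  off U, so the whole energy balance lives on U. Where \<open>\<zeta> = 1\<close> the competitor is
  not positive, and this returns \<open>F s\<close>. Minimality is only local, so the radius on
  which cutoffs may live is fixed beforehand, from the energy of \<open>u\<close> near p.

  A enters the second estimate through Cauchy-Schwarz, since the gradient of
  \<open>\<zeta> u\<^sup>+\<close> lives on U. To bound A by F the square is cut at height t: the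
  strip |y| <= t has area 4 r t, and outside it \<open>Q\<^sup>2\<close> is at least
  \<open>t powr (2 * \<gamma>)\<close>. With t proportional to r both contributions are of order
  \<open>r\<^sup>2\<close> when V is of order \<open>r ^ 4 * r powr (2 * \<gamma>)\<close>. This is
  the threshold of the iteration, and the decay at density zero passes below it.

  Weak gradients are handled by mollification. Since \<open>u\<close> is continuous, the
  approximants converge uniformly while their gradients converge in L2; this mixed convergence
  yields membership in \<open>W12_0\<close>, the chain rule and the Sobolev inequality.\<close>

lemma C_k_SucI:
  assumes "\<And>x. (f has_derivative f' x) (at x)"
    and "\<And>b. b \<in> Basis \<Longrightarrow> C_k k (\<lambda>x. f' x b)"
  shows "C_k (Suc k) f"
proof -
  have "frechet_derivative f (at x) = f' x" for x
    using assms(1) frechet_derivative_at by metis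
  with assms show ?thesis
    by (auto simp: differentiable_def)
qed

lemma C_k_Suc_has_derivative:
  assumes "C_k (Suc k) f"
  shows "(f has_derivative frechet_derivative f (at x)) (at x)"
  using assms frechet_derivative_works by auto

lemma C_k_SucD: "C_k (Suc k) f \<Longrightarrow> C_k k f"
proof (induction k arbitrary: f)
  case 0
  then show ?case
    by (auto intro!: continuous_at_imp_continuous_on differentiable_imp_continuous_within)
next
  case (Suc k)
  from Suc.prems have "\<forall>b\<in>Basis. C_k (Suc k) (\<lambda>x. frechet_derivative f (at x) b)"
    unfolding C_k.simps(2)[of "Suc k"] by blast
  with Suc.IH have "\<forall>b\<in>Basis. C_k k (\<lambda>x. frechet_derivative f (at x) b)"
    by blast
  with Suc.prems show ?case by simp
qed

lemma C_k_const: "C_k k (\<lambda>x. c)"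
proof (induction k arbitrary: c)
  case (Suc k)
  show ?case by (rule C_k_SucI[where f'="\<lambda>x h. 0"]) (auto intro: Suc)
qed simp

lemma C_k_add: "C_k k f \<Longrightarrow> C_k k g \<Longrightarrow> C_k k (\<lambda>x. f x + g x)"
proof (induction k arbitrary: f g)
  case (Suc k)
  show ?case
    by (rule C_k_SucI[where f'="\<lambda>x h. frechet_derivative f (at x) h + frechet_derivative g (at x) h"])
       (use Suc in \<open>auto intro!: has_derivative_add C_k_Suc_has_derivative\<close>)
qed (auto intro: continuous_intros)

lemma C_k_mult: "C_k k f \<Longrightarrow> C_k k g \<Longrightarrow> C_k k (\<lambda>x. f x * g x)"
proof (induction k arbitrary: f g)
  case (Suc k)
  have D: "((\<lambda>x. f x * g x) has_derivative
      (\<lambda>h. f x * frechet_derivative g (at x) h + frechet_derivative f (at x) h * g x)) (at x)" for x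
    using has_derivative_mult Suc.prems C_k_Suc_has_derivative by blast
  have "C_k k f" "C_k k g" using Suc.prems by (auto dest!: C_k_SucD simp del: C_k.simps)
  with Suc.prems show ?case
    by (intro C_k_SucI[OF D] C_k_add Suc.IH) auto
qed (auto intro: continuous_intros)

lemma C_k_uminus: "C_k k f \<Longrightarrow> C_k k (\<lambda>x. - f x)"
  using C_k_mult[OF C_k_const[of k "-1"], of f] by simp

lemma C_k_prod: "(\<And>i. i \<in> I \<Longrightarrow> C_k k (f i)) \<Longrightarrow> C_k k (\<lambda>x. \<Prod>i\<in>I. f i x)"
  by (induction I rule: infinite_finite_induct) (auto intro: C_k_const C_k_mult)

lemma C_k_inverse: "C_k k f \<Longrightarrow> (\<And>x. f x \<noteq> 0) \<Longrightarrow> C_k k (\<lambda>x. inverse (f x))"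
proof (induction k arbitrary: f)
  case (Suc k)
  have D: "((\<lambda>x. inverse (f x)) has_derivative
      (\<lambda>h. - (inverse (f x) * frechet_derivative f (at x) h * inverse (f x)))) (at x)" for x
    using Deriv.has_derivative_inverse[OF Suc.prems(2) C_k_Suc_has_derivative[OF Suc.prems(1)]] .
  have "C_k k (\<lambda>x. inverse (f x))" using Suc.IH[OF C_k_SucD[OF Suc.prems(1)] Suc.prems(2)] .
  with Suc.prems show ?case
    by (intro C_k_SucI[OF D] C_k_uminus C_k_mult) auto
qed (auto intro: continuous_intros)

text \<open>The derivative in direction b is the constant \<open>l \<bullet> b\<close> times the
  same kind of composite, formed with the derivative of f; hence the induction on k closes for
  affine inner maps.\<close>

lemma C_k_compose_affine:
  fixes f :: "real \<Rightarrow> real" and l :: "'a::euclidean_space"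
  shows "C_k k f \<Longrightarrow> C_k k (\<lambda>x. f (l \<bullet> x + c))"
proof (induction k arbitrary: f)
  case (Suc k)
  have D: "((\<lambda>x. f (l \<bullet> x + c)) has_derivative
      (\<lambda>h. frechet_derivative f (at (l \<bullet> x + c)) (l \<bullet> h))) (at x)" for x
    by (rule has_derivative_compose[where g=f, OF _ C_k_Suc_has_derivative[OF Suc.prems]])
       (auto intro!: derivative_eq_intros)
  have eq: "frechet_derivative f (at y) t = t * frechet_derivative f (at y) 1" for y t
    using linear_cmul[OF has_derivative_linear[OF C_k_Suc_has_derivative[OF Suc.prems]], of y t 1]
    by simp
  have "C_k k (\<lambda>y. frechet_derivative f (at y) 1)"
    using Suc.prems by simp
  then show ?case
    by (intro C_k_SucI[OF D], subst eq, intro C_k_mult C_k_const Suc.IH)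
qed (auto intro!: continuous_intros intro: continuous_on_compose2)

text \<open>Serves twice: for \<open>smooth_step (1 - t)\<close> in the transition function, and to
  make the kernel \<open>\<lambda>y. \<rho> (x - y)\<close> a test function of y.\<close>

lemma C_k_compose_reflect: "C_k k f \<Longrightarrow> C_k k (\<lambda>x. f (c - x))"
proof (induction k arbitrary: f)
  case (Suc k)
  have D: "((\<lambda>x. f (c - x)) has_derivative
      (\<lambda>h. frechet_derivative f (at (c - x)) (- h))) (at x)" for x
    by (rule has_derivative_compose[where g=f, OF _ C_k_Suc_has_derivative[OF Suc.prems]])
       (auto intro!: derivative_eq_intros)
  have eq: "frechet_derivative f (at y) (- h) = - frechet_derivative f (at y) h" for y h
    using linear_neg[OF has_derivative_linear[OF C_k_Suc_has_derivative[OF Suc.prems]]] .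
  show ?case
    by (intro C_k_SucI[OF D], subst eq, intro C_k_uminus Suc.IH) (use Suc.prems in auto)
qed (auto intro!: continuous_intros intro: continuous_on_compose2)

lemma C_k_SucI_real:
  assumes "\<And>x. (f has_real_derivative f' x) (at x)" and "C_k k f'"
  shows "C_k (Suc k) f"
  by (rule C_k_SucI[where f'="\<lambda>x h. f' x * h"])
     (use assms in \<open>auto simp: has_field_derivative_def\<close>)

section \<open>The function exp(-1/t), and the bumps and transitions built from it\<close>

definition smooth_step :: "real \<Rightarrow> real" where
  "smooth_step t = (if t > 0 then exp (- (1 / t)) else 0)"

text \<open>The polynomial factor makes this family closed under differentiation.\<close>

lemma C_k_poly_exp: "C_k k (\<lambda>t::real. if t > 0 then poly p (1 / t) * exp (- (1 / t)) else 0)"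
proof (induction k arbitrary: p)
  let ?f = "\<lambda>p t::real. if t > 0 then poly p (1 / t) * exp (- (1 / t)) else 0"
  have lim0: "((\<lambda>t. poly p (1 / t) * exp (- (1 / t))) \<longlongrightarrow> 0) (at_right (0::real))" for p
  proof -
    have "((\<lambda>s. \<Sum>i\<le>degree p. coeff p i * (s ^ i / exp s)) \<longlongrightarrow> (\<Sum>i\<le>degree p. coeff p i * 0)) at_top"
      by (intro tendsto_sum tendsto_mult tendsto_const tendsto_power_div_exp_0)
    then have "((\<lambda>s. poly p s * exp (- s)) \<longlongrightarrow> 0) at_top"
      by (simp add: poly_altdef sum_distrib_left sum_distrib_right exp_minus divide_inverse mult.assoc)
    from filterlim_compose[OF this filterlim_inverse_at_top_right] show ?thesis
      by (simp add: inverse_eq_divide)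
  qed
  \<comment> \<open>With s = 1/t and ds/dt = -s^2, the derivative of p(s) exp(-s) is s^2 (p(s) -
    p'(s)) exp(-s), which explains the polynomial \<open>monom 1 2 * (p - pderiv p)\<close>.\<close>
  have D: "(?f p has_real_derivative ?f (monom 1 2 * (p - pderiv p)) x) (at x)" for p x
  proof -
    consider "x > 0" | "x < 0" | "x = 0" by linarith
    then show ?thesis
    proof cases
      case 1
      have "((\<lambda>t. poly p (1 / t) * exp (- (1 / t))) has_real_derivative
          ?f (monom 1 2 * (p - pderiv p)) x) (at x)"
        using 1 by (auto intro!: derivative_eq_intros DERIV_chain'[OF _ poly_DERIV]
            simp: poly_monom field_simps power2_eq_square)
      then show ?thesis
        by (rule has_field_derivative_transform_within_open[where S="{0<..}"]) (use 1 in auto)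
    next
      case 2
      have "((\<lambda>t. 0) has_real_derivative ?f (monom 1 2 * (p - pderiv p)) x) (at x)"
        using 2 by simp
      then show ?thesis
        by (rule has_field_derivative_transform_within_open[where S="{..<0}"]) (use 2 in auto)
    next
      case 3
      \<comment> \<open>Dividing by t multiplies the polynomial by s = 1/t, so the difference
        quotient at 0 is again a member of the family and \<open>lim0\<close> applies.\<close>
      have "((\<lambda>t. ?f p t / t) \<longlongrightarrow> 0) (at_right 0)"
        by (rule Lim_transform_eventually[OF lim0[of "monom 1 1 * p"]])
           (auto simp: eventually_at_right_field poly_monom intro!: exI[of _ 1])
      moreover have "((\<lambda>t. ?f p t / t) \<longlongrightarrow> 0) (at_left 0)"
        by (rule Lim_transform_eventually[OF tendsto_const])
           (auto simp: eventually_at_left_field intro!: exI[of _ "-1"])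
      ultimately have "((\<lambda>t. ?f p t / t) \<longlongrightarrow> 0) (at 0)"
        using filterlim_split_at by blast
      then show ?thesis
        using 3 by (simp add: has_field_derivative_iff)
    qed
  qed
  { case 0
    have "continuous_on UNIV (?f p)"
      using D DERIV_isCont continuous_at_imp_continuous_on by blast
    then show ?case by simp
  next
    case (Suc k)
    show ?case by (rule C_k_SucI_real[OF D Suc]) }
qed

lemma C_k_smooth_step: "C_k k smooth_step"
  using C_k_poly_exp[of k 1] by (simp add: smooth_step_def[abs_def] cong: if_cong)

lemma smooth_step_pos_iff: "smooth_step t > 0 \<longleftrightarrow> t > 0"
  and smooth_step_nonneg: "smooth_step t \<ge> 0"
  and smooth_step_eq_0_iff: "smooth_step t = 0 \<longleftrightarrow> t \<le> 0"
  by (auto simp: smooth_step_def)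

definition box_bump :: "'a::euclidean_space \<Rightarrow> 'a \<Rightarrow> 'a \<Rightarrow> real" where
  "box_bump a b x = (\<Prod>i\<in>Basis. smooth_step (i \<bullet> x + - (a \<bullet> i)) * smooth_step ((-i) \<bullet> x + b \<bullet> i))"

lemma C_k_box_bump: "C_k k (box_bump a b)"
  unfolding box_bump_def[abs_def]
  by (intro C_k_prod C_k_mult C_k_compose_affine C_k_smooth_step)

lemma box_bump_nonneg: "box_bump a b x \<ge> 0"
  by (auto simp: box_bump_def intro!: prod_nonneg mult_nonneg_nonneg smooth_step_nonneg)

text \<open>The exact zero set matters twice: the bump has nonzero integral, and in
  \<open>weak_gradient_unique\<close> it can be divided out on the whole open box.\<close>

lemma box_bump_eq_0_iff: "box_bump a b x = 0 \<longleftrightarrow> x \<notin> box a b"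
  by (auto simp: box_bump_def mem_box smooth_step_eq_0_iff inner_commute not_less)

lemma box_bump_test_function:
  assumes "cbox a b \<subseteq> \<Omega>"
  shows "box_bump a b \<in> test_functions \<Omega>"
proof -
  have "closure {x. box_bump a b x \<noteq> 0} \<subseteq> cbox a b"
    by (auto simp: box_bump_eq_0_iff intro!: closure_minimal[THEN subsetD, OF box_subset_cbox])
  moreover have "compact (closure {x. box_bump a b x \<noteq> 0})"
    by (simp add: box_bump_eq_0_iff bounded_subset[OF bounded_cbox box_subset_cbox])
  ultimately show ?thesis
    using assms C_k_box_bump by (auto simp: test_functions_def)
qed

text \<open>The quotient of \<open>smooth_step t\<close> by
  \<open>smooth_step t + smooth_step (1 - t)\<close> is smooth because t and 1 - t are never both
  nonpositive. Its derivative is bounded by compactness on [0, 1] and by local constancy elsewhere.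
  After rescaling, M yields cutoffs whose gradient is of order 1/(r - s).\<close>

lemma smooth_transition:
  obtains \<sigma> :: "real \<Rightarrow> real" and M where
    "\<And>k. C_k k \<sigma>" "\<And>t. 0 \<le> \<sigma> t" "\<And>t. \<sigma> t \<le> 1" "\<And>t. t \<le> 0 \<Longrightarrow> \<sigma> t = 0" "\<And>t. t \<ge> 1 \<Longrightarrow> \<sigma> t = 1"
    "M > 0" "\<And>t. \<bar>frechet_derivative \<sigma> (at t) 1\<bar> \<le> M"
proof -
  define \<sigma> where "\<sigma> t = smooth_step t * inverse (smooth_step t + smooth_step (1 - t))" for t
  have pos: "smooth_step t + smooth_step (1 - t) > 0" for t
    by (smt (verit) smooth_step_pos_iff smooth_step_nonneg)
  have C: "C_k k \<sigma>" for k
    unfolding \<sigma>_def[abs_def]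
    using pos by (intro C_k_mult C_k_inverse C_k_add C_k_smooth_step C_k_compose_reflect)
                 (auto simp: less_imp_neq[symmetric])
  have s0: "\<sigma> t = 0" if "t \<le> 0" for t
    using that by (simp add: \<sigma>_def smooth_step_eq_0_iff)
  have s1: "\<sigma> t = 1" if "t \<ge> 1" for t
  proof -
    have "smooth_step (1 - t) = 0" using that by (simp add: smooth_step_eq_0_iff)
    then show ?thesis using pos[of t] by (simp add: \<sigma>_def)
  qed
  have der: "(\<sigma> has_derivative frechet_derivative \<sigma> (at t)) (at t)" for t
    using C_k_Suc_has_derivative C by blast
  have "C_k (Suc 0) \<sigma>" using C .
  then have "continuous_on UNIV (\<lambda>t. frechet_derivative \<sigma> (at t) 1)"
    by simp
  then have "compact ((\<lambda>t. frechet_derivative \<sigma> (at t) 1) ` {0..1})"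
    by (intro compact_continuous_image compact_Icc) (auto intro: continuous_on_subset)
  then obtain M where M: "M > 0" "\<And>t. t \<in> {0..1} \<Longrightarrow> \<bar>frechet_derivative \<sigma> (at t) 1\<bar> \<le> M"
    using bounded_pos[of "(\<lambda>t. frechet_derivative \<sigma> (at t) 1) ` {0..1}"] compact_imp_bounded
    by (auto simp: real_norm_def)
  have out: "frechet_derivative \<sigma> (at t) 1 = 0" if "t \<notin> {0..1}" for t
  proof -
    define c where "c = \<sigma> t"
    obtain S where S: "open S" "t \<in> S" "\<And>s. s \<in> S \<Longrightarrow> \<sigma> s = c"
    proof (cases "t < 0")
      case True
      then show ?thesis using that[of "{..<0}"] s0 by (auto simp: c_def)
    next
      case False
      with \<open>t \<notin> {0..1}\<close> show ?thesis using that[of "{1<..}"] s1 by (auto simp: c_def)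
    qed
    have "(\<sigma> has_derivative (\<lambda>h. 0)) (at t)"
      by (rule has_derivative_transform_within_open[OF has_derivative_const S(1,2)]) (simp add: S(3))
    then have "frechet_derivative \<sigma> (at t) = (\<lambda>h. 0)"
      using frechet_derivative_at by metis
    then show ?thesis by simp
  qed
  show ?thesis
  proof (rule that[of \<sigma> M])
    show "0 \<le> \<sigma> t" "\<sigma> t \<le> 1" for t
      using pos[of t] smooth_step_nonneg[of t] smooth_step_nonneg[of "1 - t"]
      by (auto simp: \<sigma>_def field_simps)
    show "\<bar>frechet_derivative \<sigma> (at t) 1\<bar> \<le> M" for t
      using M out[of t] by (cases "t \<in> {0..1}") auto
  qed (use C s0 s1 M in auto)
qed

section \<open>Mollification\<close>

text \<open>Two points at distance less than 1 either both lie in K', the closed unit neighbourhood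
  of K, where compactness gives uniform continuity, or both lie outside K, where f is 0.\<close>

lemma uniformly_continuous_compact_support:
  fixes f :: "'a::euclidean_space \<Rightarrow> 'b::real_normed_vector"
  assumes "continuous_on UNIV f" "compact K" "\<And>x. x \<notin> K \<Longrightarrow> f x = 0"
  shows "uniformly_continuous_on UNIV f"
proof -
  define K' where "K' = (\<Union>x\<in>K. \<Union>y\<in>cball 0 1. {x + y})"
  have "compact K'"
    using compact_sums'[OF assms(2) compact_cball] by (simp add: K'_def)
  have nbhd: "y \<in> K'" if "x \<in> K" "dist x y < 1" for x y
  proof -
    have "y = x + (y - x)" "y - x \<in> cball 0 1"
      using that by (auto simp: dist_norm norm_minus_commute)
    with that show ?thesis unfolding K'_def by blast
  qed
  have "uniformly_continuous_on K' f"
    using assms(1) \<open>compact K'\<close> by (auto intro!: compact_uniformly_continuous intro: continuous_on_subset)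
  show ?thesis
    unfolding uniformly_continuous_on_def
  proof (intro allI impI)
    fix e :: real assume "e > 0"
    with \<open>uniformly_continuous_on K' f\<close> obtain d where d: "d > 0"
      "\<And>x y. x \<in> K' \<Longrightarrow> y \<in> K' \<Longrightarrow> dist y x < d \<Longrightarrow> dist (f y) (f x) < e"
      unfolding uniformly_continuous_on_def by meson
    have "dist (f y) (f x) < e" if "dist y x < min d 1" for x y
    proof (cases "x \<in> K \<or> y \<in> K")
      case True
      then have "x \<in> K'" "y \<in> K'"
        using nbhd[of x y] nbhd[of y x] nbhd[of x x] nbhd[of y y] that by (auto simp: dist_commute)
      with d that show ?thesis by simp
    next
      case False
      with assms(3) \<open>e > 0\<close> show ?thesis by simp
    qed
    with \<open>d > 0\<close> show "\<exists>d>0. \<forall>x\<in>UNIV. \<forall>x'\<in>UNIV. dist x' x < d \<longrightarrow> dist (f x') (f x) < e"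
      by (intro exI[of _ "min d 1"]) auto
  qed
qed

lemma bounded_compact_support:
  fixes f :: "'a::euclidean_space \<Rightarrow> 'b::real_normed_vector"
  assumes "continuous_on UNIV f" "compact K" "\<And>x. x \<notin> K \<Longrightarrow> f x = 0"
  obtains B where "B > 0" "\<And>x. norm (f x) \<le> B"
proof -
  have "bounded (f ` K)"
    using assms by (auto intro!: compact_imp_bounded compact_continuous_image intro: continuous_on_subset)
  then obtain B where "B > 0" "\<And>x. x \<in> K \<Longrightarrow> norm (f x) \<le> B"
    by (auto simp: bounded_pos)
  then show ?thesis
    using assms(3) by (intro that[of B]) (metis less_eq_real_def norm_zero)+
qed

lemma integrable_compact_support:
  fixes f :: "'a::euclidean_space \<Rightarrow> real"
  assumes "continuous_on UNIV f" "compact K" "\<And>x. x \<notin> K \<Longrightarrow> f x = 0"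
  shows "integrable lborel f"
proof -
  have "integrable lborel (\<lambda>x. indicator K x *\<^sub>R f x)"
    using borel_integrable_compact[OF assms(2) continuous_on_subset[OF assms(1)]] by simp
  moreover have "(\<lambda>x. indicator K x *\<^sub>R f x) = f"
    
  proof
    show "indicator K x *\<^sub>R f x = f x" for x
      using assms(3)[of x] by (cases "x \<in> K") auto
  qed
  ultimately show ?thesis by simp
qed

lemma integrable_mult_bounded:
  fixes f g :: "'a \<Rightarrow> real"
  assumes "integrable M f" "g \<in> borel_measurable M" "\<And>x. \<bar>g x\<bar> \<le> B"
  shows "integrable M (\<lambda>x. g x * f x)"
proof (rule Bochner_Integration.integrable_bound[where f="\<lambda>x. B * f x"])
  have "0 \<le> B" using assms(3) abs_ge_zero order_trans by blast
  then show "AE x in M. norm (g x * f x) \<le> norm (B * f x)"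
    using assms(3) by (auto simp: abs_mult intro!: mult_right_mono)
qed (use assms in auto)

lemma derivative_zero_outside:
  assumes "(f has_derivative f') (at x)" "closed K" "\<And>x. x \<notin> K \<Longrightarrow> f x = 0" "x \<notin> K"
  shows "f' = (\<lambda>h. 0)"
proof -
  have "(f has_derivative (\<lambda>h. 0)) (at x)"
    by (rule has_derivative_transform_within_open[OF has_derivative_const, of "- K"])
       (use assms in auto)
  with assms(1) show ?thesis
    using has_derivative_unique by blast
qed

text \<open>The threshold d does not depend on x, which is what allows first-order expansions to be
  integrated in x. It comes from the uniform continuity of the partial derivatives and the mean
  value inequality on a ball. Each partial derivative may vary by \<open>e / DIM('a)\<close>,
  because the operator norm is bounded by the sum over all coordinates.\<close>

lemma uniform_derivative_compact_support:
  fixes f :: "'a::euclidean_space \<Rightarrow> real"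
  assumes f: "\<And>x. (f has_derivative f' x) (at x)"
    and f': "\<And>b. b \<in> Basis \<Longrightarrow> continuous_on UNIV (\<lambda>x. f' x b)"
    and K: "compact K" "\<And>x. x \<notin> K \<Longrightarrow> f x = 0" and "e > 0"
  obtains d where "d > 0" "\<And>x h. norm h < d \<Longrightarrow> \<bar>f (x + h) - f x - f' x h\<bar> \<le> e * norm h"
proof -
  let ?e = "e / DIM('a)"
  have "?e > 0" using \<open>e > 0\<close> by simp
  have zero: "f' x b = 0" if "x \<notin> K" for x b
    using derivative_zero_outside[OF f] K that compact_imp_closed by metis
  have "\<exists>d>0. \<forall>x y. dist y x < d \<longrightarrow> dist (f' y b) (f' x b) < ?e" if "b \<in> Basis" for b
    using uniformly_continuous_compact_support[OF f'[OF that] K(1) zero] \<open>?e > 0\<close>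
    unfolding uniformly_continuous_on_def by blast
  then obtain d where d: "\<And>b. b \<in> Basis \<Longrightarrow> d b > 0"
    "\<And>b x y. b \<in> Basis \<Longrightarrow> dist y x < d b \<Longrightarrow> dist (f' y b) (f' x b) < ?e"
    by metis
  define D where "D = Min (d ` Basis)"
  have D: "D > 0" "\<And>b. b \<in> Basis \<Longrightarrow> D \<le> d b"
    using d(1) by (auto simp: D_def)
  have "\<bar>f (x + h) - f x - f' x h\<bar> \<le> e * norm h" if "norm h < D" for x h
  proof -
    have "onorm (f' y - f' x) \<le> e" if "y \<in> ball x D" for y
    proof (rule onorm_le)
      fix v
      have lin: "f' z v = (\<Sum>b\<in>Basis. (v \<bullet> b) * f' z b)" for z
        using linear_sum[OF has_derivative_linear[OF f[of z]], of "\<lambda>b. (v \<bullet> b) *\<^sub>R b" Basis]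
          linear_cmul[OF has_derivative_linear[OF f[of z]]]
        by (simp add: euclidean_representation)
      have "\<bar>f' y b - f' x b\<bar> \<le> ?e" if "b \<in> Basis" for b
        using d(2)[OF that, of y x] D(2)[OF that] \<open>y \<in> ball x D\<close>
        by (simp add: dist_real_def dist_commute less_imp_le)
      then have "\<bar>(v \<bullet> b) * (f' y b - f' x b)\<bar> \<le> norm v * ?e" if "b \<in> Basis" for b
        unfolding abs_mult using that by (intro mult_mono Basis_le_norm) auto
      then have "\<bar>\<Sum>b\<in>Basis. (v \<bullet> b) * (f' y b - f' x b)\<bar> \<le> (\<Sum>b\<in>(Basis::'a set). norm v * ?e)"
        by (intro order_trans[OF sum_abs] sum_mono)
      then show "norm ((f' y - f' x) v) \<le> e * norm v"
        using lin[of y] lin[of x] by (simp add: sum_subtractf[symmetric] algebra_simps)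
    qed
    moreover have "x + t *\<^sub>R (x + h - x) \<in> ball x D" if "t \<in> {0..1}" for t
    proof -
      have "\<bar>t\<bar> * norm h \<le> 1 * norm h" using that by (intro mult_right_mono) auto
      with \<open>norm h < D\<close> show ?thesis by (simp add: dist_norm)
    qed
    ultimately have "norm (f (x + h) - f x - f' x (x + h - x)) \<le> norm (x + h - x) * e"
      using D(1) by (intro differentiable_bound_linearization[where S="ball x D"])
        (auto intro: has_derivative_at_withinI[OF f])
    then show ?thesis by (simp add: mult.commute)
  qed
  with that D(1) show ?thesis by blast
qed

lemma
  fixes f :: "'a::euclidean_space \<Rightarrow> real"
  assumes [measurable]: "f \<in> borel_measurable borel"
  shows lborel_integral_translate: "(LINT x|lborel. f (c + x)) = (LINT x|lborel. f x)"
    and lborel_integral_reflect: "(LINT x|lborel. f (c - x)) = (LINT x|lborel. f x)"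
proof -
  show "(LINT x|lborel. f (c + x)) = (LINT x|lborel. f x)"
    by (subst (2) lborel_distr_plus[of c, symmetric]) (simp add: integral_distr)
  have "lborel = distr lborel borel (\<lambda>x::'a. c - x)"
    using lborel_affine[of "-1" c] by (simp add: density_1)
  then have "(LINT x|lborel. f x) = (LINT x|distr lborel borel (\<lambda>x::'a. c - x). f x)"
    by simp
  also have "\<dots> = (LINT x|lborel. f (c - x))"
    by (simp add: integral_distr)
  finally show "(LINT x|lborel. f (c - x)) = (LINT x|lborel. f x)" by simp
qed

lemma lborel_integrable_reflect:
  fixes f :: "'a::euclidean_space \<Rightarrow> real"
  assumes "integrable lborel f"
  shows "integrable lborel (\<lambda>x. f (c - x))"
proof -
  have "lborel = distr lborel borel (\<lambda>x::'a. c - x)"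
    using lborel_affine[of "-1" c] by (simp add: density_1)
  with assms have "integrable (distr lborel borel (\<lambda>x::'a. c - x)) f"
    by simp
  then show ?thesis
    by (subst (asm) integrable_distr_eq) (use assms in auto)
qed

lemma lborel_nn_integral_minus_right:
  fixes f :: "'a::euclidean_space \<Rightarrow> ennreal"
  assumes [measurable]: "f \<in> borel_measurable borel"
  shows "(\<integral>\<^sup>+x. f (x - c) \<partial>lborel) = (\<integral>\<^sup>+x. f x \<partial>lborel)"
  by (subst (2) lborel_distr_plus[of "-c", symmetric]) (simp add: nn_integral_distr)

text \<open>By translation invariance the integral of \<open>f (t *\<^sub>R b + x) - f x\<close> is
  0 for every t, and this difference equals t times the derivative up to an error of e t on a
  bounded set. The integral is therefore at most e times a fixed volume for every e > 0.\<close>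

lemma integral_derivative_compact_support:
  fixes f :: "'a::euclidean_space \<Rightarrow> real"
  assumes f: "\<And>x. (f has_derivative f' x) (at x)"
    and f': "\<And>b. b \<in> Basis \<Longrightarrow> continuous_on UNIV (\<lambda>x. f' x b)"
    and K: "compact K" "\<And>x. x \<notin> K \<Longrightarrow> f x = 0" and b: "b \<in> Basis"
  shows "(LINT x|lborel. f' x b) = 0"
proof -
  let ?K = "(\<Union>x\<in>K. \<Union>y\<in>cball 0 1. {x + y})"
  have "compact ?K" using compact_sums'[OF K(1) compact_cball] by simp
  have cf: "continuous_on UNIV f"
    using f by (auto intro!: continuous_at_imp_continuous_on has_derivative_continuous)
  have [measurable]: "f \<in> borel_measurable borel"
    using cf by (rule borel_measurable_continuous_onI)
  have zero: "f' x h = 0" if "x \<notin> K" for x h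
    using derivative_zero_outside[OF f] K that compact_imp_closed by metis
  have int: "integrable lborel f" "integrable lborel (\<lambda>x. f' x b)"
    using integrable_compact_support[OF cf K] integrable_compact_support[OF f'[OF b] K(1) zero] by auto
  have out: "f (h + x) = 0" if "x \<notin> ?K" "norm h \<le> 1" for x h
  proof (rule K(2), rule notI)
    assume "h + x \<in> K"
    then have "(h + x) + (- h) \<in> ?K" using \<open>norm h \<le> 1\<close> by (intro UN_I[of "h + x"] UN_I[of "-h"]) auto
    with that show False by simp
  qed
  have KK: "x \<in> ?K" if "x \<in> K" for x
    using that by (intro UN_I[of x] UN_I[of 0]) auto
  define C where "C = measure lborel ?K"
  have fin: "emeasure lborel ?K < \<infinity>" "?K \<in> sets lborel"
    using emeasure_compact_finite[OF \<open>compact ?K\<close>] borel_compact[OF \<open>compact ?K\<close>] by auto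
  have "\<bar>LINT x|lborel. f' x b\<bar> \<le> e * C" if "e > 0" for e
  proof -
    obtain d where d: "d > 0" "\<And>x h. norm h < d \<Longrightarrow> \<bar>f (x + h) - f x - f' x h\<bar> \<le> e * norm h"
      using uniform_derivative_compact_support[OF f f' K \<open>e > 0\<close>] by blast
    \<comment> \<open>The bound 1 keeps the translated support inside \<open>?K\<close>, and d / 2
      keeps the step below the threshold of the expansion.\<close>
    define t where "t = min 1 (d / 2)"
    have t: "t > 0" "t < d" "t \<le> 1" using d(1) by (auto simp: t_def)
    have scale: "f' x (t *\<^sub>R b) = t * f' x b" for x
      using linear_cmul[OF has_derivative_linear[OF f]] by simp
    have int2: "integrable lborel (\<lambda>x. f (t *\<^sub>R b + x))"
    proof (rule integrable_compact_support[OF _ \<open>compact ?K\<close>])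
      show "continuous_on UNIV (\<lambda>x. f (t *\<^sub>R b + x))"
        by (rule continuous_on_compose2[OF cf]) (auto intro!: continuous_intros)
    qed (use out b t in auto)
    have "t * (LINT x|lborel. f' x b) = - (LINT x|lborel. f (t *\<^sub>R b + x) - f x - t * f' x b)"
      using int int2 by (simp add: lborel_integral_translate)
    also have "\<bar>\<dots>\<bar> \<le> (LINT x|lborel. indicator ?K x * (e * t))"
      unfolding abs_minus_cancel
    proof (rule integral_abs_bound[THEN order_trans], rule integral_mono)
      fix x
      show "\<bar>f (t *\<^sub>R b + x) - f x - t * f' x b\<bar> \<le> indicator ?K x * (e * t)"
      proof (cases "x \<in> ?K")
        case True
        then show ?thesis
          using d(2)[of "t *\<^sub>R b" x] t b by (simp add: scale add.commute)
      next
        case False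
        have "f (t *\<^sub>R b + x) = 0" "f (0 + x) = 0"
          by (rule out[OF False], use t b in simp)+
        moreover have "f' x b = 0" using zero KK False by blast
        ultimately show ?thesis using False by simp
      qed
    qed (use int int2 fin in \<open>auto simp: less_top[symmetric]\<close>)
    also have "\<dots> = C * e * t" by (simp add: C_def)
    finally show ?thesis using t by (simp add: abs_mult field_simps)
  qed
  note bound = this
  have "\<bar>LINT x|lborel. f' x b\<bar> \<le> 0"
  proof (rule field_le_epsilon)
    fix e :: real assume "e > 0"
    have "C \<ge> 0" by (simp add: C_def)
    have "\<bar>LINT x|lborel. f' x b\<bar> \<le> e / (C + 1) * C"
      using \<open>e > 0\<close> \<open>C \<ge> 0\<close> by (intro bound) (simp add: divide_pos_pos)
    also have "\<dots> \<le> e" using \<open>e > 0\<close> \<open>C \<ge> 0\<close> by (simp add: field_simps)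
    finally show "\<bar>LINT x|lborel. f' x b\<bar> \<le> 0 + e" by simp
  qed
  then show ?thesis by simp
qed

section \<open>Convolution with a test function\<close>

definition convol :: "('a::euclidean_space \<Rightarrow> real) \<Rightarrow> ('a \<Rightarrow> real) \<Rightarrow> 'a \<Rightarrow> real" where
  "convol \<rho> f x = (LINT y|lborel. \<rho> (x - y) * f y)"

lemma convol_integrable:
  fixes \<rho> f :: "'a::euclidean_space \<Rightarrow> real"
  assumes "continuous_on UNIV \<rho>" "compact K" "\<And>x. x \<notin> K \<Longrightarrow> \<rho> x = 0" "integrable lborel f"
  shows "integrable lborel (\<lambda>y. \<rho> (x - y) * f y)"
proof -
  obtain B where "\<And>x. norm (\<rho> x) \<le> B"
    using bounded_compact_support[OF assms(1-3)] by blast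
  moreover have "(\<lambda>y. \<rho> (x - y)) \<in> borel_measurable borel"
    by (rule borel_measurable_continuous_onI, rule continuous_on_compose2[OF assms(1)])
       (auto intro!: continuous_intros)
  ultimately show ?thesis
    by (intro integrable_mult_bounded[OF assms(4), where B=B]) auto
qed

text \<open>All derivatives fall on the kernel. The remainder of its expansion is at most
  \<open>e' * norm h\<close> uniformly, so against g it costs at most \<open>e'\<close> times the L1
  norm C of g, times \<open>norm h\<close>; dividing by C + 1 also covers C = 0.\<close>

lemma convol_has_derivative:
  assumes f: "\<And>x. (\<rho> has_derivative \<rho>' x) (at x)"
    and f': "\<And>b. b \<in> Basis \<Longrightarrow> continuous_on UNIV (\<lambda>x. \<rho>' x b)"
    and K: "compact K" "\<And>x. x \<notin> K \<Longrightarrow> \<rho> x = 0" and g: "integrable lborel g"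
  shows "(convol \<rho> g has_derivative (\<lambda>h. \<Sum>b\<in>Basis. (h \<bullet> b) * convol (\<lambda>z. \<rho>' z b) g x)) (at x)"
  unfolding has_derivative_at_alt
proof (intro conjI allI impI)
  show "bounded_linear (\<lambda>h. \<Sum>b\<in>Basis. (h \<bullet> b) * convol (\<lambda>z. \<rho>' z b) g x)"
    by (intro bounded_linear_sum bounded_linear_mult_const bounded_linear_inner_left)
  fix e :: real assume "e > 0"
  define C where "C = (LINT y|lborel. \<bar>g y\<bar>)"
  have "C \<ge> 0" by (simp add: C_def)
  define e' where "e' = e / (C + 1)"
  have "e' > 0" using \<open>e > 0\<close> \<open>C \<ge> 0\<close> by (simp add: e'_def)
  obtain d where d: "d > 0" "\<And>x h. norm h < d \<Longrightarrow> \<bar>\<rho> (x + h) - \<rho> x - \<rho>' x h\<bar> \<le> e' * norm h"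
    using uniform_derivative_compact_support[OF f f' K \<open>e' > 0\<close>] by blast
  have cf: "continuous_on UNIV \<rho>"
    using f by (auto intro!: continuous_at_imp_continuous_on has_derivative_continuous)
  have zero: "\<rho>' x h = 0" if "x \<notin> K" for x h
    using derivative_zero_outside[OF f] K that compact_imp_closed by metis
  note int = convol_integrable[OF cf K g]
  note int' = convol_integrable[OF f' K(1) zero g]
  have lin: "\<rho>' z v = (\<Sum>b\<in>Basis. (v \<bullet> b) * \<rho>' z b)" for z v
    using linear_sum[OF has_derivative_linear[OF f[of z]], of "\<lambda>b. (v \<bullet> b) *\<^sub>R b" Basis]
      linear_cmul[OF has_derivative_linear[OF f[of z]]]
    by (simp add: euclidean_representation)
  have "norm (convol \<rho> g y - convol \<rho> g x - (\<Sum>b\<in>Basis. ((y - x) \<bullet> b) * convol (\<lambda>z. \<rho>' z b) g x))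
      \<le> e * norm (y - x)" if "norm (y - x) < d" for y
  proof -
    define h where "h = y - x"
    have "convol \<rho> g y - convol \<rho> g x - (\<Sum>b\<in>Basis. (h \<bullet> b) * convol (\<lambda>z. \<rho>' z b) g x)
        = (LINT z|lborel. \<rho> (y - z) * g z - \<rho> (x - z) * g z
             - (\<Sum>b\<in>Basis. (h \<bullet> b) * (\<rho>' (x - z) b * g z)))"
      unfolding convol_def using int int' by (simp add: Bochner_Integration.integral_diff)
    also have "\<dots> = (LINT z|lborel. (\<rho> ((x - z) + h) - \<rho> (x - z) - \<rho>' (x - z) h) * g z)"
    proof (rule Bochner_Integration.integral_cong[OF refl])
      fix z
      have "\<rho>' (x - z) h * g z = (\<Sum>b\<in>Basis. (h \<bullet> b) * (\<rho>' (x - z) b * g z))"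
        by (subst lin) (simp add: sum_distrib_right mult.assoc)
      then show "\<rho> (y - z) * g z - \<rho> (x - z) * g z - (\<Sum>b\<in>Basis. (h \<bullet> b) * (\<rho>' (x - z) b * g z))
        = (\<rho> ((x - z) + h) - \<rho> (x - z) - \<rho>' (x - z) h) * g z"
        by (simp add: h_def algebra_simps)
    qed
    also have "\<bar>\<dots>\<bar> \<le> (LINT z|lborel. e' * norm h * \<bar>g z\<bar>)"
    proof (rule integral_abs_bound[THEN order_trans], rule integral_mono')
      show "\<bar>(\<rho> (x - z + h) - \<rho> (x - z) - \<rho>' (x - z) h) * g z\<bar> \<le> e' * norm h * \<bar>g z\<bar>" for z
        using d(2)[of h "x - z"] that by (auto simp: abs_mult h_def intro!: mult_right_mono)
    qed (use g \<open>e' > 0\<close> in auto)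
    also have "\<dots> = e' * C * norm h" by (simp add: C_def)
    also have "\<dots> \<le> e * norm h"
      using \<open>e > 0\<close> \<open>C \<ge> 0\<close> by (intro mult_right_mono) (auto simp: e'_def field_simps)
    finally show ?thesis by (simp add: h_def)
  qed
  with d(1) show "\<exists>d>0. \<forall>y. norm (y - x) < d \<longrightarrow>
     norm (convol \<rho> g y - convol \<rho> g x - (\<Sum>b\<in>Basis. ((y - x) \<bullet> b) * convol (\<lambda>z. \<rho>' z b) g x))
      \<le> e * norm (y - x)" by blast
qed

text \<open>Frees membership from the exact support: any compact subset of \<open>\<Omega>\<close>
  outside which \<open>\<phi>\<close> vanishes will do, because the closure of the nonzero set is a
  closed subset of it.\<close>

lemma test_functions_iff:
  "\<phi> \<in> test_functions \<Omega> \<longleftrightarrow> (\<forall>k. C_k k \<phi>) \<and> (\<exists>K. compact K \<and> K \<subseteq> \<Omega> \<and> (\<forall>x. x \<notin> K \<longrightarrow> \<phi> x = 0))"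
proof
  assume "\<phi> \<in> test_functions \<Omega>"
  moreover have "\<phi> x = 0" if "x \<notin> closure {x. \<phi> x \<noteq> 0}" for x
    using that closure_subset[of "{x. \<phi> x \<noteq> 0}"] by blast
  ultimately show "(\<forall>k. C_k k \<phi>) \<and> (\<exists>K. compact K \<and> K \<subseteq> \<Omega> \<and> (\<forall>x. x \<notin> K \<longrightarrow> \<phi> x = 0))"
    unfolding test_functions_def by blast
next
  assume R: "(\<forall>k. C_k k \<phi>) \<and> (\<exists>K. compact K \<and> K \<subseteq> \<Omega> \<and> (\<forall>x. x \<notin> K \<longrightarrow> \<phi> x = 0))"
  then obtain K where K: "compact K" "K \<subseteq> \<Omega>" "\<And>x. x \<notin> K \<Longrightarrow> \<phi> x = 0" by blast
  then have "closure {x. \<phi> x \<noteq> 0} \<subseteq> K"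
    by (intro closure_minimal compact_imp_closed) auto
  then show "\<phi> \<in> test_functions \<Omega>"
    using R K(2) compact_Int_closed[OF K(1) closed_closure, of "{x. \<phi> x \<noteq> 0}"]
    unfolding test_functions_def mem_Collect_eq by (metis inf.absorb2 order_trans)
qed

lemma test_function_derivative:
  assumes "\<phi> \<in> test_functions \<Omega>"
  shows "(\<phi> has_derivative frechet_derivative \<phi> (at x)) (at x)"
    and "b \<in> Basis \<Longrightarrow> (\<lambda>x. frechet_derivative \<phi> (at x) b) \<in> test_functions \<Omega>"
proof -
  obtain K where K: "compact K" "K \<subseteq> \<Omega>" "\<And>x. x \<notin> K \<Longrightarrow> \<phi> x = 0" and C: "\<And>k. C_k k \<phi>"
    using assms by (auto simp: test_functions_iff)
  show D: "(\<phi> has_derivative frechet_derivative \<phi> (at x)) (at x)" for x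
    using C C_k_Suc_has_derivative by blast
  assume b: "b \<in> Basis"
  have "C_k k (\<lambda>x. frechet_derivative \<phi> (at x) b)" for k
    using C[of "Suc k"] b by simp
  moreover have "frechet_derivative \<phi> (at x) b = 0" if "x \<notin> K" for x
    using derivative_zero_outside[OF D compact_imp_closed[OF K(1)] K(3) that] by metis
  ultimately show "(\<lambda>x. frechet_derivative \<phi> (at x) b) \<in> test_functions \<Omega>"
    using K by (auto simp: test_functions_iff)
qed

lemma test_function_continuous:
  assumes "\<phi> \<in> test_functions \<Omega>" shows "continuous_on UNIV \<phi>"
proof -
  have "C_k 0 \<phi>" using assms unfolding test_functions_def by blast
  then show ?thesis by simp
qed

lemma convol_test_function_derivative:
  assumes "\<rho> \<in> test_functions \<Omega>" "integrable lborel f"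
  shows "(convol \<rho> f has_derivative
      (\<lambda>h. \<Sum>b\<in>Basis. (h \<bullet> b) * convol (\<lambda>z. frechet_derivative \<rho> (at z) b) f x)) (at x)"
proof -
  obtain K where K: "compact K" "K \<subseteq> \<Omega>" "\<And>x. x \<notin> K \<Longrightarrow> \<rho> x = 0"
    using assms by (auto simp: test_functions_iff)
  show ?thesis
    by (rule convol_has_derivative[OF test_function_derivative(1)[OF assms(1)] _ K(1,3) assms(2)])
       (auto intro: test_function_continuous[OF test_function_derivative(2)[OF assms(1)]])
qed

lemma convol_frechet_derivative:
  assumes "\<rho> \<in> test_functions \<Omega>" "integrable lborel f" "b \<in> Basis"
  shows "frechet_derivative (convol \<rho> f) (at x) b = convol (\<lambda>z. frechet_derivative \<rho> (at z) b) f x"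
proof -
  have "frechet_derivative (convol \<rho> f) (at x) =
      (\<lambda>h. \<Sum>b\<in>Basis. (h \<bullet> b) * convol (\<lambda>z. frechet_derivative \<rho> (at z) b) f x)"
    using frechet_derivative_at[OF convol_test_function_derivative[OF assms(1,2)]] by metis
  then show ?thesis
    using assms(3) by (simp add: inner_Basis if_distrib if_distribR cong: if_cong)
qed

lemma C_k_convol:
  assumes "integrable lborel f"
  shows "\<rho> \<in> test_functions \<Omega> \<Longrightarrow> C_k k (convol \<rho> f)"
proof (induction k arbitrary: \<rho>)
  case 0
  then show ?case
    using convol_test_function_derivative[OF 0 assms]
    by (auto intro!: continuous_at_imp_continuous_on has_derivative_continuous)
next
  case (Suc k)
  show ?case
    using convol_test_function_derivative[OF Suc.prems assms]
      convol_frechet_derivative[OF Suc.prems assms]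
      Suc.IH[OF test_function_derivative(2)[OF Suc.prems]]
    by (auto simp: differentiable_def)
qed

section \<open>Density of continuous functions and continuity of translations in L2;
  mollifiers\<close>

lemma L2_dense_continuous:
  fixes f :: "'a::euclidean_space \<Rightarrow> real"
  assumes [measurable]: "f \<in> borel_measurable borel"
    and f2: "integrable lborel (\<lambda>x. (f x)\<^sup>2)" and "\<eta> > 0"
  obtains c K where "continuous_on UNIV c" "compact K" "\<And>x. x \<notin> K \<Longrightarrow> c x = 0"
    "(\<integral>\<^sup>+x. ennreal ((f x - c x)\<^sup>2) \<partial>lborel) \<le> ennreal \<eta>"
proof -
  \<comment> \<open>Truncation in value and in space: F k is bounded, vanishes outside a ball, and
    tends to f in L2 by dominated convergence.\<close>
  define F where "F k x = (if \<bar>f x\<bar> \<le> real k \<and> norm x \<le> real k then f x else 0)" for k :: nat and x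
  have [measurable]: "F k \<in> borel_measurable borel" for k
    unfolding F_def[abs_def] by measurable
  have "(\<lambda>k. LINT x|lborel. (f x - F k x)\<^sup>2) \<longlonglongrightarrow> (LINT x|(lborel :: 'a measure). 0)"
  proof (rule integral_dominated_convergence[where w="\<lambda>x. (f x)\<^sup>2"])
    show "AE x in lborel. (\<lambda>k. (f x - F k x)\<^sup>2) \<longlonglongrightarrow> 0"
    proof (rule AE_I2)
      fix x
      obtain N :: nat where N: "real N \<ge> max \<bar>f x\<bar> (norm x)"
        using real_arch_simple by blast
      have "\<forall>\<^sub>F k in sequentially. (f x - F k x)\<^sup>2 = 0"
        by (rule eventually_sequentiallyI[of N]) (use N in \<open>auto simp: F_def\<close>)
      then show "(\<lambda>k. (f x - F k x)\<^sup>2) \<longlonglongrightarrow> 0"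
        by (simp add: tendsto_eventually)
    qed
  qed (use f2 in \<open>auto simp: F_def\<close>)
  then have "\<forall>\<^sub>F k in sequentially. (LINT x|lborel. (f x - F k x)\<^sup>2) < \<eta> / 4"
    using \<open>\<eta> > 0\<close> by (intro order_tendstoD(2)) auto
  then obtain k where k: "(LINT x|lborel. (f x - F k x)\<^sup>2) < \<eta> / 4"
    by (auto simp: eventually_sequentially)
  have int1: "integrable lborel (\<lambda>x. (f x - F k x)\<^sup>2)"
    by (rule Bochner_Integration.integrable_bound[OF f2]) (auto simp: F_def)
  \<comment> \<open>\<open>measurable_on\<close> supplies continuous functions that converge to F k
    off a negligible set; they take the place of Lusin's theorem.\<close>
  have "F k measurable_on UNIV"
    using measurable_on_iff_borel_measurable[of UNIV "F k"] by (simp add: lebesgue_on_UNIV_eq measurable_completion)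
  then obtain N h where N: "negligible N" and h: "\<And>n. continuous_on UNIV (h n)"
    "\<And>x. x \<notin> N \<Longrightarrow> (\<lambda>n. h n x) \<longlonglongrightarrow> F k x"
    unfolding measurable_on_def by auto
  \<comment> \<open>\<open>\<psi>\<close> is 1 on the ball of radius k and 0 outside that of radius
    k + 1. Clamping to [-k, k] and multiplying by \<open>\<psi>\<close> does not change the limit F
    k, but makes the approximants dominated and compactly supported.\<close>
  define \<psi> :: "'a \<Rightarrow> real" where "\<psi> x = max 0 (min 1 (k + 1 - norm x))" for x
  have \<psi>: "continuous_on UNIV \<psi>" unfolding \<psi>_def[abs_def] by (intro continuous_intros)
  define c where "c n x = max (- real k) (min (real k) (h n x)) * \<psi> x" for n x
  have c: "continuous_on UNIV (c n)" for n
    unfolding c_def[abs_def] by (intro continuous_intros \<psi> h)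
  then have [measurable]: "c n \<in> borel_measurable borel" for n
    by (rule borel_measurable_continuous_onI)
  define K where "K = cball (0::'a) (k + 1)"
  have c0: "c n x = 0" if "x \<notin> K" for n x
    using that by (simp add: c_def \<psi>_def K_def)
  have bound: "\<bar>F k x - c n x\<bar> \<le> 2 * k * indicator K x" for n x
  proof (cases "x \<in> K")
    case True
    have "\<bar>c n x\<bar> \<le> real k * 1"
      unfolding c_def abs_mult by (rule mult_mono) (auto simp: \<psi>_def)
    moreover have "\<bar>F k x\<bar> \<le> k" by (simp add: F_def)
    ultimately show ?thesis using True by simp
  next
    case False
    then show ?thesis using c0[OF False] by (auto simp: F_def K_def)
  qed
  have Kfin: "emeasure lborel K < \<infinity>" "K \<in> sets lborel"
    using emeasure_compact_finite[OF compact_cball[of "0::'a" "real k + 1"]] by (auto simp: K_def add.commute)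
  have wint: "integrable lborel (\<lambda>x. 4 * (real k)\<^sup>2 * indicator K x)"
    using Kfin by auto
  have bound2: "(F k x - c n x)\<^sup>2 \<le> 4 * (real k)\<^sup>2 * indicator K x" for n x
    using power_mono[OF bound[of x n] abs_ge_zero, of 2]
    by (auto simp: power_mult_distrib indicator_def)
  have "(\<lambda>n. LINT x|lborel. (F k x - c n x)\<^sup>2) \<longlonglongrightarrow> (LINT x|(lborel :: 'a measure). 0)"
  proof (rule integral_dominated_convergence[OF _ _ wint])
    have "AE x in lborel. x \<notin> N"
      using AE_not_in[of N lebesgue] N unfolding negligible_iff_null_sets AE_completion_iff by blast
    then show "AE x in lborel. (\<lambda>n. (F k x - c n x)\<^sup>2) \<longlonglongrightarrow> 0"
    proof eventually_elim
      fix x assume "x \<notin> N"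
      have "(\<lambda>n. max (- real k) (min (real k) (h n x)) * \<psi> x)
          \<longlonglongrightarrow> max (- real k) (min (real k) (F k x)) * \<psi> x"
        by (intro tendsto_intros h \<open>x \<notin> N\<close>)
      also have "max (- real k) (min (real k) (F k x)) * \<psi> x = F k x"
        by (auto simp: F_def \<psi>_def max_def min_def abs_le_iff)
      finally have "(\<lambda>n. c n x) \<longlonglongrightarrow> F k x" by (simp add: c_def)
      then have "(\<lambda>n. (F k x - c n x)\<^sup>2) \<longlonglongrightarrow> (F k x - F k x)\<^sup>2"
        by (intro tendsto_intros)
      then show "(\<lambda>n. (F k x - c n x)\<^sup>2) \<longlonglongrightarrow> 0" by simp
    qed
  qed (use bound2 in auto)
  then have "\<forall>\<^sub>F n in sequentially. (LINT x|lborel. (F k x - c n x)\<^sup>2) < \<eta> / 4"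
    using \<open>\<eta> > 0\<close> by (intro order_tendstoD(2)) auto
  then obtain n where n: "(LINT x|lborel. (F k x - c n x)\<^sup>2) < \<eta> / 4"
    by (auto simp: eventually_sequentially)
  have int2: "integrable lborel (\<lambda>x. (F k x - c n x)\<^sup>2)"
    by (rule Bochner_Integration.integrable_bound[OF wint]) (use bound2 in auto)
  have sq: "(f x - c n x)\<^sup>2 \<le> 2 * (f x - F k x)\<^sup>2 + 2 * (F k x - c n x)\<^sup>2" for x
    using sum_squares_ge_zero[of "(f x - F k x) - (F k x - c n x)" 0]
    by (simp add: power2_eq_square algebra_simps)
  have "(\<integral>\<^sup>+x. ennreal ((f x - c n x)\<^sup>2) \<partial>lborel)
      \<le> (\<integral>\<^sup>+x. ennreal (2 * (f x - F k x)\<^sup>2 + 2 * (F k x - c n x)\<^sup>2) \<partial>lborel)"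
    by (intro nn_integral_mono ennreal_leI sq)
  also have "\<dots> = ennreal (LINT x|lborel. 2 * (f x - F k x)\<^sup>2 + 2 * (F k x - c n x)\<^sup>2)"
    using int1 int2 by (intro nn_integral_eq_integral) auto
  also have "\<dots> \<le> ennreal \<eta>"
    using int1 int2 k n by (intro ennreal_leI) simp
  finally show ?thesis
    using that[OF c[of n], of K] c0 by (simp add: K_def)
qed

text \<open>Compare f with a continuous c of compact support. Uniform continuity handles the
  translation of c, and translation invariance makes the error f - c equally small at x - z and at
  x. Squaring a sum of three terms costs a factor 3, so three errors of \<open>\<eta> / 9\<close>
  add up to \<open>\<eta>\<close>.\<close>

lemma L2_translation_continuous:
  fixes f :: "'a::euclidean_space \<Rightarrow> real"
  assumes [measurable]: "f \<in> borel_measurable borel"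
    and f2: "integrable lborel (\<lambda>x. (f x)\<^sup>2)" and "\<eta> > 0"
  obtains d where "d > 0"
    "\<And>z. norm z < d \<Longrightarrow> (\<integral>\<^sup>+x. ennreal ((f (x - z) - f x)\<^sup>2) \<partial>lborel) \<le> ennreal \<eta>"
proof -
  obtain c K where c: "continuous_on UNIV c" and K: "compact K" "\<And>x. x \<notin> K \<Longrightarrow> c x = 0"
    and fc: "(\<integral>\<^sup>+x. ennreal ((f x - c x)\<^sup>2) \<partial>lborel) \<le> ennreal (\<eta> / 9)"
    using L2_dense_continuous[OF assms(1) f2, of "\<eta> / 9"] \<open>\<eta> > 0\<close> by auto
  have [measurable]: "c \<in> borel_measurable borel"
    using c by (rule borel_measurable_continuous_onI)
  let ?K = "(\<Union>x\<in>K. \<Union>y\<in>cball 0 1. {x + y})"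
  have "compact ?K" using compact_sums'[OF K(1) compact_cball] by simp
  define C where "C = measure lborel ?K"
  have fin: "emeasure lborel ?K < \<infinity>" "?K \<in> sets lborel"
    using emeasure_compact_finite[OF \<open>compact ?K\<close>] borel_compact[OF \<open>compact ?K\<close>] by auto
  have C: "C \<ge> 0" "emeasure lborel ?K = ennreal C"
    using fin by (auto simp: C_def emeasure_eq_ennreal_measure)
  \<comment> \<open>Chosen so that \<open>\<delta>\<^sup>2 * C\<close> is at most
    \<open>\<eta> / 9\<close>, where C is the area of the enlarged support; the summand 1 covers C =
    0.\<close>
  define \<delta> where "\<delta> = sqrt (\<eta> / 9 / (C + 1))"
  have "\<delta> > 0" using \<open>\<eta> > 0\<close> C(1) by (simp add: \<delta>_def)
  obtain d where d: "d > 0" "\<And>x y. dist x y < d \<Longrightarrow> \<bar>c x - c y\<bar> < \<delta>"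
    using uniformly_continuous_compact_support[OF c K] \<open>\<delta> > 0\<close>
    unfolding uniformly_continuous_on_def dist_real_def by (metis UNIV_I)
  show ?thesis
  proof (rule that[of "min d 1"])
    fix z :: 'a assume z: "norm z < min d 1"
    have "(c (x - z) - c x)\<^sup>2 \<le> \<delta>\<^sup>2 * indicator ?K x" for x
    proof (cases "x \<in> ?K")
      case True
      have "\<bar>c (x - z) - c x\<bar> \<le> \<delta>"
        using d(2)[of "x - z" x] z by (simp add: dist_norm less_imp_le)
      then have "(c (x - z) - c x)\<^sup>2 \<le> \<delta>\<^sup>2"
        by (simp add: abs_le_square_iff[symmetric])
      with True show ?thesis by simp
    next
      case False
      have "x \<notin> K"
      proof
        assume "x \<in> K"
        then have "x + 0 \<in> ?K" by (intro UN_I[of x] UN_I[of 0]) auto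
        with False show False by simp
      qed
      moreover have "x - z \<notin> K"
      proof
        assume "x - z \<in> K"
        then have "(x - z) + z \<in> ?K" using z by (intro UN_I[of "x - z"] UN_I[of z]) auto
        with False show False by simp
      qed
      ultimately show ?thesis using K(2) by simp
    qed
    then have "(\<integral>\<^sup>+x. ennreal ((c (x - z) - c x)\<^sup>2) \<partial>lborel) \<le> (\<integral>\<^sup>+x. ennreal (\<delta>\<^sup>2 * indicator ?K x) \<partial>lborel)"
      by (intro nn_integral_mono ennreal_leI)
    also have "\<dots> = (\<integral>\<^sup>+x. ennreal (\<delta>\<^sup>2) * indicator ?K x \<partial>lborel)"
      by (intro nn_integral_cong) (auto simp: indicator_def)
    also have "\<dots> = ennreal (\<delta>\<^sup>2 * C)"
      using fin C by (subst nn_integral_cmult_indicator) (auto simp: ennreal_mult)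
    also have "\<dots> \<le> ennreal (\<eta> / 9)"
      using \<open>\<eta> > 0\<close> C(1) by (intro ennreal_leI) (auto simp: \<delta>_def field_simps)
    finally have cc: "(\<integral>\<^sup>+x. ennreal ((c (x - z) - c x)\<^sup>2) \<partial>lborel) \<le> ennreal (\<eta> / 9)" .
    have fcz: "(\<integral>\<^sup>+x. ennreal ((f (x - z) - c (x - z))\<^sup>2) \<partial>lborel) \<le> ennreal (\<eta> / 9)"
      using lborel_nn_integral_minus_right[of "\<lambda>x. ennreal ((f x - c x)\<^sup>2)" z] fc by simp
    have sq: "(f (x - z) - f x)\<^sup>2
        \<le> 3 * ((f (x - z) - c (x - z))\<^sup>2 + (c (x - z) - c x)\<^sup>2 + (f x - c x)\<^sup>2)" for x
    proof -
      have "(p + q - r)\<^sup>2 \<le> 3 * (p\<^sup>2 + q\<^sup>2 + r\<^sup>2)" for p q r :: real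
      proof -
        have "3 * (p\<^sup>2 + q\<^sup>2 + r\<^sup>2) - (p + q - r)\<^sup>2 = (p - q)\<^sup>2 + (p + r)\<^sup>2 + (q + r)\<^sup>2"
          by (simp add: power2_eq_square algebra_simps)
        then show ?thesis by (smt (verit) zero_le_power2)
      qed
      from this[of "f (x - z) - c (x - z)" "c (x - z) - c x" "f x - c x"] show ?thesis by simp
    qed
    have "(\<integral>\<^sup>+x. ennreal ((f (x - z) - f x)\<^sup>2) \<partial>lborel)
      \<le> (\<integral>\<^sup>+x. 3 * (ennreal ((f (x - z) - c (x - z))\<^sup>2) + ennreal ((c (x - z) - c x)\<^sup>2) + ennreal ((f x - c x)\<^sup>2)) \<partial>lborel)"
    proof (rule nn_integral_mono)
      fix x
      show "ennreal ((f (x - z) - f x)\<^sup>2) \<le>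
        3 * (ennreal ((f (x - z) - c (x - z))\<^sup>2) + ennreal ((c (x - z) - c x)\<^sup>2) + ennreal ((f x - c x)\<^sup>2))"
        using ennreal_leI[OF sq[of x]] by (subst (asm) ennreal_mult) auto
    qed
    also have "\<dots> = 3 * ((\<integral>\<^sup>+x. ennreal ((f (x - z) - c (x - z))\<^sup>2) \<partial>lborel)
        + (\<integral>\<^sup>+x. ennreal ((c (x - z) - c x)\<^sup>2) \<partial>lborel) + (\<integral>\<^sup>+x. ennreal ((f x - c x)\<^sup>2) \<partial>lborel))"
      by (simp add: nn_integral_cmult nn_integral_add)
    also have "\<dots> \<le> 3 * (ennreal (\<eta> / 9) + ennreal (\<eta> / 9) + ennreal (\<eta> / 9))"
      by (intro mult_left_mono add_mono fc cc fcz) auto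
    also have "\<dots> = ennreal 3 * ennreal (\<eta> / 9 + \<eta> / 9 + \<eta> / 9)"
      using \<open>\<eta> > 0\<close> by (simp add: ennreal_plus[symmetric] del: ennreal_plus)
    also have "\<dots> = ennreal \<eta>"
      using \<open>\<eta> > 0\<close> by (subst ennreal_mult[symmetric]) auto
    finally show "(\<integral>\<^sup>+x. ennreal ((f (x - z) - f x)\<^sup>2) \<partial>lborel) \<le> ennreal \<eta>" .
  qed (use d in simp)
qed

text \<open>An arbitrary kernel of scale e instead of a rescaled fixed profile: the estimates use
  only smoothness, sign, support and mass, so each scale may have a kernel of its own.\<close>

definition mollifier :: "real \<Rightarrow> ('a::euclidean_space \<Rightarrow> real) \<Rightarrow> bool" where
  "mollifier e \<rho> \<longleftrightarrow> \<rho> \<in> test_functions UNIV \<and> (\<forall>x. \<rho> x \<ge> 0) \<and> (\<forall>x. norm x \<ge> e \<longrightarrow> \<rho> x = 0) \<and>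
     (LINT x|lborel. \<rho> x) = 1"

lemma mollifier_exists:
  assumes "e > 0"
  obtains \<rho> :: "'a::euclidean_space \<Rightarrow> real" where "mollifier e \<rho>"
proof -
  \<comment> \<open>A point of the open cube of half-width c has l1 norm less than e, so the cube
    lies in the ball of radius e.\<close>
  define c where "c = e / DIM('a)"
  have "c > 0" using assms by (simp add: c_def)
  define \<beta> :: "'a \<Rightarrow> real" where "\<beta> = box_bump (- c *\<^sub>R One) (c *\<^sub>R One)"
  let ?B = "box (- c *\<^sub>R One) (c *\<^sub>R (One::'a))"
  have test: "\<beta> \<in> test_functions UNIV"
    unfolding \<beta>_def by (rule box_bump_test_function) simp
  have small: "norm x < e" if "x \<in> ?B" for x
  proof -
    have "\<bar>x \<bullet> i\<bar> < c" if "i \<in> Basis" for i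
      using \<open>x \<in> ?B\<close> that by (auto simp: mem_box)
    then have "(\<Sum>i\<in>Basis. \<bar>x \<bullet> i\<bar>) < (\<Sum>i\<in>(Basis::'a set). c)"
      by (rule sum_strict_mono[rotated 2]) auto
    then show ?thesis
      using norm_le_l1[of x] by (simp add: c_def)
  qed
  have "compact (cbox (- c *\<^sub>R One) (c *\<^sub>R (One::'a)))" by simp
  moreover have "\<beta> x = 0" if "x \<notin> cbox (- c *\<^sub>R One) (c *\<^sub>R One)" for x
    using that box_subset_cbox unfolding \<beta>_def box_bump_eq_0_iff by blast
  ultimately have int: "integrable lborel \<beta>"
    using test_function_continuous[OF test] integrable_compact_support by blast
  have nn: "\<beta> x \<ge> 0" for x by (simp add: \<beta>_def box_bump_nonneg)
  have "(LINT x|lborel. \<beta> x) \<noteq> 0"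
  proof
    assume "(LINT x|lborel. \<beta> x) = 0"
    then have "AE x in lborel. \<beta> x = 0"
      using integral_nonneg_eq_0_iff_AE[OF int] nn by simp
    then have "AE x in lborel. x \<notin> ?B"
      by (simp add: \<beta>_def box_bump_eq_0_iff)
    then have "emeasure lborel ?B = 0"
      by (subst (asm) AE_iff_measurable[of ?B]) auto
    moreover have "emeasure lborel ?B > 0"
    proof -
      have "(\<Prod>i\<in>Basis. (c *\<^sub>R One - (- c *\<^sub>R One)) \<bullet> (i::'a)) = (\<Prod>i\<in>(Basis::'a set). 2 * c)"
        by (intro prod.cong) (auto simp: inner_add_left)
      also have "\<dots> > 0" using \<open>c > 0\<close> by (intro prod_pos) auto
      finally show ?thesis
        using \<open>c > 0\<close> by (subst emeasure_lborel_box) auto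
    qed
    ultimately show False by simp
  qed
  then have pos: "(LINT x|lborel. \<beta> x) > 0"
    using integral_nonneg_AE[of \<beta> lborel] nn by (simp add: less_le)
  define \<rho> where "\<rho> x = inverse (LINT x|lborel. \<beta> x) * \<beta> x" for x
  have "mollifier e \<rho>"
    unfolding mollifier_def
  proof (intro conjI allI impI)
    show "\<rho> \<in> test_functions UNIV"
      using test unfolding \<rho>_def[abs_def] test_functions_iff by (auto intro: C_k_mult C_k_const)
    show "\<rho> x \<ge> 0" for x using pos nn by (simp add: \<rho>_def)
    show "\<rho> x = 0" if "norm x \<ge> e" for x
    proof -
      have "x \<notin> ?B" using small[of x] that by auto
      then show ?thesis by (simp add: \<rho>_def \<beta>_def box_bump_eq_0_iff)
    qed
    show "(LINT x|lborel. \<rho> x) = 1" using pos by (simp add: \<rho>_def)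
  qed
  with that show ?thesis .
qed

lemma mollifierD:
  assumes "mollifier e \<rho>"
  shows "\<rho> \<in> test_functions UNIV" "\<rho> x \<ge> 0" "norm x \<ge> e \<Longrightarrow> \<rho> x = 0" "(LINT x|lborel. \<rho> x) = 1"
    "continuous_on UNIV \<rho>" "\<rho> \<in> borel_measurable borel" "integrable lborel \<rho>"
    "(\<integral>\<^sup>+x. ennreal (\<rho> x) \<partial>lborel) = 1"
proof -
  show test: "\<rho> \<in> test_functions UNIV" and nn: "\<rho> x \<ge> 0" and out: "norm x \<ge> e \<Longrightarrow> \<rho> x = 0"
    and one: "(LINT x|lborel. \<rho> x) = 1" for x
    using assms by (auto simp: mollifier_def)
  show cont: "continuous_on UNIV \<rho>" using test_function_continuous[OF test] .
  then show "\<rho> \<in> borel_measurable borel" by (rule borel_measurable_continuous_onI)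
  show int: "integrable lborel \<rho>"
    by (rule integrable_compact_support[OF cont compact_cball[of 0 e]]) (use out in auto)
  show "(\<integral>\<^sup>+x. ennreal (\<rho> x) \<partial>lborel) = 1"
    using nn_integral_eq_integral[OF int] nn one by simp
qed

lemma convol_mollifier_diff:
  fixes f :: "'a::euclidean_space \<Rightarrow> real"
  assumes \<rho>: "mollifier e \<rho>" and f: "integrable lborel f"
  shows "integrable lborel (\<lambda>z. \<rho> z * (f (x - z) - f x))"
    and "convol \<rho> f x - f x = (LINT z|lborel. \<rho> z * (f (x - z) - f x))"
proof -
  note \<rho>D = mollifierD[OF \<rho>]
  have int: "integrable lborel (\<lambda>y. \<rho> (x - y) * f y)"
    by (rule convol_integrable[OF \<rho>D(5) compact_cball[of 0 e] _ f]) (use \<rho>D(3) in auto)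
  have int': "integrable lborel (\<lambda>z. \<rho> z * f (x - z))"
    using lborel_integrable_reflect[OF int, of x] by simp
  have "(\<lambda>z. \<rho> z * (f (x - z) - f x)) = (\<lambda>z. \<rho> z * f (x - z) - \<rho> z * f x)"
    by (simp add: algebra_simps)
  then show "integrable lborel (\<lambda>z. \<rho> z * (f (x - z) - f x))"
    using int' \<rho>D(7) by simp
  have "convol \<rho> f x = (LINT z|lborel. \<rho> z * f (x - z))"
    unfolding convol_def using lborel_integral_reflect[of "\<lambda>y. \<rho> (x - y) * f y" x] int by simp
  then show "convol \<rho> f x - f x = (LINT z|lborel. \<rho> z * (f (x - z) - f x))"
    using int' \<rho>D(4,7) by (simp add: right_diff_distrib)
qed

lemma convol_mollifier_uniform:
  fixes f :: "'a::euclidean_space \<Rightarrow> real"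
  assumes \<rho>: "mollifier e \<rho>" and f: "integrable lborel f"
    and d: "\<And>z. norm z < e \<Longrightarrow> \<bar>f (x - z) - f x\<bar> \<le> \<eta>"
  shows "\<bar>convol \<rho> f x - f x\<bar> \<le> \<eta>"
proof -
  note \<rho>D = mollifierD[OF \<rho>]
  have "\<bar>convol \<rho> f x - f x\<bar> \<le> (LINT z|lborel. \<bar>\<rho> z * (f (x - z) - f x)\<bar>)"
    unfolding convol_mollifier_diff(2)[OF \<rho> f] by (rule integral_abs_bound)
  also have "\<dots> \<le> (LINT z|lborel. \<rho> z * \<eta>)"
  proof (rule integral_mono)
    show "\<bar>\<rho> z * (f (x - z) - f x)\<bar> \<le> \<rho> z * \<eta>" for z
      using \<rho>D(2)[of z] \<rho>D(3)[of z] d[of z]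
      by (cases "norm z < e") (auto simp: abs_mult intro: mult_left_mono)
  qed (use \<rho>D(7) convol_mollifier_diff(1)[OF \<rho> f] in auto)
  also have "\<dots> = \<eta>" using \<rho>D(4) by simp
  finally show ?thesis .
qed

text \<open>Jensen's inequality, obtained by writing the kernel as the product of two square roots
  and applying Cauchy-Schwarz with total mass 1. Exchanging the integrals then bounds the error by
  an average of translation errors over |z| < e.\<close>

lemma convol_mollifier_L2:
  fixes f :: "'a::euclidean_space \<Rightarrow> real"
  assumes \<rho>: "mollifier e \<rho>" and f: "integrable lborel f"
    and d: "\<And>z. norm z < e \<Longrightarrow> (\<integral>\<^sup>+x. ennreal ((f (x - z) - f x)\<^sup>2) \<partial>lborel) \<le> \<eta>"
  shows "(\<integral>\<^sup>+x. ennreal ((convol \<rho> f x - f x)\<^sup>2) \<partial>lborel) \<le> \<eta>"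
proof -
  note \<rho>D = mollifierD[OF \<rho>]
  note [measurable] = \<rho>D(6)
  have [measurable]: "f \<in> borel_measurable borel" using f by auto
  have pt: "ennreal ((convol \<rho> f x - f x)\<^sup>2) \<le> (\<integral>\<^sup>+z. ennreal (\<rho> z * (f (x - z) - f x)\<^sup>2) \<partial>lborel)" for x
  proof -
    have "ennreal \<bar>convol \<rho> f x - f x\<bar> \<le> (\<integral>\<^sup>+z. ennreal \<bar>\<rho> z * (f (x - z) - f x)\<bar> \<partial>lborel)"
      unfolding convol_mollifier_diff(2)[OF \<rho> f]
      using integral_norm_bound_ennreal[OF convol_mollifier_diff(1)[OF \<rho> f, of x]] by simp
    also have "\<dots> = (\<integral>\<^sup>+z. ennreal (sqrt (\<rho> z)) * ennreal (sqrt (\<rho> z) * \<bar>f (x - z) - f x\<bar>) \<partial>lborel)"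
      using \<rho>D(2) by (intro nn_integral_cong)
        (simp add: ennreal_mult[symmetric] abs_mult mult.assoc[symmetric])
    finally have "(ennreal \<bar>convol \<rho> f x - f x\<bar>)\<^sup>2 \<le>
        (\<integral>\<^sup>+z. ennreal (sqrt (\<rho> z)) * ennreal (sqrt (\<rho> z) * \<bar>f (x - z) - f x\<bar>) \<partial>lborel)\<^sup>2"
      by (intro power_mono) auto
    also have "\<dots> \<le> (\<integral>\<^sup>+z. (ennreal (sqrt (\<rho> z)))\<^sup>2 \<partial>lborel) *
        (\<integral>\<^sup>+z. (ennreal (sqrt (\<rho> z) * \<bar>f (x - z) - f x\<bar>))\<^sup>2 \<partial>lborel)"
      by (rule Cauchy_Schwarz_nn_integral) auto
    also have "(\<integral>\<^sup>+z. (ennreal (sqrt (\<rho> z)))\<^sup>2 \<partial>lborel) = 1"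
      using \<rho>D(2,8) by (simp add: ennreal_power)
    also have "(\<integral>\<^sup>+z. (ennreal (sqrt (\<rho> z) * \<bar>f (x - z) - f x\<bar>))\<^sup>2 \<partial>lborel)
        = (\<integral>\<^sup>+z. ennreal (\<rho> z * (f (x - z) - f x)\<^sup>2) \<partial>lborel)"
      using \<rho>D(2) by (intro nn_integral_cong) (simp add: ennreal_power power_mult_distrib)
    finally show ?thesis by (simp add: ennreal_power)
  qed
  have "(\<integral>\<^sup>+x. ennreal ((convol \<rho> f x - f x)\<^sup>2) \<partial>lborel)
     \<le> (\<integral>\<^sup>+x. (\<integral>\<^sup>+z. ennreal (\<rho> z * (f (x - z) - f x)\<^sup>2) \<partial>lborel) \<partial>lborel)"
    by (intro nn_integral_mono pt)
  also have "\<dots> = (\<integral>\<^sup>+z. (\<integral>\<^sup>+x. ennreal (\<rho> z * (f (x - z) - f x)\<^sup>2) \<partial>lborel) \<partial>lborel)"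
    by (rule lborel_pair.Fubini') simp
  also have "\<dots> = (\<integral>\<^sup>+z. ennreal (\<rho> z) * (\<integral>\<^sup>+x. ennreal ((f (x - z) - f x)\<^sup>2) \<partial>lborel) \<partial>lborel)"
    using \<rho>D(2) by (intro nn_integral_cong) (simp add: ennreal_mult nn_integral_cmult)
  also have "\<dots> \<le> (\<integral>\<^sup>+z. ennreal (\<rho> z) * \<eta> \<partial>lborel)"
  proof (rule nn_integral_mono)
    show "ennreal (\<rho> z) * (\<integral>\<^sup>+x. ennreal ((f (x - z) - f x)\<^sup>2) \<partial>lborel) \<le> ennreal (\<rho> z) * \<eta>" for z
      using d[of z] \<rho>D(3)[of z] by (cases "norm z < e") (auto intro: mult_left_mono)
  qed
  also have "\<dots> = \<eta>"
    using \<rho>D(8) by (simp add: nn_integral_multc)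
  finally show ?thesis .
qed

lemma convol_tendsto_L2:
  fixes f :: "'a::euclidean_space \<Rightarrow> real"
  assumes \<rho>: "\<And>n. mollifier (e n) (\<rho> n)" and e: "e \<longlonglongrightarrow> 0"
    and f: "integrable lborel f" "integrable lborel (\<lambda>x. (f x)\<^sup>2)"
  shows "(\<lambda>n. \<integral>\<^sup>+x. ennreal ((convol (\<rho> n) f x - f x)\<^sup>2) \<partial>lborel) \<longlonglongrightarrow> 0"
proof (rule order_tendstoI)
  fix a :: ennreal assume "0 < a"
  then obtain \<eta> where \<eta>: "\<eta> > 0" "ennreal \<eta> < a"
    proof -
      obtain b where b: "0 < b" "b < a" using dense[OF \<open>0 < a\<close>] by blast
      then have "b < top" by (auto intro: less_le_trans)
      then obtain r where "r \<ge> 0" "b = ennreal r" by (cases b) auto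
      with b that show thesis by auto
    qed
  obtain d where d: "d > 0"
    "\<And>z. norm z < d \<Longrightarrow> (\<integral>\<^sup>+x. ennreal ((f (x - z) - f x)\<^sup>2) \<partial>lborel) \<le> ennreal \<eta>"
    using L2_translation_continuous[OF _ f(2) \<eta>(1)] f(1) by auto
  have "\<forall>\<^sub>F n in sequentially. e n < d"
    using e d(1) by (rule order_tendstoD(2))
  then show "\<forall>\<^sub>F n in sequentially. (\<integral>\<^sup>+x. ennreal ((convol (\<rho> n) f x - f x)\<^sup>2) \<partial>lborel) < a"
  proof eventually_elim
    case (elim n)
    then have "(\<integral>\<^sup>+x. ennreal ((convol (\<rho> n) f x - f x)\<^sup>2) \<partial>lborel) \<le> ennreal \<eta>"
      by (intro convol_mollifier_L2[OF \<rho> f(1)] d(2)) auto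
    with \<eta>(2) show ?case by simp
  qed
qed auto

lemma convol_uniform_limit:
  fixes f :: "'a::euclidean_space \<Rightarrow> real"
  assumes \<rho>: "\<And>n. mollifier (e n) (\<rho> n)" and e: "e \<longlonglongrightarrow> 0"
    and f: "continuous_on UNIV f" "compact K" "\<And>x. x \<notin> K \<Longrightarrow> f x = 0"
  shows "uniform_limit UNIV (\<lambda>n. convol (\<rho> n) f) f sequentially"
proof (rule uniform_limitI)
  fix \<eta> :: real assume "\<eta> > 0"
  then obtain d where d: "d > 0" "\<And>x y. dist x y < d \<Longrightarrow> \<bar>f x - f y\<bar> < \<eta> / 2"
    using uniformly_continuous_compact_support[OF f] half_gt_zero
    unfolding uniformly_continuous_on_def dist_real_def by (metis UNIV_I)
  have "\<forall>\<^sub>F n in sequentially. e n < d"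
    using e d(1) by (rule order_tendstoD(2))
  then show "\<forall>\<^sub>F n in sequentially. \<forall>x\<in>UNIV. dist (convol (\<rho> n) f x) (f x) < \<eta>"
  proof eventually_elim
    case (elim n)
    have "\<bar>convol (\<rho> n) f x - f x\<bar> \<le> \<eta> / 2" for x
      by (rule convol_mollifier_uniform[OF \<rho> integrable_compact_support[OF f]])
         (use d(2) elim in \<open>auto simp: dist_norm less_imp_le\<close>)
    with \<open>\<eta> > 0\<close> show ?case by (smt (verit) dist_real_def field_sum_of_halves)
  qed
qed

lemma convol_zero_outside:
  fixes f :: "'a::euclidean_space \<Rightarrow> real"
  assumes \<rho>: "mollifier e \<rho>" and "\<And>x. x \<notin> K \<Longrightarrow> f x = 0"
    and "x \<notin> (\<Union>y\<in>K. \<Union>z\<in>cball 0 e. {y + z})"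
  shows "convol \<rho> f x = 0"
proof -
  have "\<rho> (x - y) * f y = 0" for y
  proof (cases "y \<in> K \<and> norm (x - y) \<le> e")
    case True
    then have "y + (x - y) \<in> (\<Union>y\<in>K. \<Union>z\<in>cball 0 e. {y + z})"
      by (intro UN_I[of y] UN_I[of "x - y"]) auto
    with assms(3) show ?thesis by simp
  next
    case False
    then show ?thesis using assms(2)[of y] mollifierD(3)[OF \<rho>, of "x - y"] by auto
  qed
  then have "(\<lambda>y. \<rho> (x - y) * f y) = (\<lambda>y. 0)" by blast
  then show ?thesis by (simp only: convol_def) simp
qed

section \<open>Weak gradients\<close>

text \<open>Bridges the definitions, which integrate over \<open>lebesgue_on \<Omega>\<close>, and
  the computations on the whole space: test functions and cut-off functions vanish outside
  \<open>\<Omega>\<close>.\<close>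

lemma
  fixes f :: "'a::euclidean_space \<Rightarrow> 'b::euclidean_space"
  assumes \<Omega>: "\<Omega> \<in> sets lebesgue" and out: "\<And>x. x \<notin> \<Omega> \<Longrightarrow> f x = 0"
  shows integral_lebesgue_on_zero_outside: "(LINT x|lebesgue_on \<Omega>. f x) = (LINT x|lebesgue. f x)"
    and integrable_lebesgue_on_zero_outside: "integrable (lebesgue_on \<Omega>) f \<longleftrightarrow> integrable lebesgue f"
    and measurable_lebesgue_on_zero_outside:
      "f \<in> borel_measurable (lebesgue_on \<Omega>) \<longleftrightarrow> f \<in> borel_measurable lebesgue"
proof -
  have eq: "(\<lambda>x. if x \<in> \<Omega> then f x else 0) = f" using out by auto
  show "(LINT x|lebesgue_on \<Omega>. f x) = (LINT x|lebesgue. f x)"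
    using Lebesgue_Measure.integral_restrict_UNIV[OF \<Omega>, of f] by (simp add: eq)
  show "integrable (lebesgue_on \<Omega>) f \<longleftrightarrow> integrable lebesgue f"
    using Lebesgue_Measure.integrable_restrict_UNIV[OF \<Omega>, of f] by (simp add: eq)
  show "f \<in> borel_measurable (lebesgue_on \<Omega>) \<longleftrightarrow> f \<in> borel_measurable lebesgue"
    using borel_measurable_if_I[OF _ \<Omega>, of f] borel_measurable_if_D[of \<Omega> f] unfolding eq by blast
qed

lemma nn_integral_lebesgue_on_zero_outside:
  assumes \<Omega>: "\<Omega> \<in> sets lebesgue" and out: "\<And>x. x \<notin> \<Omega> \<Longrightarrow> f x = 0"
  shows "(\<integral>\<^sup>+x. f x \<partial>lebesgue_on \<Omega>) = (\<integral>\<^sup>+x. f x \<partial>lebesgue)"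
proof -
  have "(\<lambda>x. f x * indicator \<Omega> x) = f"
    using out by (auto simp: indicator_def fun_eq_iff)
  then show ?thesis
    using nn_integral_restrict_space[of \<Omega> lebesgue f] \<Omega> by simp
qed

lemma borel_measurable_lebesgue_on_continuous:
  fixes f :: "'a::euclidean_space \<Rightarrow> 'b::euclidean_space"
  assumes "continuous_on UNIV f"
  shows "f \<in> borel_measurable (lebesgue_on S)"
  using borel_measurable_continuous_onI[OF assms]
  by (intro measurable_restrict_space1 measurable_completion) auto

lemma L2_borel_measurable: "f \<in> L2 \<Omega> \<Longrightarrow> f \<in> borel_measurable (lebesgue_on \<Omega>)"
  by (simp add: L2_def)

lemma L2_integrable_square:
  assumes "f \<in> L2 \<Omega>"
  shows "integrable (lebesgue_on \<Omega>) (\<lambda>x. (norm (f x))\<^sup>2)"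
  using assms by (simp add: L2_def)

lemma L2_bound:
  fixes f :: "'a::euclidean_space \<Rightarrow> 'b::euclidean_space" and g :: "'a \<Rightarrow> 'c::euclidean_space"
  assumes "f \<in> L2 \<Omega>" "g \<in> borel_measurable (lebesgue_on \<Omega>)"
    and "\<And>x. x \<in> \<Omega> \<Longrightarrow> norm (g x) \<le> B * norm (f x)"
  shows "g \<in> L2 \<Omega>"
proof -
  have "integrable (lebesgue_on \<Omega>) (\<lambda>x. (norm (g x))\<^sup>2)"
  proof (rule Bochner_Integration.integrable_bound)
    show "integrable (lebesgue_on \<Omega>) (\<lambda>x. B\<^sup>2 * (norm (f x))\<^sup>2)"
      using L2_integrable_square[OF assms(1)] by simp
    show "(\<lambda>x. (norm (g x))\<^sup>2) \<in> borel_measurable (lebesgue_on \<Omega>)"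
      using assms(2) by measurable
    show "AE x in lebesgue_on \<Omega>. norm ((norm (g x))\<^sup>2) \<le> norm (B\<^sup>2 * (norm (f x))\<^sup>2)"
      using power_mono[OF assms(3) norm_ge_zero, of _ 2]
      by (intro AE_I2) (simp add: power_mult_distrib abs_mult)
  qed
  with assms(2) show ?thesis by (simp add: L2_def)
qed

lemma L2_add:
  assumes "f \<in> L2 \<Omega>" "g \<in> L2 \<Omega>"
  shows "(\<lambda>x. f x + g x) \<in> L2 \<Omega>"
proof -
  note [measurable] = L2_borel_measurable[OF assms(1)] L2_borel_measurable[OF assms(2)]
  have "integrable (lebesgue_on \<Omega>) (\<lambda>x. (norm (f x + g x))\<^sup>2)"
  proof (rule Bochner_Integration.integrable_bound)
    show "integrable (lebesgue_on \<Omega>) (\<lambda>x. 2 * (norm (f x))\<^sup>2 + 2 * (norm (g x))\<^sup>2)"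
      using assms L2_integrable_square by (intro Bochner_Integration.integrable_add) auto
    show "AE x in lebesgue_on \<Omega>. norm ((norm (f x + g x))\<^sup>2) \<le> norm (2 * (norm (f x))\<^sup>2 + 2 * (norm (g x))\<^sup>2)"
    proof (rule AE_I2)
      fix x
      have "(norm (f x + g x))\<^sup>2 \<le> (norm (f x) + norm (g x))\<^sup>2"
        by (intro power_mono norm_triangle_ineq) auto
      also have "\<dots> \<le> 2 * (norm (f x))\<^sup>2 + 2 * (norm (g x))\<^sup>2"
        using zero_le_power2[of "norm (f x) - norm (g x)"] by (simp add: power2_eq_square algebra_simps)
      finally show "norm ((norm (f x + g x))\<^sup>2) \<le> norm (2 * (norm (f x))\<^sup>2 + 2 * (norm (g x))\<^sup>2)"
        by simp
    qed
  qed measurable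
  then show ?thesis by (simp add: L2_def)
qed

lemma L2_scaleR: "f \<in> L2 \<Omega> \<Longrightarrow> (\<lambda>x. c *\<^sub>R f x) \<in> L2 \<Omega>"
  by (rule L2_bound[where B="\<bar>c\<bar>"]) (auto dest: L2_borel_measurable)

lemma L2_diff: "f \<in> L2 \<Omega> \<Longrightarrow> g \<in> L2 \<Omega> \<Longrightarrow> (\<lambda>x. f x - g x) \<in> L2 \<Omega>"
  using L2_add[of f \<Omega> "\<lambda>x. (-1) *\<^sub>R g x"] L2_scaleR[of g \<Omega> "-1"] by simp

lemma L2_inner: "g \<in> L2 \<Omega> \<Longrightarrow> (\<lambda>x. g x \<bullet> b) \<in> L2 \<Omega>"
  by (rule L2_bound[where B="norm b"])
     (auto dest: L2_borel_measurable intro: order_trans[OF Cauchy_Schwarz_ineq2] simp: mult.commute)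

lemma integrable_if_square_integrable:
  fixes f :: "'a \<Rightarrow> 'b::{banach, second_countable_topology}"
  assumes "f \<in> borel_measurable M" "integrable M (\<lambda>x. (norm (f x))\<^sup>2)"
    and "K \<in> sets M" "emeasure M K < \<infinity>" "\<And>x. x \<in> space M \<Longrightarrow> x \<notin> K \<Longrightarrow> f x = 0"
  shows "integrable M f"
proof (rule Bochner_Integration.integrable_bound)
  show "integrable M (\<lambda>x. indicator K x + (norm (f x))\<^sup>2 :: real)"
    using assms by (intro Bochner_Integration.integrable_add) auto
  have "t \<le> 1 + t\<^sup>2" for t :: real
  proof -
    have "(t - 1)\<^sup>2 = t\<^sup>2 - 2 * t + 1" by (simp add: power2_eq_square algebra_simps)
    then show ?thesis using zero_le_power2[of "t - 1"] zero_le_power2[of t] by linarith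
  qed
  then show "AE x in M. norm (f x) \<le> norm (indicator K x + (norm (f x))\<^sup>2 :: real)"
    using assms(5) by (intro AE_I2) (auto simp: indicator_def)
qed (use assms in auto)

lemma L2_locally_integrable:
  assumes "f \<in> L2 \<Omega>" "\<Omega> \<in> sets lebesgue"
  shows "locally_integrable \<Omega> f"
  unfolding locally_integrable_def
proof (intro allI impI)
  fix K assume K: "compact K \<and> K \<subseteq> \<Omega>"
  then have Kb: "K \<in> sets lebesgue"
    using fmeasurableD[OF lmeasurable_compact] by blast
  have fin: "emeasure lebesgue K < \<infinity>"
    using K emeasure_compact_finite[of K] borel_compact[of K] by simp
  have sub: "lebesgue_on K = restrict_space (lebesgue_on \<Omega>) K"
    using K assms(2) Kb by (subst restrict_restrict_space) (auto simp: inf.absorb2)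
  have Ks: "K \<in> sets (lebesgue_on \<Omega>)"
    using K Kb assms(2) by (auto simp: sets_restrict_space_iff)
  note int = L2_integrable_square[OF assms(1)]
  have "integrable (lebesgue_on K) (\<lambda>x. (norm (f x))\<^sup>2)"
    unfolding sub using integrable_mult_indicator[OF Ks int] Ks K
    by (subst integrable_restrict_space) (auto simp: Int_absorb2)
  moreover have "f \<in> borel_measurable (lebesgue_on K)"
    unfolding sub using L2_borel_measurable[OF assms(1)] by (rule measurable_restrict_space1)
  ultimately show "integrable (lebesgue_on K) f"
    using fin Kb by (rule_tac integrable_if_square_integrable[where K=K]) (simp_all add: emeasure_restrict_space)
qed

lemma locally_integrable_mult_integrable:
  fixes f :: "'a::euclidean_space \<Rightarrow> 'b::euclidean_space"
  assumes f: "locally_integrable \<Omega> f"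
    and c: "c \<in> borel_measurable lebesgue" "\<And>x. \<bar>c x\<bar> \<le> B"
    and K: "compact K" "K \<subseteq> \<Omega>" "\<And>x. x \<notin> K \<Longrightarrow> c x = (0::real)"
  shows "integrable lebesgue (\<lambda>x. c x *\<^sub>R f x)"
proof -
  have Kb: "K \<in> sets lebesgue"
    using fmeasurableD[OF lmeasurable_compact[OF K(1)]] .
  have "integrable (lebesgue_on K) (\<lambda>x. c x *\<^sub>R f x)"
  proof (rule Bochner_Integration.integrable_bound)
    have int: "integrable (lebesgue_on K) f"
      using f K by (simp add: locally_integrable_def)
    then show "integrable (lebesgue_on K) (\<lambda>x. B * norm (f x))" by simp
    show "(\<lambda>x. c x *\<^sub>R f x) \<in> borel_measurable (lebesgue_on K)"
      using int measurable_restrict_space1[OF c(1), of K] by measurable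
    have "0 \<le> B" using c(2) abs_ge_zero order_trans by blast
    then show "AE x in lebesgue_on K. norm (c x *\<^sub>R f x) \<le> norm (B * norm (f x))"
      using c(2) by (intro AE_I2) (auto simp: abs_mult intro!: mult_right_mono)
  qed
  then show ?thesis
    using K(3) Kb by (subst (asm) integrable_lebesgue_on_zero_outside) auto
qed

section \<open>Classical gradients of test functions and the calculus of weak gradients\<close>

definition grad :: "('a::euclidean_space \<Rightarrow> real) \<Rightarrow> 'a \<Rightarrow> 'a" where
  "grad f x = (\<Sum>b\<in>Basis. frechet_derivative f (at x) b *\<^sub>R b)"

lemma grad_inner_Basis: "b \<in> Basis \<Longrightarrow> grad f x \<bullet> b = frechet_derivative f (at x) b"
  by (simp add: grad_def inner_sum_left_Basis)

lemma norm_sq_eq_sum_Basis: "(norm (x::'a::euclidean_space))\<^sup>2 = (\<Sum>b\<in>Basis. (x \<bullet> b)\<^sup>2)"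
  by (simp only: power2_norm_eq_inner euclidean_inner[of x x]) (simp add: power2_eq_square)

lemma test_function_bounded:
  fixes \<phi> :: "'a::euclidean_space \<Rightarrow> real"
  assumes "\<phi> \<in> test_functions \<Omega>"
  obtains B where "B > 0" "\<And>x. \<bar>\<phi> x\<bar> \<le> B"
proof -
  obtain K where "compact K" "\<And>x. x \<notin> K \<Longrightarrow> \<phi> x = 0"
    using assms by (auto simp: test_functions_iff)
  from bounded_compact_support[OF test_function_continuous[OF assms] this] that show thesis
    by auto
qed

lemma test_function_support:
  assumes "\<phi> \<in> test_functions \<Omega>"
  obtains K where "compact K" "K \<subseteq> \<Omega>" "\<And>x. x \<notin> K \<Longrightarrow> \<phi> x = 0"
    "\<And>x b. x \<notin> K \<Longrightarrow> frechet_derivative \<phi> (at x) b = 0"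
proof -
  obtain K where K: "compact K" "K \<subseteq> \<Omega>" "\<And>x. x \<notin> K \<Longrightarrow> \<phi> x = 0"
    using assms by (auto simp: test_functions_iff)
  have "frechet_derivative \<phi> (at x) b = 0" if "x \<notin> K" for x b
    using derivative_zero_outside[OF test_function_derivative(1)[OF assms] compact_imp_closed[OF K(1)] K(3) that]
    by metis
  with K that show thesis by blast
qed

lemma test_function_borel:
  "\<phi> \<in> test_functions \<Omega> \<Longrightarrow> \<phi> \<in> borel_measurable borel"
  using test_function_continuous by (rule borel_measurable_continuous_onI)

lemma test_function_mult:
  assumes "\<zeta> \<in> test_functions UNIV" "\<phi> \<in> test_functions \<Omega>"
  shows "(\<lambda>x. \<zeta> x * \<phi> x) \<in> test_functions \<Omega>"
    and "frechet_derivative (\<lambda>x. \<zeta> x * \<phi> x) (at x) b =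
      \<zeta> x * frechet_derivative \<phi> (at x) b + frechet_derivative \<zeta> (at x) b * \<phi> x"
proof -
  show "(\<lambda>x. \<zeta> x * \<phi> x) \<in> test_functions \<Omega>"
    using assms unfolding test_functions_iff by (auto intro: C_k_mult)
  show "frechet_derivative (\<lambda>x. \<zeta> x * \<phi> x) (at x) b =
      \<zeta> x * frechet_derivative \<phi> (at x) b + frechet_derivative \<zeta> (at x) b * \<phi> x"
    using frechet_derivative_at[OF has_derivative_mult[OF test_function_derivative(1)[OF assms(1), of x]
        test_function_derivative(1)[OF assms(2), of x]]]
    by (metis (no_types, lifting))
qed

lemma test_functions_mono: "\<phi> \<in> test_functions \<Omega> \<Longrightarrow> \<Omega> \<subseteq> \<Omega>' \<Longrightarrow> \<phi> \<in> test_functions \<Omega>'"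
  by (auto simp: test_functions_iff)

lemma L2_compact_support:
  fixes f :: "'a::euclidean_space \<Rightarrow> 'b::euclidean_space"
  assumes "continuous_on UNIV f" "compact K" "\<And>x. x \<notin> K \<Longrightarrow> f x = 0" "\<Omega> \<in> sets lebesgue"
  shows "f \<in> L2 \<Omega>"
proof -
  have "integrable lborel (\<lambda>x. (norm (f x))\<^sup>2)"
    by (rule integrable_compact_support[OF _ assms(2)]) (use assms in \<open>auto intro!: continuous_intros\<close>)
  then have "integrable lebesgue (\<lambda>x. (norm (f x))\<^sup>2)"
    by (subst integrable_completion) auto
  then have "integrable (lebesgue_on \<Omega>) (\<lambda>x. (norm (f x))\<^sup>2)"
    using assms(4) integrable_mult_indicator[OF assms(4), of "\<lambda>x. (norm (f x))\<^sup>2"]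
    by (subst integrable_restrict_space) auto
  then show ?thesis
    using borel_measurable_lebesgue_on_continuous[OF assms(1)] by (simp add: L2_def)
qed

lemma continuous_grad:
  assumes "\<phi> \<in> test_functions \<Omega>"
  shows "continuous_on UNIV (grad \<phi>)"
  unfolding grad_def[abs_def]
  by (intro continuous_intros test_function_continuous[OF test_function_derivative(2)[OF assms]])

lemma test_function_L2:
  assumes "\<phi> \<in> test_functions \<Omega>" "\<Omega>' \<in> sets lebesgue"
  shows "\<phi> \<in> L2 \<Omega>'" "grad \<phi> \<in> L2 \<Omega>'"
proof -
  obtain K where K: "compact K" "K \<subseteq> \<Omega>" "\<And>x. x \<notin> K \<Longrightarrow> \<phi> x = 0"
    "\<And>x b. x \<notin> K \<Longrightarrow> frechet_derivative \<phi> (at x) b = 0"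
    using test_function_support[OF assms(1)] by blast
  show "\<phi> \<in> L2 \<Omega>'"
    using L2_compact_support[OF test_function_continuous[OF assms(1)] K(1,3) assms(2)] .
  show "grad \<phi> \<in> L2 \<Omega>'"
    by (rule L2_compact_support[OF continuous_grad[OF assms(1)] K(1) _ assms(2)]) (simp add: grad_def K(4))
qed

lemma has_weak_gradientD:
  assumes "has_weak_gradient \<Omega> f g" "\<phi> \<in> test_functions \<Omega>" "b \<in> Basis" "\<Omega> \<in> sets lebesgue"
  shows "(LINT x|lebesgue. f x * frechet_derivative \<phi> (at x) b) = - (LINT x|lebesgue. (g x \<bullet> b) * \<phi> x)"
proof -
  obtain K where K: "compact K" "K \<subseteq> \<Omega>" "\<And>x. x \<notin> K \<Longrightarrow> \<phi> x = 0"
    "\<And>x b. x \<notin> K \<Longrightarrow> frechet_derivative \<phi> (at x) b = 0"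
    using test_function_support[OF assms(2)] by blast
  have out: "\<phi> x = 0" "frechet_derivative \<phi> (at x) b = 0" if "x \<notin> \<Omega>" for x
    using that K by blast+
  have "(LINT x|lebesgue_on \<Omega>. f x * frechet_derivative \<phi> (at x) b) =
      - (LINT x|lebesgue_on \<Omega>. (g x \<bullet> b) * \<phi> x)"
    using assms by (simp add: has_weak_gradient_def)
  then show ?thesis
    using assms(4) out by (simp add: integral_lebesgue_on_zero_outside)
qed

lemma has_weak_gradientI:
  assumes "f \<in> L2 \<Omega>" "g \<in> L2 \<Omega>" "\<Omega> \<in> sets lebesgue"
    and eq: "\<And>\<phi> b. \<phi> \<in> test_functions \<Omega> \<Longrightarrow> b \<in> Basis \<Longrightarrow>
      (LINT x|lebesgue. f x * frechet_derivative \<phi> (at x) b) = - (LINT x|lebesgue. (g x \<bullet> b) * \<phi> x)"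
  shows "has_weak_gradient \<Omega> f g"
  unfolding has_weak_gradient_def
proof (intro conjI ballI L2_locally_integrable assms(1-3))
  fix \<phi> b assume \<phi>: "\<phi> \<in> test_functions \<Omega>" and b: "b \<in> (Basis :: 'a set)"
  obtain K where K: "compact K" "K \<subseteq> \<Omega>" "\<And>x. x \<notin> K \<Longrightarrow> \<phi> x = 0"
    "\<And>x b. x \<notin> K \<Longrightarrow> frechet_derivative \<phi> (at x) b = 0"
    using test_function_support[OF \<phi>] by blast
  have out: "\<phi> x = 0" "frechet_derivative \<phi> (at x) b = 0" if "x \<notin> \<Omega>" for x
    using that K by blast+
  show "(LINT x|lebesgue_on \<Omega>. f x * frechet_derivative \<phi> (at x) b) =
      - (LINT x|lebesgue_on \<Omega>. (g x \<bullet> b) * \<phi> x)"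
    using eq[OF \<phi> b] assms(3) out by (simp add: integral_lebesgue_on_zero_outside)
qed

lemma L2_mult_test_function_integrable:
  fixes f :: "'a::euclidean_space \<Rightarrow> real"
  assumes "f \<in> L2 \<Omega>" "\<phi> \<in> test_functions \<Omega>" "\<Omega> \<in> sets lebesgue"
  shows "integrable lebesgue (\<lambda>x. f x * \<phi> x)"
proof -
  obtain K where K: "compact K" "K \<subseteq> \<Omega>" "\<And>x. x \<notin> K \<Longrightarrow> \<phi> x = 0"
    by (rule test_function_support[OF assms(2)], rule that)
  obtain B where "\<And>x. \<bar>\<phi> x\<bar> \<le> B" using test_function_bounded[OF assms(2)] by blast
  then have "integrable lebesgue (\<lambda>x. \<phi> x *\<^sub>R f x)"
    using test_function_borel[OF assms(2)] K assms
    by (intro locally_integrable_mult_integrable[where B=B and K=K and \<Omega>=\<Omega>] L2_locally_integrable)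
       (auto intro: measurable_completion)
  then show ?thesis by (simp add: mult.commute)
qed

lemma has_weak_gradient_add_scaled:
  assumes "f \<in> L2 \<Omega>" "g \<in> L2 \<Omega>" "has_weak_gradient \<Omega> f g"
    and "f' \<in> L2 \<Omega>" "g' \<in> L2 \<Omega>" "has_weak_gradient \<Omega> f' g'" and \<Omega>: "\<Omega> \<in> sets lebesgue"
  shows "has_weak_gradient \<Omega> (\<lambda>x. f x + c * f' x) (\<lambda>x. g x + c *\<^sub>R g' x)"
proof (rule has_weak_gradientI[OF _ _ \<Omega>])
  show "(\<lambda>x. f x + c * f' x) \<in> L2 \<Omega>" "(\<lambda>x. g x + c *\<^sub>R g' x) \<in> L2 \<Omega>"
    using L2_add[OF assms(1) L2_scaleR[OF assms(4)], of c] L2_add[OF assms(2) L2_scaleR[OF assms(5)]] by simp_all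
  fix \<phi> b assume \<phi>: "\<phi> \<in> test_functions \<Omega>" and b: "b \<in> (Basis :: 'a set)"
  note D = test_function_derivative(2)[OF \<phi> b]
  note int = L2_mult_test_function_integrable[OF assms(1) D \<Omega>]
    L2_mult_test_function_integrable[OF assms(4) D \<Omega>]
    L2_mult_test_function_integrable[OF L2_inner[OF assms(2)] \<phi> \<Omega>, of b]
    L2_mult_test_function_integrable[OF L2_inner[OF assms(5)] \<phi> \<Omega>, of b]
  show "(LINT x|lebesgue. (f x + c * f' x) * frechet_derivative \<phi> (at x) b) =
      - (LINT x|lebesgue. ((g x + c *\<^sub>R g' x) \<bullet> b) * \<phi> x)"
    using has_weak_gradientD[OF assms(3) \<phi> b \<Omega>] has_weak_gradientD[OF assms(6) \<phi> b \<Omega>] int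
    by (simp add: inner_add_left distrib_right mult.assoc)
qed

lemma lebesgue_integral_lborel:
  fixes f :: "'a::euclidean_space \<Rightarrow> real"
  assumes "f \<in> borel_measurable borel"
  shows "(LINT x|lebesgue. f x) = (LINT x|lborel. f x)"
  using assms by (intro integral_completion) auto

text \<open>Integration by parts: the partial derivative of the product
  \<open>\<psi> x * \<phi> x\<close> integrates to 0.\<close>

lemma test_function_weak_gradient:
  assumes \<psi>: "\<psi> \<in> test_functions \<Omega>" and \<Omega>: "\<Omega> \<in> sets lebesgue"
  shows "has_weak_gradient \<Omega> \<psi> (grad \<psi>)"
proof (rule has_weak_gradientI[OF test_function_L2[OF \<psi> \<Omega>] \<Omega>])
  fix \<phi> b assume \<phi>: "\<phi> \<in> test_functions \<Omega>" and b: "b \<in> (Basis :: 'a set)"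
  have \<psi>U: "\<psi> \<in> test_functions UNIV" using test_functions_mono[OF \<psi>] by simp
  note prod = test_function_mult[OF \<psi>U \<phi>]
  note [measurable] = test_function_borel[OF \<psi>] test_function_borel[OF \<phi>]
    test_function_borel[OF test_function_derivative(2)[OF \<psi> b]]
    test_function_borel[OF test_function_derivative(2)[OF \<phi> b]]
  obtain K where K: "compact K" "\<And>x. x \<notin> K \<Longrightarrow> \<psi> x * \<phi> x = 0"
    by (rule test_function_support[OF prod(1)], rule that)
  have "(LINT x|lborel. frechet_derivative (\<lambda>x. \<psi> x * \<phi> x) (at x) b) = 0"
    by (rule integral_derivative_compact_support[OF test_function_derivative(1)[OF prod(1)] _ K b])
       (auto intro: test_function_continuous[OF test_function_derivative(2)[OF prod(1)]])
  then have "(LINT x|lebesgue. \<psi> x * frechet_derivative \<phi> (at x) b + frechet_derivative \<psi> (at x) b * \<phi> x) = 0"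
    unfolding prod(2) by (simp add: lebesgue_integral_lborel)
  moreover note L2_mult_test_function_integrable[OF test_function_L2(1)[OF \<psi> \<Omega>] test_function_derivative(2)[OF \<phi> b] \<Omega>]
    L2_mult_test_function_integrable[OF test_function_L2(1)[OF test_function_derivative(2)[OF \<psi> b] \<Omega>] \<phi> \<Omega>]
  ultimately show "(LINT x|lebesgue. \<psi> x * frechet_derivative \<phi> (at x) b) = - (LINT x|lebesgue. (grad \<psi> x \<bullet> b) * \<phi> x)"
    using b by (simp add: grad_inner_Basis)
qed

text \<open>The product \<open>\<zeta> x * \<phi> x\<close> is itself a test function. The weak
  identity for f is tested with it, and the product rule separates the term with the derivative of
  \<open>\<zeta>\<close>.\<close>

lemma has_weak_gradient_mult:
  assumes "f \<in> L2 \<Omega>" "g \<in> L2 \<Omega>" "has_weak_gradient \<Omega> f g"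
    and \<zeta>: "\<zeta> \<in> test_functions UNIV" and \<Omega>: "\<Omega> \<in> sets lebesgue"
  shows "(\<lambda>x. \<zeta> x * f x) \<in> L2 \<Omega>" "(\<lambda>x. \<zeta> x *\<^sub>R g x + f x *\<^sub>R grad \<zeta> x) \<in> L2 \<Omega>"
    "has_weak_gradient \<Omega> (\<lambda>x. \<zeta> x * f x) (\<lambda>x. \<zeta> x *\<^sub>R g x + f x *\<^sub>R grad \<zeta> x)"
proof -
  obtain B where B: "B > 0" "\<And>x. \<bar>\<zeta> x\<bar> \<le> B" using test_function_bounded[OF \<zeta>] by blast
  obtain K where K: "compact K" "\<And>x b. x \<notin> K \<Longrightarrow> frechet_derivative \<zeta> (at x) b = 0"
    by (rule test_function_support[OF \<zeta>], rule that)
  have "grad \<zeta> x = 0" if "x \<notin> K" for x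
    using that by (simp add: grad_def K(2))
  then obtain B' where B': "\<And>x. norm (grad \<zeta> x) \<le> B'"
    using bounded_compact_support[OF continuous_grad[OF \<zeta>] K(1)] by metis
  note [measurable] = L2_borel_measurable[OF assms(1)] L2_borel_measurable[OF assms(2)]
    borel_measurable_lebesgue_on_continuous[OF continuous_grad[OF \<zeta>], of \<Omega>]
    borel_measurable_lebesgue_on_continuous[OF test_function_continuous[OF \<zeta>], of \<Omega>]
  show 1: "(\<lambda>x. \<zeta> x * f x) \<in> L2 \<Omega>"
    by (rule L2_bound[OF assms(1), where B=B]) (auto simp: abs_mult B intro!: mult_right_mono)
  have "(\<lambda>x. \<zeta> x *\<^sub>R g x) \<in> L2 \<Omega>"
    by (rule L2_bound[OF assms(2), where B=B]) (auto simp: B intro!: mult_right_mono)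
  moreover have "(\<lambda>x. f x *\<^sub>R grad \<zeta> x) \<in> L2 \<Omega>"
    by (rule L2_bound[OF assms(1), where B=B']) (auto simp: mult.commute[of B'] B' intro!: mult_left_mono)
  ultimately show 2: "(\<lambda>x. \<zeta> x *\<^sub>R g x + f x *\<^sub>R grad \<zeta> x) \<in> L2 \<Omega>"
    by (rule L2_add)
  show "has_weak_gradient \<Omega> (\<lambda>x. \<zeta> x * f x) (\<lambda>x. \<zeta> x *\<^sub>R g x + f x *\<^sub>R grad \<zeta> x)"
  proof (rule has_weak_gradientI[OF 1 2 \<Omega>])
    fix \<phi> b assume \<phi>: "\<phi> \<in> test_functions \<Omega>" and b: "b \<in> (Basis :: 'a set)"
    note prod = test_function_mult[OF \<zeta> \<phi>]
    have test: "(\<lambda>x. frechet_derivative \<zeta> (at x) b * \<phi> x) \<in> test_functions \<Omega>"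
      using test_function_mult(1)[OF test_function_derivative(2)[OF \<zeta> b] \<phi>] .
    have test': "(\<lambda>x. \<zeta> x * frechet_derivative \<phi> (at x) b) \<in> test_functions \<Omega>"
      using test_function_mult(1)[OF \<zeta> test_function_derivative(2)[OF \<phi> b]] .
    note i1 = L2_mult_test_function_integrable[OF assms(1) test \<Omega>]
    note i2 = L2_mult_test_function_integrable[OF assms(1) test' \<Omega>]
    note i3 = L2_mult_test_function_integrable[OF L2_inner[OF assms(2)] prod(1) \<Omega>, of b]
    have "(LINT x|lebesgue. f x * (\<zeta> x * frechet_derivative \<phi> (at x) b)) + (LINT x|lebesgue. f x * (frechet_derivative \<zeta> (at x) b * \<phi> x))
      = (LINT x|lebesgue. f x * frechet_derivative (\<lambda>x. \<zeta> x * \<phi> x) (at x) b)"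
      unfolding prod(2) using i1 i2 by (simp add: distrib_left)
    also have "\<dots> = - (LINT x|lebesgue. (g x \<bullet> b) * (\<zeta> x * \<phi> x))"
      by (rule has_weak_gradientD[OF assms(3) prod(1) b \<Omega>])
    finally have eq: "(LINT x|lebesgue. f x * (\<zeta> x * frechet_derivative \<phi> (at x) b)) =
       - ((LINT x|lebesgue. (g x \<bullet> b) * (\<zeta> x * \<phi> x)) + (LINT x|lebesgue. f x * (frechet_derivative \<zeta> (at x) b * \<phi> x)))"
      by simp
    have "(LINT x|lebesgue. \<zeta> x * f x * frechet_derivative \<phi> (at x) b) =
        (LINT x|lebesgue. f x * (\<zeta> x * frechet_derivative \<phi> (at x) b))"
      by (simp add: ac_simps)
    moreover have "(LINT x|lebesgue. ((\<zeta> x *\<^sub>R g x + f x *\<^sub>R grad \<zeta> x) \<bullet> b) * \<phi> x) =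
        (LINT x|lebesgue. (g x \<bullet> b) * (\<zeta> x * \<phi> x) + f x * (frechet_derivative \<zeta> (at x) b * \<phi> x))"
      using b by (intro Bochner_Integration.integral_cong) (auto simp: inner_add_left grad_inner_Basis algebra_simps)
    ultimately show "(LINT x|lebesgue. \<zeta> x * f x * frechet_derivative \<phi> (at x) b) =
      - (LINT x|lebesgue. ((\<zeta> x *\<^sub>R g x + f x *\<^sub>R grad \<zeta> x) \<bullet> b) * \<phi> x)"
      using eq i1 i3 by simp
  qed
qed

section \<open>Approximation by mollification and uniqueness of weak gradients\<close>

lemma compact_imp_lebesgue: "compact K \<Longrightarrow> K \<in> sets lebesgue"
  using fmeasurableD[OF lmeasurable_compact] by blast

text \<open>
  Fubini is only available for Borel functions on \<open>lborel\<close>, so Lebesgue measurable functions are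
  replaced by Borel versions before they are mollified.
\<close>

lemma square_integrable_borel_version:
  fixes F :: "'a::euclidean_space \<Rightarrow> real"
  assumes "F \<in> borel_measurable lebesgue" "integrable lebesgue (\<lambda>x. (F x)\<^sup>2)"
    and K: "compact K" "\<And>x. x \<notin> K \<Longrightarrow> F x = 0"
  obtains F' where "F' \<in> borel_measurable borel" "AE x in lebesgue. F x = F' x" "\<And>x. x \<notin> K \<Longrightarrow> F' x = 0"
    "integrable lborel F'" "integrable lborel (\<lambda>x. (F' x)\<^sup>2)"
proof -
  obtain G where G: "G \<in> borel_measurable lborel" "AE x in lborel. F x = G x"
    using completion_ex_borel_measurable_real[OF assms(1)] by blast
  define F' where "F' x = indicator K x * G x" for x
  have [measurable]: "K \<in> sets borel" using K(1) by (rule borel_compact)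
  have [measurable]: "F' \<in> borel_measurable borel"
    using G(1) unfolding F'_def[abs_def] by measurable
  have "AE x in lborel. F x = F' x"
    using G(2) by eventually_elim (use K(2) in \<open>auto simp: F'_def indicator_def\<close>)
  then have ae: "AE x in lebesgue. F x = F' x" by (rule AE_completion)
  have [measurable]: "F' \<in> borel_measurable lebesgue" by (rule measurable_completion) simp
  have "integrable lebesgue (\<lambda>x. (F' x)\<^sup>2)"
    by (rule integrable_cong_AE_imp[OF assms(2)]) (use ae in auto)
  then have 2: "integrable lborel (\<lambda>x. (F' x)\<^sup>2)"
    by (subst (asm) integrable_completion) auto
  have "integrable lborel F'"
    by (rule integrable_if_square_integrable[where K=K])
       (use 2 emeasure_compact_finite[OF K(1)] in \<open>auto simp: F'_def\<close>)
  with 2 ae show thesis by (intro that[of F']) (auto simp: F'_def)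
qed

lemma L2_zero_outside_borel_version:
  fixes F :: "'a::euclidean_space \<Rightarrow> real"
  assumes F: "F \<in> L2 \<Omega>" "\<Omega> \<in> sets lebesgue"
    and K: "compact K" "K \<subseteq> \<Omega>" "\<And>x. x \<notin> K \<Longrightarrow> F x = 0"
  obtains F' where "F' \<in> borel_measurable borel" "AE x in lebesgue. F x = F' x" "\<And>x. x \<notin> K \<Longrightarrow> F' x = 0"
    "integrable lborel F'" "integrable lborel (\<lambda>x. (F' x)\<^sup>2)"
proof -
  have out: "F x = 0" if "x \<notin> \<Omega>" for x using that K by blast
  have m: "F \<in> borel_measurable lebesgue"
    using measurable_lebesgue_on_zero_outside[OF F(2) out] L2_borel_measurable[OF F(1)] by simp
  have "integrable lebesgue (\<lambda>x. (F x)\<^sup>2)"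
    using integrable_lebesgue_on_zero_outside[OF F(2), of "\<lambda>x. (F x)\<^sup>2"] out L2_integrable_square[OF F(1)]
    by simp
  from square_integrable_borel_version[OF m this K(1,3)] that show thesis by blast
qed

lemma mollifier_seq_exists:
  assumes "\<And>n. e n > 0"
  obtains \<rho> :: "nat \<Rightarrow> 'a::euclidean_space \<Rightarrow> real" where "\<And>n. mollifier (e n) (\<rho> n)"
proof -
  have "\<exists>\<rho>::'a \<Rightarrow> real. mollifier (e n) \<rho>" for n
    using mollifier_exists[OF assms[of n]] by blast
  then show thesis using that by metis
qed

text \<open>Once the closed e-ball around x lies in \<open>\<Omega>\<close>, the kernel centred at x
  may be inserted into the definition of a weak gradient. The minus sign turns a derivative in x
  into one in y.\<close>

lemma reflected_test_function:
  fixes \<rho> :: "'a::euclidean_space \<Rightarrow> real"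
  assumes "\<rho> \<in> test_functions UNIV" "\<And>z. norm z \<ge> e \<Longrightarrow> \<rho> z = 0" "cball x e \<subseteq> \<Omega>"
  shows "(\<lambda>y. \<rho> (x - y)) \<in> test_functions \<Omega>"
    and "frechet_derivative (\<lambda>y. \<rho> (x - y)) (at y) b = - frechet_derivative \<rho> (at (x - y)) b"
proof -
  have "C_k k (\<lambda>y. \<rho> (x - y))" for k
    using assms(1) by (intro C_k_compose_reflect) (auto simp: test_functions_iff)
  then show "(\<lambda>y. \<rho> (x - y)) \<in> test_functions \<Omega>"
    unfolding test_functions_iff using assms(2,3)
    by (intro conjI allI exI[of _ "cball x e"]) (auto simp: dist_norm)
  have "((\<lambda>y. \<rho> (x - y)) has_derivative (\<lambda>h. frechet_derivative \<rho> (at (x - y)) (- h))) (at y)"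
    by (rule has_derivative_compose[where g=\<rho>, OF _ test_function_derivative(1)[OF assms(1)]])
       (auto intro!: derivative_eq_intros)
  from frechet_derivative_at[OF this]
  have "frechet_derivative (\<lambda>y. \<rho> (x - y)) (at y) b = frechet_derivative \<rho> (at (x - y)) (- b)"
    by metis
  then show "frechet_derivative (\<lambda>y. \<rho> (x - y)) (at y) b = - frechet_derivative \<rho> (at (x - y)) b"
    using linear_neg[OF has_derivative_linear[OF test_function_derivative(1)[OF assms(1)]]] by simp
qed

lemma convol_lebesgue:
  fixes \<rho> F F' :: "'a::euclidean_space \<Rightarrow> real"
  assumes "continuous_on UNIV \<rho>" "F' \<in> borel_measurable borel" "AE x in lebesgue. F x = F' x"
    and "F \<in> borel_measurable lebesgue"
  shows "(LINT y|lebesgue. \<rho> (x - y) * F y) = convol \<rho> F' x"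
proof -
  have [measurable]: "(\<lambda>y. \<rho> (x - y)) \<in> borel_measurable borel"
    by (rule borel_measurable_continuous_onI, rule continuous_on_compose2[OF assms(1)])
       (auto intro!: continuous_intros)
  note [measurable] = assms(2,4) measurable_completion[of "\<lambda>y. \<rho> (x - y)" lborel borel]
    measurable_completion[of F' lborel borel]
  have "(LINT y|lebesgue. \<rho> (x - y) * F y) = (LINT y|lebesgue. \<rho> (x - y) * F' y)"
    using assms(3) by (intro integral_cong_AE) auto
  also have "\<dots> = convol \<rho> F' x"
    unfolding convol_def by (rule lebesgue_integral_lborel) measurable
  finally show ?thesis .
qed

text \<open>The basic approximation tool. Mollifying f gives uniform convergence because f is
  continuous with compact support; the gradient of the mollified f is the mollified g, so it
  converges in L2. All approximants share one compact support K'. It is enlarged from K, since the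
  mollified functions spread out.\<close>

lemma weak_gradient_approx:
  fixes f :: "'a::euclidean_space \<Rightarrow> real"
  assumes \<Omega>: "open \<Omega>" and f: "continuous_on UNIV f" "\<And>x. x \<notin> K \<Longrightarrow> f x = 0"
    and g: "g \<in> L2 \<Omega>" "\<And>x. x \<notin> K \<Longrightarrow> g x = 0"
    and wg: "has_weak_gradient \<Omega> f g" and K: "compact K" "K \<subseteq> \<Omega>"
  obtains \<phi> K' where "\<And>n::nat. \<phi> n \<in> test_functions \<Omega>" "compact K'" "K \<subseteq> K'" "K' \<subseteq> \<Omega>"
    "\<And>n x. x \<notin> K' \<Longrightarrow> \<phi> n x = 0" "\<And>n x. x \<notin> K' \<Longrightarrow> grad (\<phi> n) x = 0"
    "uniform_limit UNIV \<phi> f sequentially"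
    "\<And>b. b \<in> Basis \<Longrightarrow>
      (\<lambda>n. \<integral>\<^sup>+x. ennreal (((grad (\<phi> n) x - g x) \<bullet> b)\<^sup>2) \<partial>lebesgue) \<longlonglongrightarrow> 0"
proof -
  have \<Omega>s: "\<Omega> \<in> sets lebesgue" using \<Omega> by auto
  obtain e0 where e0: "e0 > 0" "(\<Union>x\<in>K. ball x e0) \<subseteq> \<Omega>"
    using compact_subset_open_imp_ball_epsilon_subset[OF K(1) \<Omega> K(2)] by blast
  \<comment> \<open>K' is the closed e0/4-neighbourhood of K, so balls of radius at most e0/4 around
    its points stay within e0/2 of K and hence inside \<open>\<Omega>\<close>.\<close>
  define e where "e n = e0 / 4 / real (Suc n)" for n
  have e: "e n > 0" "e n \<le> e0 / 4" for n
    using e0(1) by (auto simp: e_def divide_le_eq_1 field_simps)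
  have elim: "e \<longlonglongrightarrow> 0"
    unfolding e_def[abs_def] using lim_const_over_n[of "e0 / 4"]
    by (rule filterlim_compose[OF _ filterlim_Suc])
  obtain \<rho> :: "nat \<Rightarrow> 'a \<Rightarrow> real" where \<rho>: "\<And>n. mollifier (e n) (\<rho> n)"
    using mollifier_seq_exists[of e] e(1) by blast
  define N where "N r = (\<Union>x\<in>K. \<Union>y\<in>cball 0 r. {x + y})" for r
  have Nc: "compact (N r)" for r
    using compact_sums'[OF K(1) compact_cball] by (simp add: N_def)
  have NI: "x \<in> N r" if "y \<in> K" "norm (x - y) \<le> r" for x y r
  proof -
    have "y + (x - y) \<in> N r" unfolding N_def using that by (intro UN_I[of y] UN_I[of "x - y"]) auto
    then show ?thesis by simp
  qed
  have ND: "\<exists>y\<in>K. norm (x - y) \<le> r" if xN: "x \<in> N r" for x r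
  proof -
    obtain y z where yz: "y \<in> K" "z \<in> cball 0 r" "x = y + z" using xN unfolding N_def by blast
    then have "norm (x - y) \<le> r" by simp
    with yz(1) show ?thesis by blast
  qed
  have Nball: "cball x (e0 / 4) \<subseteq> \<Omega>" if x: "x \<in> N (e0 / 4)" for x
  proof
    fix z assume z: "z \<in> cball x (e0 / 4)"
    obtain y where y: "y \<in> K" "norm (x - y) \<le> e0 / 4" using ND[OF x] by blast
    have "dist y z \<le> dist y x + dist x z" by (rule dist_triangle)
    also have "\<dots> < e0" using y z e0(1) by (simp add: dist_norm norm_minus_commute)
    finally have "z \<in> (\<Union>x\<in>K. ball x e0)" using y(1) by auto
    then show "z \<in> \<Omega>" using e0(2) by blast
  qed
  define K' where "K' = N (e0 / 4)"
  have K': "compact K'" "K \<subseteq> K'" "K' \<subseteq> \<Omega>"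
    using Nc NI[of _ _ "e0 / 4"] Nball e0(1) by (force simp: K'_def)+
  have NK': "N (e n) \<subseteq> K'" for n
    unfolding K'_def using ND NI e(2)[of n] order_trans by (metis subsetI)
  note fint = integrable_compact_support[OF f(1) K(1) f(2)]
  define \<phi> where "\<phi> n = convol (\<rho> n) f" for n
  have zero: "\<phi> n x = 0" if "x \<notin> K'" for n x
  proof -
    have "x \<notin> N (e n)" using that NK' by blast
    then show ?thesis
      unfolding \<phi>_def N_def by (intro convol_zero_outside[OF \<rho> f(2)])
  qed
  have test: "\<phi> n \<in> test_functions \<Omega>" for n
    unfolding test_functions_iff using K' zero C_k_convol[OF fint mollifierD(1)[OF \<rho>]]
    by (auto simp: \<phi>_def)
  have Dzero: "frechet_derivative (\<phi> n) (at x) b = 0" if "x \<notin> K'" for n x b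
    using derivative_zero_outside[OF test_function_derivative(1)[OF test] compact_imp_closed[OF K'(1)] zero that]
    by metis
  have "(\<lambda>n. \<integral>\<^sup>+x. ennreal (((grad (\<phi> n) x - g x) \<bullet> b)\<^sup>2) \<partial>lebesgue) \<longlonglongrightarrow> 0"
    if b: "b \<in> Basis" for b
  proof -
    have gb0: "g x \<bullet> b = 0" if "x \<notin> K" for x using g(2)[OF that] by simp
    obtain G where G: "G \<in> borel_measurable borel" "AE x in lebesgue. g x \<bullet> b = G x"
      "\<And>x. x \<notin> K \<Longrightarrow> G x = 0" "integrable lborel G" "integrable lborel (\<lambda>x. (G x)\<^sup>2)"
      by (rule L2_zero_outside_borel_version[OF L2_inner[OF g(1)] \<Omega>s K gb0]) (assumption | rule that)+
    have gm: "(\<lambda>x. g x \<bullet> b) \<in> borel_measurable lebesgue"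
      using measurable_lebesgue_on_zero_outside[OF \<Omega>s, of "\<lambda>x. g x \<bullet> b"] gb0 K(2)
        L2_borel_measurable[OF L2_inner[OF g(1)]] by blast
    \<comment> \<open>On K' the kernel at x is admissible, and the derivative travels from the
      kernel to f through the weak identity. Off K' both sides vanish.\<close>
    have deriv: "grad (\<phi> n) x \<bullet> b = convol (\<rho> n) G x" for n x
    proof (cases "x \<in> K'")
      case True
      have cb: "cball x (e n) \<subseteq> \<Omega>"
        using Nball[of x] True e(2)[of n] by (auto simp: K'_def)
      note refl = reflected_test_function[OF mollifierD(1,3)[OF \<rho>] cb]
      have mD: "(\<lambda>z. frechet_derivative (\<rho> n) (at z) b) \<in> test_functions UNIV"
        by (rule test_function_derivative(2)[OF mollifierD(1)[OF \<rho>] b])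
      have fb: "f \<in> borel_measurable borel" using f(1) by (rule borel_measurable_continuous_onI)
      have "grad (\<phi> n) x \<bullet> b = convol (\<lambda>z. frechet_derivative (\<rho> n) (at z) b) f x"
        using convol_frechet_derivative[OF mollifierD(1)[OF \<rho>] fint b] by (simp add: grad_inner_Basis[OF b] \<phi>_def)
      also have "\<dots> = (LINT y|lebesgue. frechet_derivative (\<rho> n) (at (x - y)) b * f y)"
        using convol_lebesgue[OF test_function_continuous[OF mD] fb, of f x] fb
        by (simp add: measurable_completion)
      also have "\<dots> = - (LINT y|lebesgue. f y * frechet_derivative (\<lambda>y. \<rho> n (x - y)) (at y) b)"
        by (simp add: refl(2) mult.commute)
      also have "\<dots> = (LINT y|lebesgue. (g y \<bullet> b) * \<rho> n (x - y))"
        using has_weak_gradientD[OF wg refl(1) b \<Omega>s] by simp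
      also have "\<dots> = convol (\<rho> n) G x"
        using convol_lebesgue[OF mollifierD(5)[OF \<rho>] G(1,2) gm, of n x] by (simp add: mult.commute)
      finally show ?thesis .
    next
      case False
      then have "x \<notin> N (e n)" using NK' by blast
      then have "convol (\<rho> n) G x = 0"
        unfolding N_def by (intro convol_zero_outside[OF \<rho> G(3)])
      with False show ?thesis by (simp add: grad_inner_Basis[OF b] Dzero)
    qed
    have "(\<integral>\<^sup>+x. ennreal (((grad (\<phi> n) x - g x) \<bullet> b)\<^sup>2) \<partial>lebesgue)
        = (\<integral>\<^sup>+x. ennreal ((convol (\<rho> n) G x - G x)\<^sup>2) \<partial>lborel)" for n
    proof -
      have "(\<integral>\<^sup>+x. ennreal (((grad (\<phi> n) x - g x) \<bullet> b)\<^sup>2) \<partial>lebesgue)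
          = (\<integral>\<^sup>+x. ennreal ((convol (\<rho> n) G x - G x)\<^sup>2) \<partial>lebesgue)"
        using G(2) by (intro nn_integral_cong_AE, eventually_elim) (simp add: inner_diff_left deriv)
      then show ?thesis by (simp add: nn_integral_completion)
    qed
    then show ?thesis
      using convol_tendsto_L2[OF \<rho> elim G(4,5)] by simp
  qed
  moreover have "grad (\<phi> n) x = 0" if "x \<notin> K'" for n x
    using Dzero[OF that] by (simp add: grad_def)
  moreover have "uniform_limit UNIV \<phi> f sequentially"
    unfolding \<phi>_def[abs_def] by (rule convol_uniform_limit[OF \<rho> elim f(1) K(1) f(2)])
  ultimately show thesis
    using that[of \<phi> K'] test K' zero by blast
qed

text \<open>Localize g - h with a bump on a box: every mollification of the product is the integral
  of g - h against a test function, hence 0, and so is the L2 limit. The bump is positive on the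
  open box and can be divided out.\<close>

lemma weak_gradient_unique:
  fixes f :: "'a::euclidean_space \<Rightarrow> real"
  assumes \<Omega>: "open \<Omega>" and g: "g \<in> L2 \<Omega>" "has_weak_gradient \<Omega> f g"
    and h: "h \<in> L2 \<Omega>" "has_weak_gradient \<Omega> f h"
  shows "AE x in lebesgue_on \<Omega>. g x = h x"
proof -
  have \<Omega>s: "\<Omega> \<in> sets lebesgue" using \<Omega> by auto
  have gh: "(\<lambda>x. g x - h x) \<in> L2 \<Omega>" using L2_diff[OF g(1) h(1)] .
  have local: "AE x in lebesgue. x \<in> box a c \<longrightarrow> (g x - h x) \<bullet> b = 0"
    if ac: "cbox a c \<subseteq> \<Omega>" and b: "b \<in> Basis" for a c b
  proof -
    define \<beta> where "\<beta> = box_bump a c"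
    define F where "F x = \<beta> x * ((g x - h x) \<bullet> b)" for x
    have \<beta>: "\<beta> \<in> test_functions \<Omega>" unfolding \<beta>_def by (rule box_bump_test_function[OF ac])
    have \<beta>0: "\<beta> x = 0" if "x \<notin> cbox a c" for x
      using that box_subset_cbox[of a c] by (auto simp: \<beta>_def box_bump_eq_0_iff)
    obtain B where B: "B > 0" "\<And>x. \<bar>\<beta> x\<bar> \<le> B" using test_function_bounded[OF \<beta>] by blast
    have F: "F \<in> L2 \<Omega>"
      unfolding F_def[abs_def]
    proof (rule L2_bound[OF L2_inner[OF gh], where B=B])
      show "(\<lambda>x. \<beta> x * ((g x - h x) \<bullet> b)) \<in> borel_measurable (lebesgue_on \<Omega>)"
        using L2_borel_measurable[OF L2_inner[OF gh]]
          borel_measurable_lebesgue_on_continuous[OF test_function_continuous[OF \<beta>], of \<Omega>]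
        by (intro borel_measurable_times)
    qed (auto simp: abs_mult B intro!: mult_right_mono)
    have F0: "F x = 0" if "x \<notin> cbox a c" for x using \<beta>0[OF that] by (simp add: F_def)
    obtain F' where F': "F' \<in> borel_measurable borel" "AE x in lebesgue. F x = F' x"
      "integrable lborel F'" "integrable lborel (\<lambda>x. (F' x)\<^sup>2)"
      by (rule L2_zero_outside_borel_version[OF F \<Omega>s compact_cbox ac F0]) (assumption | rule that)+
    have Fm: "F \<in> borel_measurable lebesgue"
      using measurable_lebesgue_on_zero_outside[OF \<Omega>s, of F] F0 ac L2_borel_measurable[OF F] by blast
    have elim: "(\<lambda>n. 1 / real (Suc n)) \<longlonglongrightarrow> 0"
      using lim_const_over_n[of "1::real"] by (rule filterlim_compose[OF _ filterlim_Suc])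
    obtain \<rho> :: "nat \<Rightarrow> 'a \<Rightarrow> real" where \<rho>: "\<And>n. mollifier (1 / real (Suc n)) (\<rho> n)"
      using mollifier_seq_exists[of "\<lambda>n. 1 / real (Suc n)"] by auto
    have "convol (\<rho> n) F' x = 0" for n x
    proof -
      have refl: "(\<lambda>y. \<rho> n (x - y)) \<in> test_functions UNIV"
        by (rule reflected_test_function(1)[OF mollifierD(1,3)[OF \<rho>] subset_UNIV])
      \<comment> \<open>The bump keeps the product supported in \<open>\<Omega>\<close>, so the
        kernel may be centred at any x, however close to or beyond the boundary.\<close>
      note test = test_function_mult(1)[OF refl \<beta>]
      have "(LINT y|lebesgue. (g y \<bullet> b) * (\<rho> n (x - y) * \<beta> y)) = (LINT y|lebesgue. (h y \<bullet> b) * (\<rho> n (x - y) * \<beta> y))"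
        using has_weak_gradientD[OF g(2) test b \<Omega>s] has_weak_gradientD[OF h(2) test b \<Omega>s] by simp
      then have "0 = (LINT y|lebesgue. (g y \<bullet> b) * (\<rho> n (x - y) * \<beta> y) - (h y \<bullet> b) * (\<rho> n (x - y) * \<beta> y))"
        using L2_mult_test_function_integrable[OF L2_inner[OF g(1)] test \<Omega>s]
          L2_mult_test_function_integrable[OF L2_inner[OF h(1)] test \<Omega>s] by simp
      also have "\<dots> = (LINT y|lebesgue. \<rho> n (x - y) * F y)"
        by (simp add: F_def inner_diff_left algebra_simps)
      also have "\<dots> = convol (\<rho> n) F' x"
        by (rule convol_lebesgue[OF mollifierD(5)[OF \<rho>] F'(1,2) Fm])
      finally show ?thesis by simp
    qed
    then have "(\<lambda>n::nat. \<integral>\<^sup>+x. ennreal ((F' x)\<^sup>2) \<partial>lborel) \<longlonglongrightarrow> 0"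
      using convol_tendsto_L2[OF \<rho> elim F'(3,4)] by simp
    then have "(\<integral>\<^sup>+x. ennreal ((F' x)\<^sup>2) \<partial>lborel) = 0"
      using LIMSEQ_unique tendsto_const by blast
    then have "AE x in lborel. F' x = 0"
      using F'(1) by (subst (asm) nn_integral_0_iff_AE) auto
    then have "AE x in lebesgue. F' x = 0" by (rule AE_completion)
    with F'(2) show ?thesis
    proof eventually_elim
      case (elim x)
      then have "F x = 0" by simp
      then show ?case by (auto simp: F_def \<beta>_def box_bump_eq_0_iff)
    qed
  qed
  \<comment> \<open>Countably many closed boxes exhaust \<open>\<Omega>\<close>; the local statement
    covers their interiors, and their boundaries are negligible.\<close>
  obtain \<D> where D: "countable \<D>" "\<D> \<subseteq> Pow \<Omega>" "\<And>X. X \<in> \<D> \<Longrightarrow> \<exists>a b. X = cbox a b" "\<Union>\<D> = \<Omega>"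
    using open_countable_Union_open_cbox[OF \<Omega>] by blast
  have "AE x in lebesgue. \<forall>X\<in>\<D>. x \<in> X \<longrightarrow> g x = h x"
    unfolding AE_ball_countable[OF D(1)]
  proof
    fix X assume X: "X \<in> \<D>"
    then obtain a c where ac: "X = cbox a c" using D(3) by blast
    have "AE x in lebesgue. \<forall>b\<in>Basis. x \<in> box a c \<longrightarrow> (g x - h x) \<bullet> b = 0"
      unfolding AE_ball_countable[OF countable_finite[OF finite_Basis]]
      using local D(2) X ac by blast
    moreover have "AE x in lebesgue. x \<notin> cbox a c - box a c"
      using negligible_frontier_interval[of a c] unfolding negligible_iff_null_sets by (rule AE_not_in)
    ultimately show "AE x in lebesgue. x \<in> X \<longrightarrow> g x = h x"
    proof eventually_elim
      case (elim x)
      show ?case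
      proof
        assume "x \<in> X"
        with elim ac have "\<forall>b\<in>Basis. (g x - h x) \<bullet> b = 0" by blast
        then have "g x - h x = 0" using euclidean_all_zero_iff by blast
        then show "g x = h x" by simp
      qed
    qed
  qed
  then have "AE x in lebesgue. x \<in> \<Omega> \<longrightarrow> g x = h x"
    by eventually_elim (use D(4) in blast)
  then show ?thesis
    using \<Omega>s by (subst AE_restrict_space_iff) auto
qed

lemma weak_grad_props:
  assumes "u \<in> W12 \<Omega>"
  shows "weak_grad \<Omega> u \<in> L2 \<Omega>" "has_weak_gradient \<Omega> u (weak_grad \<Omega> u)" "u \<in> L2 \<Omega>"
proof -
  have "\<exists>g. g \<in> L2 \<Omega> \<and> has_weak_gradient \<Omega> u g" using assms by (simp add: W12_def)
  from someI_ex[OF this]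
  show "weak_grad \<Omega> u \<in> L2 \<Omega>" "has_weak_gradient \<Omega> u (weak_grad \<Omega> u)"
    by (simp_all add: weak_grad_def)
  show "u \<in> L2 \<Omega>" using assms by (simp add: W12_def)
qed

text \<open>\<open>weak_grad\<close> is an unspecified choice. Uniqueness lets any explicitly
  computed weak gradient replace it under an integral, as needed for \<open>J\<close> and for the
  norms.\<close>

lemma weak_grad_AE_eq:
  assumes "open \<Omega>" "u \<in> L2 \<Omega>" "g \<in> L2 \<Omega>" "has_weak_gradient \<Omega> u g"
  shows "AE x in lebesgue_on \<Omega>. weak_grad \<Omega> u x = g x"
proof -
  have "u \<in> W12 \<Omega>" using assms by (auto simp: W12_def)
  from weak_gradient_unique[OF assms(1) weak_grad_props(1,2)[OF this] assms(3,4)] show ?thesis .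
qed

text \<open>The bound is claimed only eventually: for the first indices the deviation may be
  unbounded, and its supremum is then meaningless.\<close>

lemma uniform_limit_sup_bound:
  fixes \<phi> :: "nat \<Rightarrow> 'a \<Rightarrow> real"
  assumes "uniform_limit UNIV \<phi> f sequentially"
  obtains d where "d \<longlonglongrightarrow> (0::real)" "\<forall>\<^sub>F n in sequentially. \<forall>x. \<bar>f x - \<phi> n x\<bar> \<le> d n"
proof -
  define d where "d n = (SUP x. \<bar>f x - \<phi> n x\<bar>)" for n
  have ev: "\<forall>\<^sub>F n in sequentially. \<forall>x. \<bar>f x - \<phi> n x\<bar> \<le> \<eta>" if "\<eta> > 0" for \<eta>
    using uniform_limitD[OF assms that]
    by eventually_elim (auto simp: dist_real_def abs_minus_commute less_imp_le)
  have bound: "\<forall>\<^sub>F n in sequentially. \<forall>x. \<bar>f x - \<phi> n x\<bar> \<le> d n"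
    using ev[OF zero_less_one]
  proof eventually_elim
    case (elim n)
    then show ?case
      unfolding d_def by (auto intro!: cSUP_upper bdd_aboveI2)
  qed
  have "d \<longlonglongrightarrow> 0"
  proof (rule LIMSEQ_I)
    fix r :: real assume "r > 0"
    have "\<forall>\<^sub>F n in sequentially. norm (d n - 0) < r"
      using ev[OF half_gt_zero[OF \<open>r > 0\<close>]] bound
    proof eventually_elim
      case (elim n)
      have "d n \<le> r / 2" unfolding d_def using elim(1) by (intro cSUP_least) auto
      moreover have "0 \<le> d n" using elim(2) abs_ge_zero order_trans by blast
      ultimately show ?case using \<open>r > 0\<close> by simp
    qed
    then show "\<exists>no. \<forall>n\<ge>no. norm (d n - 0) < r" by (simp add: eventually_sequentially)
  qed
  with bound show thesis by (rule that[rotated])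
qed

text \<open>On the common compact support the uniform error contributes \<open>(d n)\<^sup>2\<close>
  times an area, and the gradient error is the sum of the componentwise L2 errors. The lemma admits
  the correction \<open>- w\<close> in \<open>caccioppoli\<close>.\<close>

lemma compact_support_W12_0:
  fixes f :: "'a::euclidean_space \<Rightarrow> real"
  assumes \<Omega>: "open \<Omega>" and f: "continuous_on UNIV f" "\<And>x. x \<notin> K \<Longrightarrow> f x = 0"
    and g: "g \<in> L2 \<Omega>" "\<And>x. x \<notin> K \<Longrightarrow> g x = 0"
    and wg: "has_weak_gradient \<Omega> f g" and K: "compact K" "K \<subseteq> \<Omega>"
  shows "f \<in> W12_0 \<Omega>"
proof -
  have \<Omega>s: "\<Omega> \<in> sets lebesgue" using \<Omega> by auto
  obtain \<phi> K' where \<phi>: "\<And>n::nat. \<phi> n \<in> test_functions \<Omega>" and K': "compact K'" "K \<subseteq> K'" "K' \<subseteq> \<Omega>"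
    and \<phi>0: "\<And>n x. x \<notin> K' \<Longrightarrow> \<phi> n x = 0" "\<And>n x. x \<notin> K' \<Longrightarrow> grad (\<phi> n) x = 0"
    and unif: "uniform_limit UNIV \<phi> f sequentially"
    and lim: "\<And>b. b \<in> Basis \<Longrightarrow>
      (\<lambda>n. \<integral>\<^sup>+x. ennreal (((grad (\<phi> n) x - g x) \<bullet> b)\<^sup>2) \<partial>lebesgue) \<longlonglongrightarrow> 0"
    by (rule weak_gradient_approx[OF \<Omega> f g wg K]) (assumption | rule that)+
  have fL2: "f \<in> L2 \<Omega>" using L2_compact_support[OF f(1) K(1) f(2) \<Omega>s] .
  have fW: "f \<in> W12 \<Omega>" using fL2 g(1) wg by (auto simp: W12_def)
  define C where "C = measure lebesgue K'"
  have C: "emeasure lebesgue K' = ennreal C" "C \<ge> 0" "K' \<in> sets lebesgue"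
    using emeasure_eq_measure2[OF lmeasurable_compact[OF K'(1)]] compact_imp_lebesgue[OF K'(1)]
    by (simp_all only: C_def measure_nonneg)
  have g0: "g x = 0" if "x \<notin> K'" for x using that K' g(2) by blast
  have meas: "(\<lambda>x. (grad (\<phi> n) x - g x) \<bullet> b) \<in> borel_measurable lebesgue" for n b
  proof -
    have "(\<lambda>x. (grad (\<phi> n) x - g x) \<bullet> b) \<in> L2 \<Omega>"
      by (intro L2_inner L2_diff test_function_L2(2)[OF \<phi>] g(1) \<Omega>s)
    then show ?thesis
      using measurable_lebesgue_on_zero_outside[OF \<Omega>s, of "\<lambda>x. (grad (\<phi> n) x - g x) \<bullet> b"] L2_borel_measurable
        g0 \<phi>0(2) K'(3) by fastforce
  qed
  obtain d where d: "d \<longlonglongrightarrow> (0::real)" "\<forall>\<^sub>F n in sequentially. \<forall>x. \<bar>f x - \<phi> n x\<bar> \<le> d n"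
    using uniform_limit_sup_bound[OF unif] by blast
  have "(\<lambda>n. W12_norm_sq \<Omega> (\<lambda>x. f x - \<phi> n x)) \<longlonglongrightarrow> 0"
  proof (rule tendsto_sandwich[OF _ _ tendsto_const])
    show "\<forall>\<^sub>F n in sequentially. W12_norm_sq \<Omega> (\<lambda>x. f x - \<phi> n x) \<le>
       ennreal ((d n)\<^sup>2 * C) + (\<Sum>b\<in>Basis. \<integral>\<^sup>+x. ennreal (((grad (\<phi> n) x - g x) \<bullet> b)\<^sup>2) \<partial>lebesgue)"
      using d(2)
    proof eventually_elim
      case (elim n)
      have wgd: "has_weak_gradient \<Omega> (\<lambda>x. f x - \<phi> n x) (\<lambda>x. g x - grad (\<phi> n) x)"
        using has_weak_gradient_add_scaled[OF fL2 g(1) wg test_function_L2[OF \<phi> \<Omega>s]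
            test_function_weak_gradient[OF \<phi> \<Omega>s] \<Omega>s, of "-1"] by simp
      have "AE x in lebesgue_on \<Omega>. weak_grad \<Omega> (\<lambda>x. f x - \<phi> n x) x = g x - grad (\<phi> n) x"
        by (rule weak_grad_AE_eq[OF \<Omega> _ _ wgd]) (intro L2_diff fL2 g(1) test_function_L2[OF \<phi> \<Omega>s])+
      then have "W12_norm_sq \<Omega> (\<lambda>x. f x - \<phi> n x)
          = (\<integral>\<^sup>+x. ennreal ((f x - \<phi> n x)\<^sup>2 + (norm (g x - grad (\<phi> n) x))\<^sup>2) \<partial>lebesgue_on \<Omega>)"
        unfolding W12_norm_sq_def by (intro nn_integral_cong_AE, eventually_elim) simp
      also have "\<dots> = (\<integral>\<^sup>+x. ennreal ((f x - \<phi> n x)\<^sup>2 + (norm (g x - grad (\<phi> n) x))\<^sup>2) \<partial>lebesgue)"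
      proof (rule nn_integral_lebesgue_on_zero_outside[OF \<Omega>s])
        fix x assume "x \<notin> \<Omega>"
        then have "x \<notin> K" "x \<notin> K'" using K K' by blast+
        then show "ennreal ((f x - \<phi> n x)\<^sup>2 + (norm (g x - grad (\<phi> n) x))\<^sup>2) = 0"
          by (simp add: f(2) g(2) \<phi>0)
      qed
      also have "\<dots> \<le> (\<integral>\<^sup>+x. ennreal ((d n)\<^sup>2) * indicator K' x +
          (\<Sum>b\<in>Basis. ennreal (((grad (\<phi> n) x - g x) \<bullet> b)\<^sup>2)) \<partial>lebesgue)"
      proof (rule nn_integral_mono)
        fix x
        have "(f x - \<phi> n x)\<^sup>2 \<le> (d n)\<^sup>2 * indicator K' x"
        proof (cases "x \<in> K'")
          case True
          then show ?thesis
            using power_mono[OF elim[rule_format, of x] abs_ge_zero, of 2] by simp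
        next
          case False
          then show ?thesis using f(2) \<phi>0(1) K'(2) by auto
        qed
        then have "(f x - \<phi> n x)\<^sup>2 + (norm (g x - grad (\<phi> n) x))\<^sup>2
          \<le> (d n)\<^sup>2 * indicator K' x + (\<Sum>b\<in>Basis. ((grad (\<phi> n) x - g x) \<bullet> b)\<^sup>2)"
          by (simp only: norm_minus_commute[of "g x"] norm_sq_eq_sum_Basis)
        from ennreal_leI[OF this]
        show "ennreal ((f x - \<phi> n x)\<^sup>2 + (norm (g x - grad (\<phi> n) x))\<^sup>2)
          \<le> ennreal ((d n)\<^sup>2) * indicator K' x + (\<Sum>b\<in>Basis. ennreal (((grad (\<phi> n) x - g x) \<bullet> b)\<^sup>2))"
          by (subst (asm) ennreal_plus)
             (simp_all add: sum_nonneg sum_ennreal ennreal_mult ennreal_indicator)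
      qed
      also have "\<dots> = ennreal ((d n)\<^sup>2 * C) + (\<Sum>b\<in>Basis. \<integral>\<^sup>+x. ennreal (((grad (\<phi> n) x - g x) \<bullet> b)\<^sup>2) \<partial>lebesgue)"
      proof (subst nn_integral_add)
        have "(\<integral>\<^sup>+x. ennreal ((d n)\<^sup>2) * indicator K' x \<partial>lebesgue) = ennreal ((d n)\<^sup>2 * C)"
          using C by (simp only: nn_integral_cmult_indicator ennreal_mult zero_le_power2)
        moreover have "(\<integral>\<^sup>+x. (\<Sum>b\<in>Basis. ennreal (((grad (\<phi> n) x - g x) \<bullet> b)\<^sup>2)) \<partial>lebesgue)
            = (\<Sum>b\<in>Basis. \<integral>\<^sup>+x. ennreal (((grad (\<phi> n) x - g x) \<bullet> b)\<^sup>2) \<partial>lebesgue)"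
          using meas by (intro nn_integral_sum) simp
        ultimately show "(\<integral>\<^sup>+x. ennreal ((d n)\<^sup>2) * indicator K' x \<partial>lebesgue)
            + (\<integral>\<^sup>+x. (\<Sum>b\<in>Basis. ennreal (((grad (\<phi> n) x - g x) \<bullet> b)\<^sup>2)) \<partial>lebesgue)
          = ennreal ((d n)\<^sup>2 * C) + (\<Sum>b\<in>Basis. \<integral>\<^sup>+x. ennreal (((grad (\<phi> n) x - g x) \<bullet> b)\<^sup>2) \<partial>lebesgue)"
          by simp
      qed (use C(3) meas in auto)
      finally show ?case .
    qed
    have "(\<lambda>n. ennreal ((d n)\<^sup>2 * C) + (\<Sum>b\<in>Basis. \<integral>\<^sup>+x. ennreal (((grad (\<phi> n) x - g x) \<bullet> b)\<^sup>2) \<partial>lebesgue))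
      \<longlonglongrightarrow> ennreal (0\<^sup>2 * C) + (\<Sum>b\<in>(Basis::'a set). 0)"
      by (intro tendsto_intros d(1) lim)
    then show "(\<lambda>n. ennreal ((d n)\<^sup>2 * C) + (\<Sum>b\<in>Basis. \<integral>\<^sup>+x. ennreal (((grad (\<phi> n) x - g x) \<bullet> b)\<^sup>2) \<partial>lebesgue)) \<longlonglongrightarrow> 0"
      by simp
  qed simp
  with fW \<phi> show ?thesis by (auto simp: W12_0_def)
qed

section \<open>The chain rule and the weak gradient of the positive part\<close>

lemma L2_null_imp_L1_null:
  fixes a :: "nat \<Rightarrow> 'a \<Rightarrow> real"
  assumes [measurable]: "\<And>n. a n \<in> borel_measurable M" "c \<in> borel_measurable M"
    and c: "integrable M (\<lambda>x. (c x)\<^sup>2)"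
    and lim: "(\<lambda>n. \<integral>\<^sup>+x. ennreal ((a n x)\<^sup>2) \<partial>M) \<longlonglongrightarrow> 0"
  shows "(\<lambda>n. \<integral>\<^sup>+x. ennreal \<bar>a n x * c x\<bar> \<partial>M) \<longlonglongrightarrow> 0"
proof (rule order_tendstoI)
  fix b :: ennreal assume "0 < b"
  define C where "C = (\<integral>\<^sup>+x. ennreal ((c x)\<^sup>2) \<partial>M)"
  have "C < top" using nn_integral_eq_integral[OF c] by (simp add: C_def)
  have cs: "(\<integral>\<^sup>+x. ennreal \<bar>a n x * c x\<bar> \<partial>M)\<^sup>2 \<le> C * (\<integral>\<^sup>+x. ennreal ((a n x)\<^sup>2) \<partial>M)" for n
    using Cauchy_Schwarz_nn_integral[of "\<lambda>x. ennreal \<bar>a n x\<bar>" M "\<lambda>x. ennreal \<bar>c x\<bar>"]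
    by (simp add: ennreal_power abs_mult ennreal_mult C_def mult.commute)
  have "(\<lambda>n. C * (\<integral>\<^sup>+x. ennreal ((a n x)\<^sup>2) \<partial>M)) \<longlonglongrightarrow> C * 0"
    using \<open>C < top\<close> lim by (rule ennreal_tendsto_cmult)
  moreover have "C * 0 < b\<^sup>2"
    using \<open>0 < b\<close> by (simp add: power2_eq_square ennreal_zero_less_mult_iff)
  ultimately have "\<forall>\<^sub>F n in sequentially. C * (\<integral>\<^sup>+x. ennreal ((a n x)\<^sup>2) \<partial>M) < b\<^sup>2"
    by (rule order_tendstoD(2))
  then show "\<forall>\<^sub>F n in sequentially. (\<integral>\<^sup>+x. ennreal \<bar>a n x * c x\<bar> \<partial>M) < b"
  proof eventually_elim
    case (elim n)
    show ?case
    proof (rule ccontr)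
      assume "\<not> ?case"
      then have "b\<^sup>2 \<le> (\<integral>\<^sup>+x. ennreal \<bar>a n x * c x\<bar> \<partial>M)\<^sup>2" by (intro power_mono) auto
      with cs[of n] elim show False by (meson leD order_trans)
    qed
  qed
qed auto

lemma integral_tendsto_zero_if_nn_integral:
  fixes h :: "nat \<Rightarrow> 'a \<Rightarrow> real"
  assumes "\<And>n. integrable M (h n)" "(\<lambda>n. \<integral>\<^sup>+x. ennreal \<bar>h n x\<bar> \<partial>M) \<longlonglongrightarrow> 0"
  shows "(\<lambda>n. LINT x|M. h n x) \<longlonglongrightarrow> 0"
proof -
  have "ennreal (LINT x|M. \<bar>h n x\<bar>) = (\<integral>\<^sup>+x. ennreal \<bar>h n x\<bar> \<partial>M)" for n
    using nn_integral_eq_integral[of M "\<lambda>x. \<bar>h n x\<bar>"] assms(1) by simp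
  then have "(\<lambda>n. LINT x|M. \<bar>h n x\<bar>) \<longlonglongrightarrow> 0"
    using assms(2) tendsto_ennrealD[of "\<lambda>n. LINT x|M. \<bar>h n x\<bar>" 0] by simp
  then show ?thesis
    by (rule Lim_null_comparison[rotated]) (auto intro: integral_abs_bound)
qed

text \<open>For the smooth approximants this is classical integration by parts. The left side passes
  to the limit because F is 1-Lipschitz and the convergence is uniform; the right side needs the
  splitting in \<open>A\<close> and \<open>B\<close>.\<close>

lemma weak_gradient_chain_rule:
  fixes f :: "'a::euclidean_space \<Rightarrow> real" and F :: "real \<Rightarrow> real"
  assumes \<Omega>: "open \<Omega>" and f: "continuous_on UNIV f" "\<And>x. x \<notin> K \<Longrightarrow> f x = 0"
    and g: "g \<in> L2 \<Omega>" "\<And>x. x \<notin> K \<Longrightarrow> g x = 0"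
    and wg: "has_weak_gradient \<Omega> f g" and K: "compact K" "K \<subseteq> \<Omega>"
    and F: "\<And>t. (F has_real_derivative F' t) (at t)" "continuous_on UNIV F'" "\<And>t. \<bar>F' t\<bar> \<le> 1"
    and \<psi>: "\<psi> \<in> test_functions \<Omega>" and b: "b \<in> Basis"
  shows "(LINT x|lebesgue. F (f x) * frechet_derivative \<psi> (at x) b)
    = - (LINT x|lebesgue. F' (f x) * (g x \<bullet> b) * \<psi> x)"
proof -
  have \<Omega>s: "\<Omega> \<in> sets lebesgue" using \<Omega> by auto
  obtain \<phi> K' where \<phi>: "\<And>n::nat. \<phi> n \<in> test_functions \<Omega>" and K': "compact K'" "K \<subseteq> K'" "K' \<subseteq> \<Omega>"
    and \<phi>0: "\<And>n x. x \<notin> K' \<Longrightarrow> \<phi> n x = 0" "\<And>n x. x \<notin> K' \<Longrightarrow> grad (\<phi> n) x = 0"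
    and unif: "uniform_limit UNIV \<phi> f sequentially"
    and lim: "\<And>b. b \<in> Basis \<Longrightarrow>
      (\<lambda>n. \<integral>\<^sup>+x. ennreal (((grad (\<phi> n) x - g x) \<bullet> b)\<^sup>2) \<partial>lebesgue) \<longlonglongrightarrow> 0"
    by (rule weak_gradient_approx[OF \<Omega> f g wg K]) (assumption | rule that)+
  obtain d where d: "d \<longlonglongrightarrow> (0::real)" "\<forall>\<^sub>F n in sequentially. \<forall>x. \<bar>f x - \<phi> n x\<bar> \<le> d n"
    using uniform_limit_sup_bound[OF unif] by blast
  have cF: "continuous_on UNIV F"
    using F(1) DERIV_isCont continuous_at_imp_continuous_on by blast
  have lip: "\<bar>F s - F t\<bar> \<le> \<bar>s - t\<bar>" for s t
    using field_differentiable_bound[of UNIV F F' 1 s t] F by simp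
  note c\<phi> = test_function_continuous[OF \<phi>]
  define D where "D x = frechet_derivative \<psi> (at x) b" for x
  have Dt: "D \<in> test_functions \<Omega>" unfolding D_def[abs_def] by (rule test_function_derivative(2)[OF \<psi> b])
  have leb: "h \<in> borel_measurable lebesgue" if "continuous_on UNIV h" for h :: "'a \<Rightarrow> real"
    using borel_measurable_continuous_onI[OF that] by (simp add: measurable_completion)
  have mg: "(\<lambda>x. g x \<bullet> b) \<in> borel_measurable lebesgue"
  proof -
    have "g x \<bullet> b = 0" if "x \<notin> \<Omega>" for x
      using g(2)[OF contra_subsetD[OF K(2) that]] by simp
    from measurable_lebesgue_on_zero_outside[OF \<Omega>s, of "\<lambda>x. g x \<bullet> b", OF this] show ?thesis
      using L2_borel_measurable[OF L2_inner[OF g(1)]] by simp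
  qed
  have [measurable]: "(\<lambda>x. g x \<bullet> b) \<in> borel_measurable lebesgue" "\<psi> \<in> borel_measurable lebesgue"
    "D \<in> borel_measurable lebesgue" "f \<in> borel_measurable lebesgue" "\<And>n. \<phi> n \<in> borel_measurable lebesgue"
    "\<And>n. (\<lambda>x. grad (\<phi> n) x \<bullet> b) \<in> borel_measurable lebesgue"
    by (intro mg leb test_function_continuous[OF \<psi>] test_function_continuous[OF Dt] f(1) c\<phi>
        continuous_intros continuous_grad[OF \<phi>])+
  have [measurable]: "F \<in> borel_measurable borel" "F' \<in> borel_measurable borel"
    by (intro borel_measurable_continuous_onI cF F(2))+
  have id: "(LINT x|lebesgue. F (\<phi> n x) * D x) = - (LINT x|lebesgue. F' (\<phi> n x) * (grad (\<phi> n) x \<bullet> b) * \<psi> x)" for n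
  proof -
    let ?f' = "\<lambda>x h. F (\<phi> n x) * frechet_derivative \<psi> (at x) h
      + F' (\<phi> n x) * frechet_derivative (\<phi> n) (at x) h * \<psi> x"
    have der: "((\<lambda>x. F (\<phi> n x) * \<psi> x) has_derivative ?f' x) (at x)" for x
      using has_derivative_mult[OF has_derivative_compose[OF test_function_derivative(1)[OF \<phi>, of n x]
            F(1)[unfolded has_field_derivative_def]] test_function_derivative(1)[OF \<psi>, of x]] by simp
    have cF\<phi>: "continuous_on UNIV (\<lambda>x. F (\<phi> n x))" "continuous_on UNIV (\<lambda>x. F' (\<phi> n x))"
      by (rule continuous_on_compose2[OF cF c\<phi>], simp, rule continuous_on_compose2[OF F(2) c\<phi>], simp)
    have cD: "continuous_on UNIV (\<lambda>x. frechet_derivative \<psi> (at x) c)"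
      "continuous_on UNIV (\<lambda>x. frechet_derivative (\<phi> n) (at x) c)" if "c \<in> Basis" for c
      using test_function_continuous[OF test_function_derivative(2)[OF \<psi> that]]
        test_function_continuous[OF test_function_derivative(2)[OF \<phi> that]] .
    obtain L where L: "compact L" "L \<subseteq> \<Omega>" "\<And>x. x \<notin> L \<Longrightarrow> \<psi> x = 0"
      "\<And>x c. x \<notin> L \<Longrightarrow> frechet_derivative \<psi> (at x) c = 0"
      using test_function_support[OF \<psi>] by blast
    have "(LINT x|lborel. ?f' x b) = 0"
      by (rule integral_derivative_compact_support[OF der _ L(1) _ b])
         (use cF\<phi> cD L(3) test_function_continuous[OF \<psi>] in \<open>auto intro!: continuous_intros\<close>)
    moreover have "integrable lborel (\<lambda>x. F (\<phi> n x) * D x)"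
      by (rule integrable_compact_support[OF _ L(1)])
         (use cF\<phi> cD b L(4) in \<open>auto simp: D_def intro!: continuous_intros\<close>)
    moreover have "integrable lborel (\<lambda>x. F' (\<phi> n x) * (grad (\<phi> n) x \<bullet> b) * \<psi> x)"
      by (rule integrable_compact_support[OF _ L(1)])
         (use cF\<phi> continuous_grad[OF \<phi>] L(3) test_function_continuous[OF \<psi>] in \<open>auto intro!: continuous_intros\<close>)
    ultimately have "(LINT x|lborel. F (\<phi> n x) * D x) = - (LINT x|lborel. F' (\<phi> n x) * (grad (\<phi> n) x \<bullet> b) * \<psi> x)"
      by (simp add: D_def[symmetric] grad_inner_Basis[OF b])
    moreover have "(\<lambda>x. F (\<phi> n x) * D x) \<in> borel_measurable borel"
      "(\<lambda>x. F' (\<phi> n x) * (grad (\<phi> n) x \<bullet> b) * \<psi> x) \<in> borel_measurable borel"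
      by (intro borel_measurable_continuous_onI continuous_intros cF\<phi> continuous_grad[OF \<phi>]
          test_function_continuous[OF \<psi>] test_function_continuous[OF Dt])+
    ultimately show ?thesis by (simp only: lebesgue_integral_lborel)
  qed
  have intD: "integrable lebesgue D"
  proof -
    obtain L where L: "compact L" "L \<subseteq> \<Omega>" "\<And>x. x \<notin> L \<Longrightarrow> D x = 0"
      "\<And>x c. x \<notin> L \<Longrightarrow> frechet_derivative D (at x) c = 0"
      using test_function_support[OF Dt] by blast
    have "integrable lborel D"
      by (rule integrable_compact_support[OF test_function_continuous[OF Dt] L(1,3)])
    then show ?thesis
      by (subst integrable_completion) auto
  qed
  have FD: "integrable lebesgue (\<lambda>x. F (h x) * D x)" if h: "continuous_on UNIV h" for h :: "'a \<Rightarrow> real"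
  proof -
    obtain L where L: "compact L" "L \<subseteq> \<Omega>" "\<And>x. x \<notin> L \<Longrightarrow> D x = 0"
      "\<And>x c. x \<notin> L \<Longrightarrow> frechet_derivative D (at x) c = 0"
      using test_function_support[OF Dt] by blast
    have c: "continuous_on UNIV (\<lambda>x. F (h x) * D x)"
      by (intro continuous_intros test_function_continuous[OF Dt] continuous_on_compose2[OF cF h]) auto
    have "integrable lborel (\<lambda>x. F (h x) * D x)"
      by (rule integrable_compact_support[OF c L(1)]) (simp add: L(3))
    then show ?thesis
      using borel_measurable_continuous_onI[OF c] by (subst integrable_completion) auto
  qed
  have L1: "(\<lambda>n. LINT x|lebesgue. F (\<phi> n x) * D x) \<longlonglongrightarrow> (LINT x|lebesgue. F (f x) * D x)"
  proof (rule LIM_zero_cancel, rule Lim_null_comparison)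
    show "\<forall>\<^sub>F n in sequentially. norm ((LINT x|lebesgue. F (\<phi> n x) * D x) - (LINT x|lebesgue. F (f x) * D x))
        \<le> d n * (LINT x|lebesgue. \<bar>D x\<bar>)"
      using d(2)
    proof eventually_elim
      case (elim n)
      have "(LINT x|lebesgue. F (\<phi> n x) * D x) - (LINT x|lebesgue. F (f x) * D x)
          = (LINT x|lebesgue. (F (\<phi> n x) - F (f x)) * D x)"
        using FD[OF c\<phi>] FD[OF f(1)] by (simp add: left_diff_distrib)
      also have "\<bar>\<dots>\<bar> \<le> (LINT x|lebesgue. d n * \<bar>D x\<bar>)"
      proof (rule integral_abs_bound[THEN order_trans], rule integral_mono')
        show "\<bar>(F (\<phi> n x) - F (f x)) * D x\<bar> \<le> d n * \<bar>D x\<bar>" for x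
          using lip[of "\<phi> n x" "f x"] elim[rule_format, of x]
          by (auto simp: abs_mult abs_minus_commute intro!: mult_right_mono)
        have "0 \<le> d n" using elim abs_ge_zero order_trans by blast
        then show "0 \<le> d n * \<bar>D x\<bar>" for x by simp
      qed (use intD in auto)
      finally show ?case by simp
    qed
    show "(\<lambda>n. d n * (LINT x|lebesgue. \<bar>D x\<bar>)) \<longlonglongrightarrow> 0"
      using tendsto_mult_left_zero[OF d(1)] .
  qed
  have \<psi>2: "integrable lebesgue (\<lambda>x. (\<psi> x)\<^sup>2)"
    using L2_mult_test_function_integrable[OF test_function_L2(1)[OF \<psi> \<Omega>s] \<psi> \<Omega>s]
    by (simp add: power2_eq_square)
  have gi: "integrable lebesgue (\<lambda>x. (g x \<bullet> b) * \<psi> x)"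
    by (rule L2_mult_test_function_integrable[OF L2_inner[OF g(1)] \<psi> \<Omega>s])
  have di: "integrable lebesgue (\<lambda>x. ((grad (\<phi> n) x - g x) \<bullet> b) * \<psi> x)" for n
    by (intro L2_mult_test_function_integrable[OF _ \<psi> \<Omega>s] L2_inner L2_diff test_function_L2(2)[OF \<phi> \<Omega>s] g(1))
  have bdd: "integrable lebesgue (\<lambda>x. F' (h x) * k x)"
    if "h \<in> borel_measurable lebesgue" "integrable lebesgue k" for h k :: "'a \<Rightarrow> real"
    using that F(3) by (intro integrable_mult_bounded[where B=1]) auto
  \<comment> \<open>The error of the gradient and the change of \<open>F'\<close> are treated
    separately. Here the bounded factor \<open>F'\<close> meets a gradient error that tends to 0 in
    L2.\<close>
  have A: "(\<lambda>n. LINT x|lebesgue. F' (\<phi> n x) * (((grad (\<phi> n) x - g x) \<bullet> b) * \<psi> x)) \<longlonglongrightarrow> 0"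
  proof (rule integral_tendsto_zero_if_nn_integral)
    show "integrable lebesgue (\<lambda>x. F' (\<phi> n x) * (((grad (\<phi> n) x - g x) \<bullet> b) * \<psi> x))" for n
      by (rule bdd[OF _ di]) measurable
    have "(\<lambda>n. \<integral>\<^sup>+x. ennreal \<bar>((grad (\<phi> n) x - g x) \<bullet> b) * \<psi> x\<bar> \<partial>lebesgue) \<longlonglongrightarrow> 0"
      by (rule L2_null_imp_L1_null[OF _ _ \<psi>2 lim[OF b]]) (auto simp: inner_diff_left)
    then show "(\<lambda>n. \<integral>\<^sup>+x. ennreal \<bar>F' (\<phi> n x) * (((grad (\<phi> n) x - g x) \<bullet> b) * \<psi> x)\<bar> \<partial>lebesgue) \<longlonglongrightarrow> 0"
    proof (rule tendsto_sandwich[OF _ _ tendsto_const, rotated 2])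
      have "\<bar>F' (\<phi> n x) * (((grad (\<phi> n) x - g x) \<bullet> b) * \<psi> x)\<bar> \<le> 1 * \<bar>((grad (\<phi> n) x - g x) \<bullet> b) * \<psi> x\<bar>" for n x
        unfolding abs_mult[of "F' (\<phi> n x)"] by (intro mult_right_mono F(3)) simp
      then show "\<forall>\<^sub>F n in sequentially. (\<integral>\<^sup>+x. ennreal \<bar>F' (\<phi> n x) * (((grad (\<phi> n) x - g x) \<bullet> b) * \<psi> x)\<bar> \<partial>lebesgue)
        \<le> (\<integral>\<^sup>+x. ennreal \<bar>((grad (\<phi> n) x - g x) \<bullet> b) * \<psi> x\<bar> \<partial>lebesgue)"
        by (intro always_eventually allI nn_integral_mono ennreal_leI) simp
    qed simp
  qed
  \<comment> \<open>\<open>F'\<close> is merely continuous, so its values converge pointwise and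
    domination by the fixed integrable function does the rest.\<close>
  have B: "(\<lambda>n. LINT x|lebesgue. F' (\<phi> n x) * ((g x \<bullet> b) * \<psi> x)) \<longlonglongrightarrow> (LINT x|lebesgue. F' (f x) * ((g x \<bullet> b) * \<psi> x))"
  proof (rule integral_dominated_convergence[where w="\<lambda>x. \<bar>(g x \<bullet> b) * \<psi> x\<bar>"])
    show "AE x in lebesgue. (\<lambda>n. F' (\<phi> n x) * ((g x \<bullet> b) * \<psi> x)) \<longlonglongrightarrow> F' (f x) * ((g x \<bullet> b) * \<psi> x)"
    proof (rule AE_I2)
      fix x
      have "(\<lambda>n. \<phi> n x) \<longlonglongrightarrow> f x" using tendsto_uniform_limitI[OF unif] by simp
      then have "(\<lambda>n. F' (\<phi> n x)) \<longlonglongrightarrow> F' (f x)"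
        using F(2) by (auto intro: continuous_on_tendsto_compose[OF F(2)])
      then show "(\<lambda>n. F' (\<phi> n x) * ((g x \<bullet> b) * \<psi> x)) \<longlonglongrightarrow> F' (f x) * ((g x \<bullet> b) * \<psi> x)"
        by (intro tendsto_intros)
    qed
    show "AE x in lebesgue. norm (F' (\<phi> n x) * ((g x \<bullet> b) * \<psi> x)) \<le> \<bar>(g x \<bullet> b) * \<psi> x\<bar>" for n
      using F(3) by (intro AE_I2) (simp only: real_norm_def abs_mult[of "F' _"] mult_left_le_one_le abs_ge_zero)
  qed (use gi in \<open>auto simp: mult.assoc[symmetric]\<close>)
  have "(LINT x|lebesgue. F (\<phi> n x) * D x) =
      - ((LINT x|lebesgue. F' (\<phi> n x) * (((grad (\<phi> n) x - g x) \<bullet> b) * \<psi> x))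
        + (LINT x|lebesgue. F' (\<phi> n x) * ((g x \<bullet> b) * \<psi> x)))" for n
  proof -
    have "integrable lebesgue (\<lambda>x. F' (\<phi> n x) * (((grad (\<phi> n) x - g x) \<bullet> b) * \<psi> x))"
      "integrable lebesgue (\<lambda>x. F' (\<phi> n x) * ((g x \<bullet> b) * \<psi> x))"
      by (rule bdd[OF _ di], measurable, rule bdd[OF _ gi], measurable)
    then have "(LINT x|lebesgue. F' (\<phi> n x) * (((grad (\<phi> n) x - g x) \<bullet> b) * \<psi> x))
        + (LINT x|lebesgue. F' (\<phi> n x) * ((g x \<bullet> b) * \<psi> x))
      = (LINT x|lebesgue. F' (\<phi> n x) * (((grad (\<phi> n) x - g x) \<bullet> b) * \<psi> x) + F' (\<phi> n x) * ((g x \<bullet> b) * \<psi> x))"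
      by (rule Bochner_Integration.integral_add[symmetric])
    also have "\<dots> = (LINT x|lebesgue. F' (\<phi> n x) * (grad (\<phi> n) x \<bullet> b) * \<psi> x)"
      by (rule Bochner_Integration.integral_cong) (auto simp: inner_diff_left algebra_simps)
    finally show ?thesis unfolding id by simp
  qed
  moreover have "(\<lambda>n. - ((LINT x|lebesgue. F' (\<phi> n x) * (((grad (\<phi> n) x - g x) \<bullet> b) * \<psi> x))
        + (LINT x|lebesgue. F' (\<phi> n x) * ((g x \<bullet> b) * \<psi> x))))
      \<longlonglongrightarrow> - (0 + (LINT x|lebesgue. F' (f x) * ((g x \<bullet> b) * \<psi> x)))"
    by (intro tendsto_intros A B)
  ultimately have "(LINT x|lebesgue. F (f x) * D x) = - (0 + (LINT x|lebesgue. F' (f x) * ((g x \<bullet> b) * \<psi> x)))"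
    using LIMSEQ_unique[OF L1] by presburger
  then show ?thesis by (simp add: D_def mult.assoc)
qed

text \<open>The square of \<open>max 0 t\<close> is continuously differentiable, and adding
  \<open>\<delta>\<^sup>2\<close> keeps the root away from its singularity. As
  \<open>\<delta>\<close> tends to 0, F tends to \<open>max 0 t\<close> and \<open>F'\<close> to the
  indicator of t > 0, both within bounds that do not depend on \<open>\<delta>\<close>.\<close>

lemma pos_part_regularization:
  fixes \<delta> :: real
  assumes "\<delta> > 0"
  defines "F \<equiv> \<lambda>t. sqrt ((max 0 t)\<^sup>2 + \<delta>\<^sup>2) - \<delta>"
    and "F' \<equiv> \<lambda>t. max 0 t / sqrt ((max 0 t)\<^sup>2 + \<delta>\<^sup>2)"
  shows "(F has_real_derivative F' t) (at t)" "continuous_on UNIV F'" "\<bar>F' t\<bar> \<le> 1" "\<bar>F t\<bar> \<le> \<bar>t\<bar>"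
proof -
  have pos: "(max 0 s)\<^sup>2 + \<delta>\<^sup>2 > 0" for s :: real
    using assms(1) by (simp add: add_nonneg_pos)
  have sq: "((\<lambda>t. (max 0 t)\<^sup>2) has_real_derivative 2 * max 0 t) (at t)" for t :: real
  proof -
    consider "t > 0" | "t < 0" | "t = 0" by linarith
    then show ?thesis
    proof cases
      case 1
      have "((\<lambda>t. t\<^sup>2) has_real_derivative 2 * max 0 t) (at t)"
        using 1 by (auto intro!: derivative_eq_intros)
      then show ?thesis
        by (rule has_field_derivative_transform_within_open[where S="{0<..}"]) (use 1 in auto)
    next
      case 2
      have "((\<lambda>t. 0) has_real_derivative 2 * max 0 t) (at t)"
        using 2 by simp
      then show ?thesis
        by (rule has_field_derivative_transform_within_open[where S="{..<0}"]) (use 2 in auto)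
    next
      case 3
      have "((\<lambda>t::real. (max 0 t)\<^sup>2 / t) \<longlongrightarrow> 0) (at 0)"
      proof (rule Lim_null_comparison)
        show "\<forall>\<^sub>F t::real in at 0. norm ((max 0 t)\<^sup>2 / t) \<le> \<bar>t\<bar>"
          by (intro always_eventually allI) (auto simp: max_def power2_eq_square abs_mult)
        show "((\<lambda>t::real. \<bar>t\<bar>) \<longlongrightarrow> 0) (at 0)" by (intro tendsto_eq_intros) auto
      qed
      then show ?thesis using 3 by (simp add: has_field_derivative_iff)
    qed
  qed
  have "((\<lambda>t. (max 0 t)\<^sup>2 + \<delta>\<^sup>2) has_real_derivative 2 * max 0 t) (at t)"
    using DERIV_add[OF sq DERIV_const] by simp
  from DERIV_diff[OF DERIV_chain2[OF DERIV_real_sqrt[OF pos] this] DERIV_const]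
  show "(F has_real_derivative F' t) (at t)"
    unfolding F_def F'_def by (simp add: field_simps)
  show "continuous_on UNIV F'"
    unfolding F'_def using pos by (intro continuous_intros) (auto simp: less_imp_neq[symmetric])
  have ge: "sqrt ((max 0 t)\<^sup>2 + \<delta>\<^sup>2) \<ge> max 0 t" for t
    by (rule real_le_rsqrt) simp
  show "\<bar>F' t\<bar> \<le> 1"
    unfolding F'_def using ge[of t] pos[of t] by (simp add: divide_le_eq_1)
  have "sqrt ((max 0 t)\<^sup>2 + \<delta>\<^sup>2) \<le> max 0 t + \<delta>"
    using assms(1) by (intro real_le_lsqrt) (auto simp: power2_eq_square algebra_simps)
  moreover have "sqrt ((max 0 t)\<^sup>2 + \<delta>\<^sup>2) \<ge> \<delta>"
    by (rule real_le_rsqrt) simp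
  ultimately show "\<bar>F t\<bar> \<le> \<bar>t\<bar>" unfolding F_def by simp
qed

text \<open>Apply the chain rule to the regularized positive part and let the parameter tend to 0 by
  dominated convergence. Every \<open>F'\<close> vanishes for t <= 0, so the limit gradient is 0 on
  the set where f <= 0, including the level f = 0.\<close>

lemma weak_gradient_pos_part:
  fixes f :: "'a::euclidean_space \<Rightarrow> real"
  assumes \<Omega>: "open \<Omega>" and f: "continuous_on UNIV f" "\<And>x. x \<notin> K \<Longrightarrow> f x = 0"
    and g: "g \<in> L2 \<Omega>" "\<And>x. x \<notin> K \<Longrightarrow> g x = 0"
    and wg: "has_weak_gradient \<Omega> f g" and K: "compact K" "K \<subseteq> \<Omega>"
  shows "(\<lambda>x. if f x > 0 then g x else 0) \<in> L2 \<Omega>"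
    "has_weak_gradient \<Omega> (\<lambda>x. max 0 (f x)) (\<lambda>x. if f x > 0 then g x else 0)"
proof -
  have \<Omega>s: "\<Omega> \<in> sets lebesgue" using \<Omega> by auto
  note [measurable] = L2_borel_measurable[OF g(1)] borel_measurable_lebesgue_on_continuous[OF f(1)]
  show L2: "(\<lambda>x. if f x > 0 then g x else 0) \<in> L2 \<Omega>"
    by (rule L2_bound[OF g(1), where B=1]) auto
  have cmax: "continuous_on UNIV (\<lambda>x. max 0 (f x))" by (intro continuous_intros f(1))
  have L2': "(\<lambda>x. max 0 (f x)) \<in> L2 \<Omega>"
    by (rule L2_compact_support[OF cmax K(1) _ \<Omega>s]) (simp add: f(2))
  show "has_weak_gradient \<Omega> (\<lambda>x. max 0 (f x)) (\<lambda>x. if f x > 0 then g x else 0)"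
  proof (rule has_weak_gradientI[OF L2' L2 \<Omega>s])
    fix \<psi> b assume \<psi>: "\<psi> \<in> test_functions \<Omega>" and b: "b \<in> (Basis :: 'a set)"
    define \<delta> where "\<delta> n = 1 / real (Suc n)" for n
    have \<delta>: "\<delta> n > 0" for n by (simp add: \<delta>_def)
    have \<delta>lim: "\<delta> \<longlonglongrightarrow> 0"
      unfolding \<delta>_def[abs_def] using lim_const_over_n[of "1::real"] by (rule filterlim_compose[OF _ filterlim_Suc])
    define F where "F n t = sqrt ((max 0 t)\<^sup>2 + (\<delta> n)\<^sup>2) - \<delta> n" for n t
    define F' where "F' n t = max 0 t / sqrt ((max 0 t)\<^sup>2 + (\<delta> n)\<^sup>2)" for n t
    note reg = pos_part_regularization[OF \<delta>, folded F_def F'_def]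
    define D where "D x = frechet_derivative \<psi> (at x) b" for x
    have Dt: "D \<in> test_functions \<Omega>" unfolding D_def[abs_def] by (rule test_function_derivative(2)[OF \<psi> b])
    have leb: "h \<in> borel_measurable lebesgue" if "continuous_on UNIV h" for h :: "'a \<Rightarrow> real"
      using borel_measurable_continuous_onI[OF that] by (simp add: measurable_completion)
    have gi: "integrable lebesgue (\<lambda>x. (g x \<bullet> b) * \<psi> x)"
      by (rule L2_mult_test_function_integrable[OF L2_inner[OF g(1)] \<psi> \<Omega>s])
    have fi: "integrable lebesgue (\<lambda>x. f x * D x)"
      by (rule L2_mult_test_function_integrable[OF L2_compact_support[OF f(1) K(1) f(2) \<Omega>s] Dt \<Omega>s])
    have [measurable]: "f \<in> borel_measurable lebesgue" "D \<in> borel_measurable lebesgue"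
      by (intro leb f(1) test_function_continuous[OF Dt])+
    have [measurable]: "(\<lambda>x. (g x \<bullet> b) * \<psi> x) \<in> borel_measurable lebesgue" using gi by auto
    have [measurable]: "F n \<in> borel_measurable borel" "F' n \<in> borel_measurable borel" for n
      unfolding F_def[abs_def] F'_def[abs_def] by measurable
    have Fl: "(\<lambda>n. F n t) \<longlonglongrightarrow> max 0 t" for t
    proof -
      have "(\<lambda>n. sqrt ((max 0 t)\<^sup>2 + (\<delta> n)\<^sup>2) - \<delta> n) \<longlonglongrightarrow> sqrt ((max 0 t)\<^sup>2 + 0\<^sup>2) - 0"
        by (intro tendsto_intros \<delta>lim)
      then show ?thesis by (simp add: F_def)
    qed
    have F'l: "(\<lambda>n. F' n t) \<longlonglongrightarrow> (if t > 0 then 1 else 0)" for t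
    proof (cases "t > 0")
      case True
      have "(\<lambda>n. max 0 t / sqrt ((max 0 t)\<^sup>2 + (\<delta> n)\<^sup>2)) \<longlonglongrightarrow> max 0 t / sqrt ((max 0 t)\<^sup>2 + 0\<^sup>2)"
        using True by (intro tendsto_intros \<delta>lim) auto
      then show ?thesis using True by (simp add: F'_def)
    qed (simp add: F'_def)
    have id: "(LINT x|lebesgue. F n (f x) * D x) = - (LINT x|lebesgue. F' n (f x) * ((g x \<bullet> b) * \<psi> x))" for n
      using weak_gradient_chain_rule[OF \<Omega> f g wg K reg(1-3) \<psi> b, of n] by (simp add: D_def mult.assoc)
    have 1: "(\<lambda>n. LINT x|lebesgue. F n (f x) * D x) \<longlonglongrightarrow> (LINT x|lebesgue. max 0 (f x) * D x)"
    proof (rule integral_dominated_convergence[where w="\<lambda>x. \<bar>f x * D x\<bar>"])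
      show "AE x in lebesgue. (\<lambda>n. F n (f x) * D x) \<longlonglongrightarrow> max 0 (f x) * D x"
        by (intro AE_I2 tendsto_intros Fl)
      show "AE x in lebesgue. norm (F n (f x) * D x) \<le> \<bar>f x * D x\<bar>" for n
        using reg(4) by (intro AE_I2) (auto simp: abs_mult intro: mult_right_mono)
    qed (use fi in auto)
    have 2: "(\<lambda>n. LINT x|lebesgue. F' n (f x) * ((g x \<bullet> b) * \<psi> x))
        \<longlonglongrightarrow> (LINT x|lebesgue. (if f x > 0 then 1 else 0) * ((g x \<bullet> b) * \<psi> x))"
    proof (rule integral_dominated_convergence[where w="\<lambda>x. \<bar>(g x \<bullet> b) * \<psi> x\<bar>"])
      show "AE x in lebesgue. (\<lambda>n. F' n (f x) * ((g x \<bullet> b) * \<psi> x)) \<longlonglongrightarrow> (if f x > 0 then 1 else 0) * ((g x \<bullet> b) * \<psi> x)"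
        by (intro AE_I2 tendsto_mult tendsto_const F'l)
      show "AE x in lebesgue. norm (F' n (f x) * ((g x \<bullet> b) * \<psi> x)) \<le> \<bar>(g x \<bullet> b) * \<psi> x\<bar>" for n
        using reg(3) by (intro AE_I2) (simp only: real_norm_def abs_mult[of "F' _ _"] mult_left_le_one_le abs_ge_zero)
    qed (use gi in auto)
    have "(LINT x|lebesgue. max 0 (f x) * D x) = - (LINT x|lebesgue. (if f x > 0 then 1 else 0) * ((g x \<bullet> b) * \<psi> x))"
      using LIMSEQ_unique[OF 1] tendsto_minus[OF 2] by (simp add: id)
    moreover have "(\<lambda>x. (if f x > 0 then 1 else 0) * ((g x \<bullet> b) * \<psi> x)) = (\<lambda>x. ((if f x > 0 then g x else 0) \<bullet> b) * \<psi> x)"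
      by auto
    ultimately show "(LINT x|lebesgue. max 0 (f x) * frechet_derivative \<psi> (at x) b)
        = - (LINT x|lebesgue. ((if f x > 0 then g x else 0) \<bullet> b) * \<psi> x)"
      by (simp only: D_def)
  qed
qed

section \<open>A Sobolev inequality in the plane\<close>

lemma abs_le_nn_integral_derivative:
  fixes h :: "real \<Rightarrow> real"
  assumes h: "\<And>t. (h has_real_derivative h' t) (at t)" and c: "continuous_on UNIV h'"
    and 0: "\<And>t. t \<le> a \<Longrightarrow> h t = 0"
  shows "ennreal \<bar>h x\<bar> \<le> (\<integral>\<^sup>+t. ennreal \<bar>h' t\<bar> \<partial>lborel)"
proof (cases "a \<le> x")
  case True
  have "(h has_vector_derivative h' t) (at t within {a..x})" for t
    using h[of t] by (simp add: has_real_derivative_iff_has_vector_derivative has_vector_derivative_at_within)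
  from integral_FTC_atLeastAtMost[OF True this continuous_on_subset[OF c]]
  have eq: "h x = (LINT t|lborel. indicator {a..x} t *\<^sub>R h' t)"
    using 0[of a] by simp
  have int: "integrable lborel (\<lambda>t. indicator {a..x} t *\<^sub>R h' t)"
    using borel_integrable_compact[of "{a..x}" h'] c by (auto intro: continuous_on_subset)
  have "ennreal \<bar>h x\<bar> \<le> (\<integral>\<^sup>+t. ennreal (norm (indicator {a..x} t *\<^sub>R h' t)) \<partial>lborel)"
    using integral_norm_bound_ennreal[OF int] by (simp only: eq[symmetric] real_norm_def)
  also have "\<dots> \<le> (\<integral>\<^sup>+t. ennreal \<bar>h' t\<bar> \<partial>lborel)"
    by (intro nn_integral_mono ennreal_leI) (auto simp: indicator_def)
  finally show ?thesis .
qed (use 0 in simp)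

text \<open>The Gagliardo-Nirenberg argument: integrating from outside the support along a row and
  along a column bounds \<open>\<phi>\<close> at (x, y) by two quantities, one depending on y only
  and one on x only. Their product bounds the square, and its double integral factorizes.\<close>

lemma sobolev_test_function:
  fixes \<phi> :: "real \<times> real \<Rightarrow> real"
  assumes \<phi>: "\<phi> \<in> test_functions \<Omega>"
  shows "(\<integral>\<^sup>+p. ennreal ((\<phi> p)\<^sup>2) \<partial>lborel) \<le>
    (\<integral>\<^sup>+p. ennreal \<bar>grad \<phi> p \<bullet> (1, 0)\<bar> \<partial>lborel) * (\<integral>\<^sup>+p. ennreal \<bar>grad \<phi> p \<bullet> (0, 1)\<bar> \<partial>lborel)"
proof -
  obtain K where K: "compact K" "K \<subseteq> \<Omega>" "\<And>x. x \<notin> K \<Longrightarrow> \<phi> x = 0"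
    using \<phi> by (auto simp: test_functions_iff)
  obtain R where R: "R > 0" "\<And>p. p \<in> K \<Longrightarrow> norm p \<le> R"
    using compact_imp_bounded[OF K(1)] by (auto simp: bounded_pos)
  have B: "(1, 0) \<in> (Basis :: (real \<times> real) set)" "(0, 1) \<in> (Basis :: (real \<times> real) set)"
    by (auto simp: Basis_prod_def)
  define D1 where "D1 p = grad \<phi> p \<bullet> (1, 0)" for p
  define D2 where "D2 p = grad \<phi> p \<bullet> (0, 1)" for p
  have cD: "continuous_on UNIV D1" "continuous_on UNIV D2"
    unfolding D1_def[abs_def] D2_def[abs_def] by (intro continuous_intros continuous_grad[OF \<phi>])+
  note [measurable] = borel_measurable_continuous_onI[OF cD(1)] borel_measurable_continuous_onI[OF cD(2)]
    test_function_borel[OF \<phi>]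
  have lin: "frechet_derivative \<phi> (at p) (t *\<^sub>R b) = t * frechet_derivative \<phi> (at p) b" for p t b
    using linear_cmul[OF has_derivative_linear[OF test_function_derivative(1)[OF \<phi>]]] by simp
  have out: "\<phi> (t, y) = 0" if "t \<le> - R - 1 \<or> y \<le> - R - 1" for t y
  proof (rule K(3), rule notI)
    assume "(t, y) \<in> K"
    from R(2)[OF this] norm_fst_le[of t y] norm_snd_le[of y t] that R(1) show False by auto
  qed
  have x1: "ennreal \<bar>\<phi> (x, y)\<bar> \<le> (\<integral>\<^sup>+t. ennreal \<bar>D1 (t, y)\<bar> \<partial>lborel)" for x y
  proof (rule abs_le_nn_integral_derivative[where h="\<lambda>t. \<phi> (t, y)" and a="-R - 1"])
    show "((\<lambda>t. \<phi> (t, y)) has_real_derivative D1 (t, y)) (at t)" for t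
    proof -
      have "((\<lambda>t. \<phi> (t, y)) has_derivative (\<lambda>h. frechet_derivative \<phi> (at (t, y)) (h, 0))) (at t)"
        by (rule has_derivative_compose[where g=\<phi>, OF _ test_function_derivative(1)[OF \<phi>]])
           (auto intro!: derivative_eq_intros)
      moreover have "frechet_derivative \<phi> (at (t, y)) (h, 0) = D1 (t, y) * h" for h
        using lin[of "(t, y)" h "(1, 0)"] B by (simp add: D1_def grad_inner_Basis mult.commute)
      ultimately show ?thesis by (simp add: has_field_derivative_def)
    qed
    show "continuous_on UNIV (\<lambda>t. D1 (t, y))"
      by (rule continuous_on_compose2[OF cD(1)]) (auto intro!: continuous_intros)
  qed (use out in auto)
  have x2: "ennreal \<bar>\<phi> (x, y)\<bar> \<le> (\<integral>\<^sup>+t. ennreal \<bar>D2 (x, t)\<bar> \<partial>lborel)" for x y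
  proof (rule abs_le_nn_integral_derivative[where h="\<lambda>t. \<phi> (x, t)" and a="-R - 1"])
    show "((\<lambda>t. \<phi> (x, t)) has_real_derivative D2 (x, t)) (at t)" for t
    proof -
      have "((\<lambda>t. \<phi> (x, t)) has_derivative (\<lambda>h. frechet_derivative \<phi> (at (x, t)) (0, h))) (at t)"
        by (rule has_derivative_compose[where g=\<phi>, OF _ test_function_derivative(1)[OF \<phi>]])
           (auto intro!: derivative_eq_intros)
      moreover have "frechet_derivative \<phi> (at (x, t)) (0, h) = D2 (x, t) * h" for h
        using lin[of "(x, t)" h "(0, 1)"] B by (simp add: D2_def grad_inner_Basis mult.commute)
      ultimately show ?thesis by (simp add: has_field_derivative_def)
    qed
    show "continuous_on UNIV (\<lambda>t. D2 (x, t))"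
      by (rule continuous_on_compose2[OF cD(2)]) (auto intro!: continuous_intros)
  qed (use out in auto)
  have fubini: "(\<integral>\<^sup>+p. F p \<partial>lborel) = (\<integral>\<^sup>+x. \<integral>\<^sup>+y. F (x, y) \<partial>lborel \<partial>lborel)"
    if [measurable]: "F \<in> borel_measurable borel" for F :: "real \<times> real \<Rightarrow> ennreal"
    using lborel.nn_integral_fst[of F lborel] by (simp add: lborel_prod)
  have "(\<integral>\<^sup>+p. ennreal ((\<phi> p)\<^sup>2) \<partial>lborel) = (\<integral>\<^sup>+x. \<integral>\<^sup>+y. ennreal ((\<phi> (x, y))\<^sup>2) \<partial>lborel \<partial>lborel)"
    by (rule fubini) measurable
  also have "\<dots> \<le> (\<integral>\<^sup>+x. \<integral>\<^sup>+y. (\<integral>\<^sup>+t. ennreal \<bar>D2 (x, t)\<bar> \<partial>lborel) * (\<integral>\<^sup>+t. ennreal \<bar>D1 (t, y)\<bar> \<partial>lborel) \<partial>lborel \<partial>lborel)"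
  proof (intro nn_integral_mono)
    fix x y
    have "ennreal ((\<phi> (x, y))\<^sup>2) = ennreal \<bar>\<phi> (x, y)\<bar> * ennreal \<bar>\<phi> (x, y)\<bar>"
      by (simp add: ennreal_mult[symmetric] power2_eq_square)
    also have "\<dots> \<le> (\<integral>\<^sup>+t. ennreal \<bar>D2 (x, t)\<bar> \<partial>lborel) * (\<integral>\<^sup>+t. ennreal \<bar>D1 (t, y)\<bar> \<partial>lborel)"
      by (intro mult_mono x1 x2) auto
    finally show "ennreal ((\<phi> (x, y))\<^sup>2) \<le> (\<integral>\<^sup>+t. ennreal \<bar>D2 (x, t)\<bar> \<partial>lborel) * (\<integral>\<^sup>+t. ennreal \<bar>D1 (t, y)\<bar> \<partial>lborel)" .
  qed
  also have "\<dots> = (\<integral>\<^sup>+x. (\<integral>\<^sup>+t. ennreal \<bar>D2 (x, t)\<bar> \<partial>lborel) \<partial>lborel) * (\<integral>\<^sup>+y. (\<integral>\<^sup>+t. ennreal \<bar>D1 (t, y)\<bar> \<partial>lborel) \<partial>lborel)"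
    by (subst nn_integral_cmult, measurable, subst nn_integral_multc, measurable)
  also have "(\<integral>\<^sup>+x. (\<integral>\<^sup>+t. ennreal \<bar>D2 (x, t)\<bar> \<partial>lborel) \<partial>lborel) = (\<integral>\<^sup>+p. ennreal \<bar>D2 p\<bar> \<partial>lborel)"
    by (rule fubini[symmetric]) measurable
  also have "(\<integral>\<^sup>+y. (\<integral>\<^sup>+t. ennreal \<bar>D1 (t, y)\<bar> \<partial>lborel) \<partial>lborel) = (\<integral>\<^sup>+p. ennreal \<bar>D1 p\<bar> \<partial>lborel)"
    by (subst fubini, measurable, rule lborel_pair.Fubini'[symmetric], measurable)
  finally show ?thesis by (simp add: D1_def D2_def mult.commute)
qed

text \<open>The inequality for test functions passes to the limit in L1 of the gradients. Only then
  is Cauchy-Schwarz applied, to g itself, because the mollified gradients need not vanish outside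
  A.\<close>

lemma sobolev_compact_support:
  fixes f :: "real \<times> real \<Rightarrow> real"
  assumes \<Omega>: "open \<Omega>" and f: "continuous_on UNIV f" "\<And>x. x \<notin> K \<Longrightarrow> f x = 0"
    and g: "g \<in> L2 \<Omega>" "\<And>x. x \<notin> K \<Longrightarrow> g x = 0"
    and wg: "has_weak_gradient \<Omega> f g" and K: "compact K" "K \<subseteq> \<Omega>"
    and A: "A \<in> lmeasurable" "\<And>x. x \<notin> A \<Longrightarrow> g x = 0"
  shows "(LINT x|lebesgue. (f x)\<^sup>2) \<le> measure lebesgue A * (LINT x|lebesgue. (norm (g x))\<^sup>2)"
proof -
  have \<Omega>s: "\<Omega> \<in> sets lebesgue" using \<Omega> by auto
  obtain \<phi> K' where \<phi>: "\<And>n::nat. \<phi> n \<in> test_functions \<Omega>" and K': "compact K'" "K \<subseteq> K'" "K' \<subseteq> \<Omega>"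
    and \<phi>0: "\<And>n x. x \<notin> K' \<Longrightarrow> \<phi> n x = 0" "\<And>n x. x \<notin> K' \<Longrightarrow> grad (\<phi> n) x = 0"
    and unif: "uniform_limit UNIV \<phi> f sequentially"
    and lim: "\<And>b. b \<in> Basis \<Longrightarrow>
      (\<lambda>n. \<integral>\<^sup>+x. ennreal (((grad (\<phi> n) x - g x) \<bullet> b)\<^sup>2) \<partial>lebesgue) \<longlonglongrightarrow> 0"
    by (rule weak_gradient_approx[OF \<Omega> f g wg K]) (assumption | rule that)+
  have B: "(1, 0) \<in> (Basis :: (real \<times> real) set)" "(0, 1) \<in> (Basis :: (real \<times> real) set)"
    by (auto simp: Basis_prod_def)
  have gout: "g x = 0" if "x \<notin> \<Omega>" for x
    using g(2)[OF contra_subsetD[OF K(2) that]] .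
  have [measurable]: "g \<in> borel_measurable lebesgue"
    using measurable_lebesgue_on_zero_outside[OF \<Omega>s, of g, OF gout] L2_borel_measurable[OF g(1)] by simp
  have [measurable]: "grad (\<phi> n) \<in> borel_measurable lebesgue" "\<phi> n \<in> borel_measurable lebesgue" for n
    using borel_measurable_continuous_onI[OF continuous_grad[OF \<phi>, of n]] test_function_borel[OF \<phi>, of n]
    by (simp_all add: measurable_completion)
  have [measurable]: "K' \<in> sets lebesgue" using compact_imp_lebesgue[OF K'(1)] .
  have [measurable]: "A \<in> sets lebesgue" using A(1) by (rule fmeasurableD)
  have norm_int: "integrable lebesgue (\<lambda>x. (norm (g x))\<^sup>2)"
    using integrable_lebesgue_on_zero_outside[OF \<Omega>s, of "\<lambda>x. (norm (g x))\<^sup>2"] gout L2_integrable_square[OF g(1)]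
    by simp
  define N where "N = (\<integral>\<^sup>+x. ennreal (norm (g x)) \<partial>lebesgue)"
  have indK: "integrable lebesgue (\<lambda>x. (indicator K' x :: real)\<^sup>2)"
  proof -
    have "(\<lambda>x. (indicator K' x :: real)\<^sup>2) = indicator K'" by (auto simp: indicator_def fun_eq_iff)
    then show ?thesis
      using lmeasurable_compact[OF K'(1)] by (simp add: fmeasurable_def)
  qed
  \<comment> \<open>The common compact support has finite area, so L2 convergence of the gradients
    gives L1 convergence; this is the role of the indicator of K'.\<close>
  have comp: "\<exists>e. e \<longlonglongrightarrow> 0 \<and> (\<forall>n. (\<integral>\<^sup>+p. ennreal \<bar>grad (\<phi> n) p \<bullet> b\<bar> \<partial>lborel) \<le> N + e n)"
    if b: "b \<in> Basis" for b
  proof (intro exI conjI allI)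
    show "(\<lambda>n. \<integral>\<^sup>+x. ennreal \<bar>((grad (\<phi> n) x - g x) \<bullet> b) * indicator K' x\<bar> \<partial>lebesgue) \<longlonglongrightarrow> 0"
      by (rule L2_null_imp_L1_null[OF _ _ indK lim[OF b]]) measurable
    fix n
    have "(\<integral>\<^sup>+p. ennreal \<bar>grad (\<phi> n) p \<bullet> b\<bar> \<partial>lborel) = (\<integral>\<^sup>+p. ennreal \<bar>grad (\<phi> n) p \<bullet> b\<bar> \<partial>lebesgue)"
      by (simp add: nn_integral_completion)
    also have "\<dots> \<le> (\<integral>\<^sup>+x. ennreal (norm (g x)) + ennreal \<bar>((grad (\<phi> n) x - g x) \<bullet> b) * indicator K' x\<bar> \<partial>lebesgue)"
    proof (rule nn_integral_mono)
      fix x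
      have "\<bar>grad (\<phi> n) x \<bullet> b\<bar> \<le> norm (g x) + \<bar>((grad (\<phi> n) x - g x) \<bullet> b) * indicator K' x\<bar>"
      proof (cases "x \<in> K'")
        case True
        have "\<bar>g x \<bullet> b\<bar> \<le> norm (g x)" using Basis_le_norm[OF b] .
        with True show ?thesis by (simp add: inner_diff_left)
      qed (simp add: \<phi>0(2))
      from ennreal_leI[OF this]
      show "ennreal \<bar>grad (\<phi> n) x \<bullet> b\<bar> \<le> ennreal (norm (g x)) + ennreal \<bar>((grad (\<phi> n) x - g x) \<bullet> b) * indicator K' x\<bar>"
        by (subst (asm) ennreal_plus) auto
    qed
    also have "\<dots> = N + (\<integral>\<^sup>+x. ennreal \<bar>((grad (\<phi> n) x - g x) \<bullet> b) * indicator K' x\<bar> \<partial>lebesgue)"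
      unfolding N_def by (rule nn_integral_add) measurable
    finally show "(\<integral>\<^sup>+p. ennreal \<bar>grad (\<phi> n) p \<bullet> b\<bar> \<partial>lborel)
      \<le> N + (\<integral>\<^sup>+x. ennreal \<bar>((grad (\<phi> n) x - g x) \<bullet> b) * indicator K' x\<bar> \<partial>lebesgue)" .
  qed
  obtain e1 where e1: "e1 \<longlonglongrightarrow> 0" "\<And>n. (\<integral>\<^sup>+p. ennreal \<bar>grad (\<phi> n) p \<bullet> (1, 0)\<bar> \<partial>lborel) \<le> N + e1 n"
    using comp[OF B(1)] by blast
  obtain e2 where e2: "e2 \<longlonglongrightarrow> 0" "\<And>n. (\<integral>\<^sup>+p. ennreal \<bar>grad (\<phi> n) p \<bullet> (0, 1)\<bar> \<partial>lborel) \<le> N + e2 n"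
    using comp[OF B(2)] by blast
  have CS: "N\<^sup>2 \<le> emeasure lebesgue A * (\<integral>\<^sup>+x. ennreal ((norm (g x))\<^sup>2) \<partial>lebesgue)"
  proof -
    have "N = (\<integral>\<^sup>+x. indicator A x * ennreal (norm (g x)) \<partial>lebesgue)"
      unfolding N_def using A(2) by (intro nn_integral_cong) (auto simp: indicator_def)
    moreover have "(\<integral>\<^sup>+x. (indicator A x)\<^sup>2 \<partial>lebesgue) = emeasure lebesgue A"
    proof -
      have "(\<lambda>x. (indicator A x :: ennreal)\<^sup>2) = indicator A" by (auto simp: indicator_def fun_eq_iff)
      then show ?thesis by simp
    qed
    ultimately show ?thesis
      using Cauchy_Schwarz_nn_integral[of "indicator A" lebesgue "\<lambda>x. ennreal (norm (g x))"]
      by (simp add: ennreal_power)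
  qed
  have Afin: "emeasure lebesgue A = ennreal (measure lebesgue A)"
    using A(1) by (rule emeasure_eq_measure2)
  have gI: "(\<integral>\<^sup>+x. ennreal ((norm (g x))\<^sup>2) \<partial>lebesgue) = ennreal (LINT x|lebesgue. (norm (g x))\<^sup>2)"
    by (rule nn_integral_eq_integral[OF norm_int]) auto
  have "N\<^sup>2 < top" using CS unfolding Afin gI by (auto simp: ennreal_mult[symmetric] intro: le_less_trans)
  \<comment> \<open>Finiteness is needed to multiply limits in \<open>ennreal\<close>, where
    infinity times 0 breaks continuity.\<close>
  then have Nfin: "N \<noteq> top" by (auto simp: power2_eq_square)
  have lim1: "(\<lambda>n. N + e1 n) \<longlonglongrightarrow> N + 0" "(\<lambda>n. N + e2 n) \<longlonglongrightarrow> N + 0"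
    by (intro tendsto_intros e1 e2)+
  have lim2: "(\<lambda>n. (N + e1 n) * (N + e2 n)) \<longlonglongrightarrow> (N + 0) * (N + 0)"
    by (rule tendsto_mult_ennreal[OF lim1]) (use Nfin in auto)
  \<comment> \<open>Fatou's lemma handles the left side, from the pointwise convergence of the
    approximants.\<close>
  have "(\<integral>\<^sup>+x. ennreal ((f x)\<^sup>2) \<partial>lebesgue) = (\<integral>\<^sup>+x. liminf (\<lambda>n. ennreal ((\<phi> n x)\<^sup>2)) \<partial>lebesgue)"
  proof (rule nn_integral_cong)
    fix x
    have "(\<lambda>n. \<phi> n x) \<longlonglongrightarrow> f x" using tendsto_uniform_limitI[OF unif] by simp
    then have "(\<lambda>n. ennreal ((\<phi> n x)\<^sup>2)) \<longlonglongrightarrow> ennreal ((f x)\<^sup>2)" by (intro tendsto_intros)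
    then show "ennreal ((f x)\<^sup>2) = liminf (\<lambda>n. ennreal ((\<phi> n x)\<^sup>2))"
      using lim_imp_Liminf[OF sequentially_bot] by metis
  qed
  also have "\<dots> \<le> liminf (\<lambda>n. \<integral>\<^sup>+x. ennreal ((\<phi> n x)\<^sup>2) \<partial>lebesgue)"
    by (rule nn_integral_liminf) measurable
  also have "\<dots> \<le> liminf (\<lambda>n. (N + e1 n) * (N + e2 n))"
  proof (rule Liminf_mono, rule always_eventually, rule allI)
    fix n
    have "(\<integral>\<^sup>+x. ennreal ((\<phi> n x)\<^sup>2) \<partial>lebesgue) = (\<integral>\<^sup>+x. ennreal ((\<phi> n x)\<^sup>2) \<partial>lborel)"
      by (simp add: nn_integral_completion)
    also note sobolev_test_function[OF \<phi>]
    also have "(\<integral>\<^sup>+p. ennreal \<bar>grad (\<phi> n) p \<bullet> (1, 0)\<bar> \<partial>lborel) * (\<integral>\<^sup>+p. ennreal \<bar>grad (\<phi> n) p \<bullet> (0, 1)\<bar> \<partial>lborel)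
        \<le> (N + e1 n) * (N + e2 n)"
      by (intro mult_mono e1 e2) auto
    finally show "(\<integral>\<^sup>+x. ennreal ((\<phi> n x)\<^sup>2) \<partial>lebesgue) \<le> (N + e1 n) * (N + e2 n)" .
  qed
  also have "\<dots> = N\<^sup>2"
    using lim_imp_Liminf[OF sequentially_bot lim2] by (simp add: power2_eq_square)
  also note CS
  also have "emeasure lebesgue A * (\<integral>\<^sup>+x. ennreal ((norm (g x))\<^sup>2) \<partial>lebesgue)
      = ennreal (measure lebesgue A * (LINT x|lebesgue. (norm (g x))\<^sup>2))"
    unfolding Afin gI by (simp add: ennreal_mult)
  finally have le: "(\<integral>\<^sup>+x. ennreal ((f x)\<^sup>2) \<partial>lebesgue) \<le> ennreal (measure lebesgue A * (LINT x|lebesgue. (norm (g x))\<^sup>2))" .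
  show ?thesis
    using le by (intro integral_real_bounded) auto
qed

section \<open>Caccioppoli and Sobolev estimates for local minimizers\<close>

text \<open>Nothing is known about u outside \<open>\<Omega>\<close>, but the product is continuous
  on the open set \<open>\<Omega>\<close> and is 0 on the open complement of K, and these two sets
  cover the space.\<close>

lemma continuous_on_mult_cutoff:
  fixes u :: "'a::euclidean_space \<Rightarrow> real"
  assumes "open \<Omega>" "continuous_on \<Omega> u" "continuous_on UNIV c" "compact K" "K \<subseteq> \<Omega>"
    and "\<And>x. x \<notin> K \<Longrightarrow> c x = 0"
  shows "continuous_on UNIV (\<lambda>x. c x * u x)"
proof -
  have "continuous_on \<Omega> (\<lambda>x. c x * u x)"
    using assms(2,3) by (auto intro!: continuous_intros intro: continuous_on_subset)
  moreover have "continuous_on (- K) (\<lambda>x. c x * u x)"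
    by (rule continuous_on_eq[OF continuous_on_const[of _ 0]]) (use assms(6) in auto)
  moreover have "open (- K)" using compact_imp_closed[OF assms(4)] by auto
  ultimately have "continuous_on (\<Omega> \<union> - K) (\<lambda>x. c x * u x)"
    using assms(1) continuous_on_open_Un by blast
  moreover have "\<Omega> \<union> - K = UNIV" using assms(5) by blast
  ultimately show ?thesis by simp
qed

lemma local_minimizerD:
  assumes "local_minimizer Q \<Omega> u"
  shows "u \<in> W12 \<Omega>"
    and "\<exists>\<epsilon>>0. \<forall>v\<in>K_class u \<Omega>.
        (\<integral>\<^sup>+x. ennreal ((norm (weak_grad \<Omega> (\<lambda>y. u y - v y) x))\<^sup>2) \<partial>lebesgue_on \<Omega>) +
        (\<integral>\<^sup>+x. ennreal \<bar>indicat_real (pos_set \<Omega> u) x - indicat_real (pos_set \<Omega> v) x\<bar>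
           \<partial>lebesgue_on \<Omega>) < ennreal \<epsilon>
        \<longrightarrow> J Q u \<Omega> \<le> J Q v \<Omega>"
  using assms by (auto simp: local_minimizer_def K_class_def)

text \<open>
  The energy gained by passing from \<open>g\<close> to the gradient of \<open>u - z\<^sup>2 u\<close>, where \<open>d\<close> is the gradient
  of \<open>z\<close>: completing the square in \<open>z * norm g - 4 * \<bar>u\<bar> * norm d\<close>.
\<close>

lemma caccioppoli_pointwise:
  fixes g d :: "'a::real_inner"
  assumes "0 \<le> z" "z \<le> 1"
  shows "z\<^sup>2 * (norm g)\<^sup>2 / 2 - 12 * u\<^sup>2 * (norm d)\<^sup>2
    \<le> (norm g)\<^sup>2 - (norm (g - (z\<^sup>2 *\<^sub>R g + (2 * z * u) *\<^sub>R d)))\<^sup>2"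
proof -
  define a c e where "a = norm g" and "c = g \<bullet> d" and "e = norm d"
  have nn: "a \<ge> 0" "e \<ge> 0" by (auto simp: a_def e_def)
  have ac: "\<bar>c\<bar> \<le> a * e" unfolding a_def c_def e_def by (rule Cauchy_Schwarz_ineq2)
  have expand: "(norm (g - (z\<^sup>2 *\<^sub>R g + (2 * z * u) *\<^sub>R d)))\<^sup>2
      = (1 - z\<^sup>2)\<^sup>2 * a\<^sup>2 - 4 * z * u * (1 - z\<^sup>2) * c + 4 * z\<^sup>2 * u\<^sup>2 * e\<^sup>2"
    unfolding a_def c_def e_def power2_norm_eq_inner
    by (simp add: inner_add_left inner_add_right inner_diff_left inner_diff_right inner_commute[of d g]
        power2_eq_square algebra_simps)
  have z2: "z\<^sup>2 \<le> 1" using assms by (simp add: power_le_one)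
  have "\<bar>z * u * (1 - z\<^sup>2) * c\<bar> = z * \<bar>u\<bar> * (1 - z\<^sup>2) * \<bar>c\<bar>"
    using assms z2 by (simp add: abs_mult)
  also have "\<dots> \<le> z * \<bar>u\<bar> * 1 * (a * e)"
    using assms z2 ac nn by (intro mult_mono) auto
  finally have cross: "- (z * \<bar>u\<bar> * a * e) \<le> z * u * (1 - z\<^sup>2) * c" by (simp add: abs_le_iff)
  \<comment> \<open>Expanding, \<open>1 - (1 - z\<^sup>2)\<^sup>2\<close> is twice
    \<open>z\<^sup>2\<close> minus its square, and the square of \<open>z\<^sup>2\<close> is at most
    \<open>z\<^sup>2\<close>.\<close>
  have t1: "z\<^sup>2 * a\<^sup>2 \<le> (1 - (1 - z\<^sup>2)\<^sup>2) * a\<^sup>2"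
  proof (rule mult_right_mono)
    have "z\<^sup>2 * z\<^sup>2 \<le> z\<^sup>2 * 1" using z2 by (intro mult_left_mono) auto
    then show "z\<^sup>2 \<le> 1 - (1 - z\<^sup>2)\<^sup>2" by (simp add: power2_eq_square algebra_simps)
  qed simp
  have t2: "z\<^sup>2 * (u\<^sup>2 * e\<^sup>2) \<le> 1 * (u\<^sup>2 * e\<^sup>2)" using z2 by (intro mult_right_mono) auto
  \<comment> \<open>Half of this square absorbs the cross term
    \<open>4 * (z * \<bar>u\<bar> * a * e)\<close>: it leaves
    \<open>z\<^sup>2 * a\<^sup>2 / 2\<close> and costs \<open>8 * u\<^sup>2 * e\<^sup>2\<close>.
    With the 4 from \<open>t2\<close> this makes the constant 12.\<close>
  have sq: "(z * a - 4 * \<bar>u\<bar> * e)\<^sup>2 = z\<^sup>2 * a\<^sup>2 - 8 * (z * \<bar>u\<bar> * a * e) + 16 * (u\<^sup>2 * e\<^sup>2)"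
    by (simp add: power2_eq_square algebra_simps)
  have "0 \<le> (z * a - 4 * \<bar>u\<bar> * e)\<^sup>2" by simp
  then have "0 \<le> z\<^sup>2 * a\<^sup>2 - 8 * (z * \<bar>u\<bar> * a * e) + 16 * (u\<^sup>2 * e\<^sup>2)" unfolding sq .
  moreover have "(1 - (1 - z\<^sup>2)\<^sup>2) * a\<^sup>2 = a\<^sup>2 - (1 - z\<^sup>2)\<^sup>2 * a\<^sup>2" by (simp add: algebra_simps)
  moreover have "4 * z * u * (1 - z\<^sup>2) * c = 4 * (z * u * (1 - z\<^sup>2) * c)"
    "12 * u\<^sup>2 * e\<^sup>2 = 12 * (u\<^sup>2 * e\<^sup>2)" "4 * z\<^sup>2 * u\<^sup>2 * e\<^sup>2 = 4 * (z\<^sup>2 * (u\<^sup>2 * e\<^sup>2))"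
    by simp_all
  ultimately show ?thesis
    unfolding expand a_def[symmetric] e_def[symmetric] using cross t1 t2 by linarith
qed

lemma norm_sq_add_le: "(norm (x + y))\<^sup>2 \<le> 2 * (norm x)\<^sup>2 + 2 * (norm (y::'a::real_inner))\<^sup>2"
proof -
  have "(norm (x + y))\<^sup>2 + (norm (x - y))\<^sup>2 = 2 * (norm x)\<^sup>2 + 2 * (norm y)\<^sup>2"
    by (simp add: power2_norm_eq_inner inner_add_left inner_add_right inner_diff_left inner_diff_right inner_commute)
  then show ?thesis using zero_le_power2[of "norm (x - y)"] by linarith
qed

text \<open>Used with the squared cutoff to build the competitor in \<open>caccioppoli\<close>, and
  with the cutoff itself for the Sobolev step in \<open>square_estimates\<close>.\<close>

lemma pos_part_cutoff_weak_gradient: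
  fixes u :: "'a::euclidean_space \<Rightarrow> real"
  assumes \<Omega>: "open \<Omega>" and u: "u \<in> L2 \<Omega>" "continuous_on \<Omega> u"
    and g: "g \<in> L2 \<Omega>" "has_weak_gradient \<Omega> u g"
    and \<zeta>: "\<zeta> \<in> test_functions UNIV" "\<And>x. 0 \<le> \<zeta> x" "\<And>x. x \<notin> K \<Longrightarrow> \<zeta> x = 0"
    and K: "compact K" "K \<subseteq> \<Omega>"
  defines "w \<equiv> \<lambda>x. max 0 (\<zeta> x * u x)"
    and "G \<equiv> \<lambda>x. if \<zeta> x * u x > 0 then \<zeta> x *\<^sub>R g x + u x *\<^sub>R grad \<zeta> x else 0"
  shows "continuous_on UNIV w" "\<And>x. x \<notin> K \<Longrightarrow> w x = 0" "\<And>x. x \<notin> K \<Longrightarrow> G x = 0"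
    "G \<in> L2 \<Omega>" "has_weak_gradient \<Omega> w G"
proof -
  have \<Omega>s: "\<Omega> \<in> sets lebesgue" using \<Omega> by auto
  have c: "continuous_on UNIV (\<lambda>x. \<zeta> x * u x)"
    using continuous_on_mult_cutoff[OF \<Omega> u(2) test_function_continuous[OF \<zeta>(1)] K \<zeta>(3)] .
  then show "continuous_on UNIV w" unfolding w_def by (intro continuous_on_max continuous_on_const)
  show "w x = 0" "G x = 0" if "x \<notin> K" for x using \<zeta>(3)[OF that] by (simp_all add: w_def G_def)
  note prod = has_weak_gradient_mult[OF u(1) g \<zeta>(1) \<Omega>s]
  have out: "\<zeta> x *\<^sub>R g x + u x *\<^sub>R grad \<zeta> x = 0" if "x \<notin> K" for x
  proof -
    have "frechet_derivative \<zeta> (at x) = (\<lambda>h. 0)"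
      using derivative_zero_outside[OF test_function_derivative(1)[OF \<zeta>(1)] compact_imp_closed[OF K(1)] \<zeta>(3) that] .
    then show ?thesis using \<zeta>(3)[OF that] by (simp add: grad_def)
  qed
  have z: "\<zeta> x * u x = 0" if "x \<notin> K" for x using \<zeta>(3)[OF that] by simp
  show "G \<in> L2 \<Omega>" "has_weak_gradient \<Omega> w G"
    unfolding w_def G_def
    by (rule weak_gradient_pos_part[OF \<Omega> c z prod(2) out prod(3) K], assumption+)+
qed

text \<open>Dominated convergence along balls shrinking to p, where the single point p is
  negligible. Controlling both the energy and the area bounds the two terms in the closeness
  condition of a local minimizer.\<close>

lemma small_ball_integral:
  fixes k :: "'a::euclidean_space \<Rightarrow> real"
  assumes \<Omega>: "open \<Omega>" "p \<in> \<Omega>" and k: "integrable (lebesgue_on \<Omega>) k" and "\<epsilon> > 0"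
  obtains r where "r > 0" "cball p r \<subseteq> \<Omega>"
    "(LINT x|lebesgue_on \<Omega>. indicator (cball p r) x * k x) < \<epsilon>" "measure lebesgue (cball p r) < \<epsilon>"
proof -
  have \<Omega>s: "\<Omega> \<in> sets lebesgue" using \<Omega> by auto
  obtain e where e: "e > 0" "cball p e \<subseteq> \<Omega>"
    using open_contains_cball \<Omega> by blast
  define r where "r n = e / real (Suc n)" for n
  have r: "r n > 0" "r n \<le> e" for n using e(1) by (auto simp: r_def field_simps)
  have rlim: "r \<longlonglongrightarrow> 0"
    unfolding r_def[abs_def] using lim_const_over_n[of e] by (rule filterlim_compose[OF _ filterlim_Suc])
  have sub: "cball p (r n) \<subseteq> \<Omega>" for n using r(2)[of n] e(2) by auto
  have ae: "AE x in lebesgue_on \<Omega>. x \<noteq> p"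
  proof -
    have "AE x in lebesgue. x \<notin> {p}"
      using negligible_sing[of p] unfolding negligible_iff_null_sets by (rule AE_not_in)
    then show ?thesis using \<Omega>s by (subst AE_restrict_space_iff) auto
  qed
  have ev: "\<forall>\<^sub>F n in sequentially. x \<notin> cball p (r n)" if "x \<noteq> p" for x
  proof -
    have "\<forall>\<^sub>F n in sequentially. r n < dist p x"
      using rlim that by (intro order_tendstoD(2)) auto
    then show ?thesis by eventually_elim auto
  qed
  have main: "(\<lambda>n. LINT x|lebesgue_on \<Omega>. indicator (cball p (r n)) x * h x) \<longlonglongrightarrow> (LINT x|lebesgue_on \<Omega>. 0)"
    if h: "integrable (lebesgue_on \<Omega>) h" for h :: "'a \<Rightarrow> real"
  proof (rule integral_dominated_convergence[where w="\<lambda>x. \<bar>h x\<bar>"])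
    have [measurable]: "indicat_real (cball p (r n)) \<in> borel_measurable (lebesgue_on \<Omega>)" for n
      using borel_measurable_indicator[of "cball p (r n)" borel]
      by (intro measurable_restrict_space1 measurable_completion) auto
    have [measurable]: "h \<in> borel_measurable (lebesgue_on \<Omega>)" using h by auto
    show "(\<lambda>x. indicator (cball p (r n)) x * h x) \<in> borel_measurable (lebesgue_on \<Omega>)" for n
      by measurable
    show "AE x in lebesgue_on \<Omega>. (\<lambda>n. indicator (cball p (r n)) x * h x) \<longlonglongrightarrow> 0"
      using ae
    proof eventually_elim
      case (elim x)
      show ?case
        by (rule tendsto_eventually, rule eventually_mono[OF ev[OF elim]]) simp
    qed
  qed (use h in \<open>auto simp: indicator_def\<close>)
  have 1: "\<forall>\<^sub>F n in sequentially. (LINT x|lebesgue_on \<Omega>. indicator (cball p (r n)) x * k x) < \<epsilon>"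
    using main[OF k] \<open>\<epsilon> > 0\<close> by (intro order_tendstoD(2)) auto
  \<comment> \<open>The indicator of a fixed ball stands in for the constant 1, which need not be
    integrable over \<open>\<Omega>\<close>.\<close>
  define c where "c = indicat_real (cball p e)"
  have "integrable lebesgue c"
    using lmeasurable_compact[OF compact_cball, of p e] by (simp add: c_def fmeasurable_def)
  then have c: "integrable (lebesgue_on \<Omega>) c"
    using integrable_lebesgue_on_zero_outside[OF \<Omega>s, of c] contra_subsetD[OF e(2)]
    by (simp add: c_def indicator_def)
  have "\<forall>\<^sub>F n in sequentially. (LINT x|lebesgue_on \<Omega>. indicator (cball p (r n)) x * c x) < \<epsilon>"
    using main[OF c] \<open>\<epsilon> > 0\<close> by (intro order_tendstoD(2)) auto
  moreover have "(LINT x|lebesgue_on \<Omega>. indicator (cball p (r n)) x * c x) = measure lebesgue (cball p (r n))" for n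
  proof -
    have "(\<lambda>x. indicator (cball p (r n)) x * c x) = indicat_real (cball p (r n))"
      using r(2)[of n] by (auto simp: c_def indicator_def fun_eq_iff)
    then show ?thesis
      using integral_lebesgue_on_zero_outside[OF \<Omega>s, of "indicat_real (cball p (r n))"] contra_subsetD[OF sub[of n]]
      by (simp del: mem_cball)
  qed
  ultimately have "\<forall>\<^sub>F n in sequentially. measure lebesgue (cball p (r n)) < \<epsilon>" by simp
  with 1 have "\<forall>\<^sub>F n in sequentially. (LINT x|lebesgue_on \<Omega>. indicator (cball p (r n)) x * k x) < \<epsilon>
      \<and> measure lebesgue (cball p (r n)) < \<epsilon>"
    by (rule eventually_conj)
  then obtain n where "(LINT x|lebesgue_on \<Omega>. indicator (cball p (r n)) x * k x) < \<epsilon>"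
    "measure lebesgue (cball p (r n)) < \<epsilon>"
    by (auto simp: eventually_sequentially)
  with r(1) sub show thesis by (rule_tac that) auto
qed

lemma pos_set_lebesgue:
  fixes u :: "'a::euclidean_space \<Rightarrow> real"
  assumes "open \<Omega>" "continuous_on \<Omega> u"
  shows "open (pos_set \<Omega> u)" "pos_set \<Omega> u \<in> sets lebesgue" "pos_set \<Omega> u \<in> sets (lebesgue_on \<Omega>)"
proof -
  have "pos_set \<Omega> u = \<Omega> \<inter> u -` {0<..}" by (auto simp: pos_set_def)
  then show o: "open (pos_set \<Omega> u)"
    using continuous_on_open_vimage[OF assms(1)] assms(2) by (metis Int_commute open_greaterThan)
  then show s: "pos_set \<Omega> u \<in> sets lebesgue" by auto
  have "\<Omega> \<in> sets lebesgue" using assms(1) by auto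
  with s show "pos_set \<Omega> u \<in> sets (lebesgue_on \<Omega>)"
    by (subst sets_restrict_space_iff) (auto simp: pos_set_def)
qed

lemma L2_indicator_norm_sq_integrable:
  assumes "f \<in> L2 \<Omega>" "A \<in> sets (lebesgue_on \<Omega>)"
    and "\<And>x. x \<in> \<Omega> \<Longrightarrow> h x = indicator A x * (norm (f x))\<^sup>2"
  shows "integrable (lebesgue_on \<Omega>) h"
proof -
  have "integrable (lebesgue_on \<Omega>) (\<lambda>x. indicator A x *\<^sub>R (norm (f x))\<^sup>2)"
    using integrable_mult_indicator[OF assms(2) L2_integrable_square[OF assms(1)]] .
  then show ?thesis
    by (subst Bochner_Integration.integrable_cong[OF refl]) (auto simp: assms(3))
qed

lemma
  assumes "\<zeta> \<in> test_functions UNIV" "\<And>x. \<bar>\<zeta> x\<bar> \<le> 1" "\<Omega> \<in> sets lebesgue"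
  shows L2_mult_cutoff: "g \<in> L2 \<Omega> \<Longrightarrow> (\<lambda>x. \<zeta> x *\<^sub>R g x) \<in> L2 \<Omega>"
    and L2_mult_grad: "u \<in> L2 \<Omega> \<Longrightarrow> (\<lambda>x. u x *\<^sub>R grad \<zeta> x) \<in> L2 \<Omega>"
proof -
  obtain K where K: "compact K" "\<And>x b. x \<notin> K \<Longrightarrow> frechet_derivative \<zeta> (at x) b = 0"
    by (rule test_function_support[OF assms(1)], rule that)
  have "grad \<zeta> x = 0" if "x \<notin> K" for x
    using that by (simp add: grad_def K(2))
  then obtain B where B: "\<And>x. norm (grad \<zeta> x) \<le> B"
    using bounded_compact_support[OF continuous_grad[OF assms(1)] K(1)] by metis
  note [measurable] = borel_measurable_lebesgue_on_continuous[OF continuous_grad[OF assms(1)], of \<Omega>]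
    borel_measurable_lebesgue_on_continuous[OF test_function_continuous[OF assms(1)], of \<Omega>]
  show "(\<lambda>x. \<zeta> x *\<^sub>R g x) \<in> L2 \<Omega>" if g: "g \<in> L2 \<Omega>" for g
  proof (rule L2_bound[OF g, where B=1])
    note [measurable] = L2_borel_measurable[OF g]
    show "(\<lambda>x. \<zeta> x *\<^sub>R g x) \<in> borel_measurable (lebesgue_on \<Omega>)" by measurable
  qed (use assms(2) in \<open>auto intro: mult_left_le_one_le\<close>)
  show "(\<lambda>x. u x *\<^sub>R grad \<zeta> x) \<in> L2 \<Omega>" if u: "u \<in> L2 \<Omega>" for u
  proof (rule L2_bound[OF u, where B=B])
    note [measurable] = L2_borel_measurable[OF u]
    show "(\<lambda>x. u x *\<^sub>R grad \<zeta> x) \<in> borel_measurable (lebesgue_on \<Omega>)" by measurable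
  qed (auto simp: mult.commute[of B] B intro!: mult_left_mono)
qed

lemma grad_square:
  assumes "\<zeta> \<in> test_functions UNIV"
  shows "grad (\<lambda>x. \<zeta> x * \<zeta> x) x = (2 * \<zeta> x) *\<^sub>R grad \<zeta> x"
  unfolding grad_def test_function_mult(2)[OF assms assms] scaleR_sum_right
  by (intro sum.cong) (auto simp: algebra_simps)

text \<open>The radius is fixed before the cutoff, so a single r serves all cutoffs in the ball,
  however steep. The term on \<open>{x. \<zeta> x = 1}\<close> is the cost of
  \<open>Q\<^sup>2\<close> saved by the competitor, whose positivity set loses exactly that part of
  U.\<close>

lemma caccioppoli:
  fixes u Q :: "'a::euclidean_space \<Rightarrow> real"
  assumes \<Omega>: "open \<Omega>" and lm: "local_minimizer Q \<Omega> u" and cu: "continuous_on \<Omega> u"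
    and Qi: "integrable (lebesgue_on \<Omega>) (\<lambda>x. (Q x)\<^sup>2)"
    and p: "p \<in> \<Omega>"
  obtains r where "r > 0" "cball p r \<subseteq> \<Omega>"
    "\<And>\<zeta>. \<zeta> \<in> test_functions UNIV \<Longrightarrow> (\<And>x. 0 \<le> \<zeta> x) \<Longrightarrow> (\<And>x. \<zeta> x \<le> 1) \<Longrightarrow>
      (\<And>x. x \<notin> cball p r \<Longrightarrow> \<zeta> x = 0) \<Longrightarrow>
      (LINT x|lebesgue_on \<Omega>. indicator (pos_set \<Omega> u) x * ((\<zeta> x)\<^sup>2 * (norm (weak_grad \<Omega> u x))\<^sup>2)) / 2 +
      (LINT x|lebesgue_on \<Omega>. indicator (pos_set \<Omega> u \<inter> {x. \<zeta> x = 1}) x * (Q x)\<^sup>2) \<le>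
      12 * (LINT x|lebesgue_on \<Omega>. indicator (pos_set \<Omega> u) x * ((u x)\<^sup>2 * (norm (grad \<zeta> x))\<^sup>2))"
proof -
  let ?M = "lebesgue_on \<Omega>" and ?U = "pos_set \<Omega> u"
  define g where "g = weak_grad \<Omega> u"
  have \<Omega>s: "\<Omega> \<in> sets lebesgue" using \<Omega> by auto
  have uW: "u \<in> W12 \<Omega>" using local_minimizerD(1)[OF lm] .
  note W = weak_grad_props[OF uW, folded g_def]
  note U = pos_set_lebesgue[OF \<Omega> cu]
  obtain \<epsilon> where \<epsilon>: "\<epsilon> > 0" and min: "\<And>v. v \<in> K_class u \<Omega> \<Longrightarrow>
        (\<integral>\<^sup>+x. ennreal ((norm (weak_grad \<Omega> (\<lambda>y. u y - v y) x))\<^sup>2) \<partial>?M) +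
        (\<integral>\<^sup>+x. ennreal \<bar>indicat_real ?U x - indicat_real (pos_set \<Omega> v) x\<bar> \<partial>?M) < ennreal \<epsilon>
        \<Longrightarrow> J Q u \<Omega> \<le> J Q v \<Omega>"
    using local_minimizerD(2)[OF lm] by blast
  note gi = L2_integrable_square[OF W(1)]
  \<comment> \<open>k collects both parts of the energy density, so its integral H over the ball
    dominates the left side of the claim by itself.\<close>
  define k where "k x = indicat_real ?U x *\<^sub>R ((norm (g x))\<^sup>2 + (Q x)\<^sup>2)" for x
  have ki: "integrable ?M k"
    unfolding k_def using gi Qi by (intro integrable_mult_indicator U(3) Bochner_Integration.integrable_add)
  have k0: "k x \<ge> 0" for x by (simp add: k_def)
  \<comment> \<open>The budget: with \<open>H < \<epsilon> / 8\<close> and 12 T < H, the squared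
    gradient distance is at most 2 H + 8 T, below \<open>3 * (\<epsilon> / 8)\<close>; the area adds
    at most \<open>\<epsilon> / 8\<close>. The total stays at or below
    \<open>\<epsilon> / 2\<close>.\<close>
  obtain r where r: "r > 0" "cball p r \<subseteq> \<Omega>"
    "(LINT x|?M. indicator (cball p r) x * k x) < \<epsilon> / 8" "measure lebesgue (cball p r) < \<epsilon> / 8"
    using small_ball_integral[OF \<Omega> p ki, of "\<epsilon> / 8"] \<epsilon> by auto
  define B where "B = cball p r"
  have Bs: "B \<in> sets lebesgue" "B \<subseteq> \<Omega>" "compact B" using r by (auto simp: B_def)
  have BM: "B \<in> sets ?M" using Bs \<Omega>s by (subst sets_restrict_space_iff) auto
  define H where "H = (LINT x|?M. indicator B x * k x)"
  have Hi: "integrable ?M (\<lambda>x. indicator B x * k x)"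
    using integrable_mult_indicator[OF BM ki] by simp
  have main: "(LINT x|?M. indicator ?U x * ((\<zeta> x)\<^sup>2 * (norm (g x))\<^sup>2)) / 2 +
      (LINT x|?M. indicator (?U \<inter> {x. \<zeta> x = 1}) x * (Q x)\<^sup>2) \<le>
      12 * (LINT x|?M. indicator ?U x * ((u x)\<^sup>2 * (norm (grad \<zeta> x))\<^sup>2))"
    if \<zeta>: "\<zeta> \<in> test_functions UNIV" "\<And>x. 0 \<le> \<zeta> x" "\<And>x. \<zeta> x \<le> 1" "\<And>x. x \<notin> B \<Longrightarrow> \<zeta> x = 0" for \<zeta>
  proof -
    define T where "T = (LINT x|?M. indicator ?U x * ((u x)\<^sup>2 * (norm (grad \<zeta> x))\<^sup>2))"
    have \<zeta>1: "\<bar>\<zeta> x\<bar> \<le> 1" for x using \<zeta>(2,3)[of x] by simp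
    note c\<zeta> = test_function_continuous[OF \<zeta>(1)]
    have Zs: "{x. \<zeta> x = 1} \<in> sets lebesgue"
    proof -
      have "closed {x. \<zeta> x = 1}" using c\<zeta> by (intro closed_Collect_eq continuous_on_const)
      then show ?thesis by auto
    qed
    have UZ: "?U \<inter> {x. \<zeta> x = 1} \<in> sets ?M"
      using U(2) Zs \<Omega>s by (subst sets_restrict_space_iff) (auto simp: pos_set_def)
    have Ti: "integrable ?M (\<lambda>x. indicator ?U x * ((u x)\<^sup>2 * (norm (grad \<zeta> x))\<^sup>2))"
      by (rule L2_indicator_norm_sq_integrable[OF L2_mult_grad[OF \<zeta>(1) \<zeta>1 \<Omega>s W(3)] U(3)])
         (simp add: power_mult_distrib)
    have Di: "integrable ?M (\<lambda>x. indicator ?U x * ((\<zeta> x)\<^sup>2 * (norm (g x))\<^sup>2))"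
      by (rule L2_indicator_norm_sq_integrable[OF L2_mult_cutoff[OF \<zeta>(1) \<zeta>1 \<Omega>s W(1)] U(3)])
         (simp add: power_mult_distrib)
    have Fi: "integrable ?M (\<lambda>x. indicator (?U \<inter> {x. \<zeta> x = 1}) x * (Q x)\<^sup>2)"
      using integrable_mult_indicator[OF UZ Qi] by simp
    have \<zeta>sq: "(\<zeta> x)\<^sup>2 \<le> indicator B x" for x
      using \<zeta>(2-4)[of x] by (cases "x \<in> B") (auto simp: power_le_one)
    have T0: "T \<ge> 0" unfolding T_def by (rule integral_nonneg_AE) simp
    \<comment> \<open>If \<open>12 * T \<ge> H\<close> there is nothing to show; otherwise the gradient of \<open>\<zeta>\<^sup>2 u\<^sup>+\<close> is so small that
      the competitor \<open>u - \<zeta>\<^sup>2 u\<^sup>+\<close> is admissible for the local minimality of \<open>u\<close>.\<close>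
    show ?thesis
    proof (cases "12 * T \<ge> H")
      case True
      have "(LINT x|?M. indicator ?U x * ((\<zeta> x)\<^sup>2 * (norm (g x))\<^sup>2)) / 2 +
          (LINT x|?M. indicator (?U \<inter> {x. \<zeta> x = 1}) x * (Q x)\<^sup>2)
        = (LINT x|?M. indicator ?U x * ((\<zeta> x)\<^sup>2 * (norm (g x))\<^sup>2) / 2 + indicator (?U \<inter> {x. \<zeta> x = 1}) x * (Q x)\<^sup>2)"
        using Di Fi by simp
      also have "\<dots> \<le> H"
        unfolding H_def
      proof (rule integral_mono[OF _ Hi])
        fix x
        show "indicator ?U x * ((\<zeta> x)\<^sup>2 * (norm (g x))\<^sup>2) / 2 + indicator (?U \<inter> {x. \<zeta> x = 1}) x * (Q x)\<^sup>2
          \<le> indicator B x * k x"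
        proof (cases "x \<in> B \<and> x \<in> ?U")
          case True
          have "(\<zeta> x)\<^sup>2 * (norm (g x))\<^sup>2 \<le> 1 * (norm (g x))\<^sup>2"
            using \<zeta>sq[of x] True by (intro mult_right_mono) auto
          then have "(\<zeta> x)\<^sup>2 * (norm (g x))\<^sup>2 / 2 \<le> (norm (g x))\<^sup>2"
            using zero_le_power2[of "norm (g x)"] by linarith
          moreover have "indicator (?U \<inter> {x. \<zeta> x = 1}) x * (Q x)\<^sup>2 \<le> (Q x)\<^sup>2"
            by (simp add: indicator_def)
          ultimately have "(\<zeta> x)\<^sup>2 * (norm (g x))\<^sup>2 / 2 + indicator (?U \<inter> {x. \<zeta> x = 1}) x * (Q x)\<^sup>2
              \<le> (norm (g x))\<^sup>2 + (Q x)\<^sup>2" by (rule add_mono)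
          then show ?thesis using True by (simp add: k_def)
        next
          case False
          then show ?thesis using \<zeta>(4)[of x] by (auto simp: k_def indicator_def)
        qed
      qed (use Di Fi in auto)
      finally show ?thesis using True unfolding T_def by linarith
    next
      case False
      define \<eta> where "\<eta> x = \<zeta> x * \<zeta> x" for x
      have \<eta>: "\<eta> \<in> test_functions UNIV" "\<And>x. 0 \<le> \<eta> x" "\<And>x. x \<notin> B \<Longrightarrow> \<eta> x = 0"
        using test_function_mult(1)[OF \<zeta>(1) \<zeta>(1)] \<zeta>(2,4) by (auto simp: \<eta>_def[abs_def])
      define w where "w x = max 0 (\<eta> x * u x)" for x
      define G where "G x = (if \<eta> x * u x > 0 then \<eta> x *\<^sub>R g x + u x *\<^sub>R grad \<eta> x else 0)" for x
      note w0 = pos_part_cutoff_weak_gradient[OF \<Omega> W(3) cu W(1,2) \<eta> Bs(3,2), folded w_def G_def]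
      have w: "continuous_on UNIV w" "\<And>x. x \<notin> B \<Longrightarrow> w x = 0" "\<And>x. x \<notin> B \<Longrightarrow> G x = 0"
        "G \<in> L2 \<Omega>" "has_weak_gradient \<Omega> w G"
        by (rule w0, assumption+)+
      have Geq: "G x = indicator ?U x *\<^sub>R ((\<zeta> x)\<^sup>2 *\<^sub>R g x + (2 * \<zeta> x * u x) *\<^sub>R grad \<zeta> x)" if "x \<in> \<Omega>" for x
      proof -
        have "\<eta> x *\<^sub>R g x + u x *\<^sub>R grad \<eta> x = (\<zeta> x)\<^sup>2 *\<^sub>R g x + (2 * \<zeta> x * u x) *\<^sub>R grad \<zeta> x"
          unfolding \<eta>_def[abs_def] grad_square[OF \<zeta>(1)] by (simp add: power2_eq_square mult_ac)
        moreover have "\<eta> x * u x > 0 \<longleftrightarrow> \<zeta> x \<noteq> 0 \<and> u x > 0"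
          using \<zeta>(2)[of x] by (auto simp: \<eta>_def zero_less_mult_iff)
        ultimately show ?thesis
          unfolding G_def using that by (auto simp: pos_set_def indicator_def)
      qed
      have wL2: "w \<in> L2 \<Omega>" using L2_compact_support[OF w(1) Bs(3) w(2) \<Omega>s] .
      define v where "v x = u x - w x" for x
      have vL2: "v \<in> L2 \<Omega>" unfolding v_def[abs_def] using L2_diff[OF W(3) wL2] .
      have gGL2: "(\<lambda>x. g x - G x) \<in> L2 \<Omega>" using L2_diff[OF W(1) w(4)] .
      have vwg: "has_weak_gradient \<Omega> v (\<lambda>x. g x - G x)"
        using has_weak_gradient_add_scaled[OF W(3,1,2) wL2 w(4,5) \<Omega>s, of "-1"] by (simp add: v_def[abs_def])
      \<comment> \<open>The negative is obtained as w + (-2) w. It is needed because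
        \<open>K_class\<close> asks for v - u, which is -w, to lie in \<open>W12_0\<close>.\<close>
      have nw: "has_weak_gradient \<Omega> (\<lambda>x. - w x) (\<lambda>x. - G x)"
        using has_weak_gradient_add_scaled[OF wL2 w(4,5) wL2 w(4,5) \<Omega>s, of "-2"]
        by (simp add: scaleR_2)
      have nGL2: "(\<lambda>x. - G x) \<in> L2 \<Omega>" using L2_scaleR[OF w(4), of "-1"] by simp
      have "(\<lambda>x. - w x) \<in> W12_0 \<Omega>"
        by (rule compact_support_W12_0[OF \<Omega> _ _ nGL2 _ nw Bs(3,2)])
           (auto intro!: continuous_on_minus w(1) simp: w(2,3))
      moreover have "v \<in> W12 \<Omega>" using vL2 gGL2 vwg by (auto simp: W12_def)
      ultimately have vK: "v \<in> K_class u \<Omega>" by (simp add: K_class_def v_def)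
      \<comment> \<open>On U the competitor equals \<open>(1 - (\<zeta> x)\<^sup>2) * u x\<close>,
        positive exactly where \<open>\<zeta> x\<close> differs from 1. Off U it is at most u, hence
        not positive.\<close>
      have Ui: "indicator (pos_set \<Omega> v) x = indicat_real ?U x - indicator (?U \<inter> {x. \<zeta> x = 1}) x" if "x \<in> \<Omega>" for x
      proof (cases "u x > 0")
        case True
        have "\<eta> x * u x \<ge> 0" using True \<eta>(2)[of x] by simp
        then have "v x = u x - \<eta> x * u x" by (simp add: v_def w_def max_absorb2)
        then have "v x = u x * (1 - (\<zeta> x)\<^sup>2)" by (simp add: \<eta>_def power2_eq_square algebra_simps)
        moreover have "1 - (\<zeta> x)\<^sup>2 > 0 \<longleftrightarrow> \<zeta> x \<noteq> 1"
          using \<zeta>(2,3)[of x] power2_eq_1_iff[of "\<zeta> x"] abs_square_less_1[of "\<zeta> x"] by auto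
        ultimately have "v x > 0 \<longleftrightarrow> \<zeta> x \<noteq> 1" using True by (simp add: zero_less_mult_iff)
        then show ?thesis using True that by (auto simp: pos_set_def indicator_def)
      next
        case F: False
        then have "v x \<le> 0" by (simp add: v_def w_def)
        with F show ?thesis by (auto simp: pos_set_def indicator_def)
      qed
      have Gi: "integrable ?M (\<lambda>x. (norm (G x))\<^sup>2)" using L2_integrable_square[OF w(4)] .
      have "(LINT x|?M. (norm (G x))\<^sup>2) \<le> (LINT x|?M. 2 * (indicator B x * k x) + 8 * (indicator ?U x * ((u x)\<^sup>2 * (norm (grad \<zeta> x))\<^sup>2)))"
      proof (rule integral_mono[OF Gi])
        fix x assume "x \<in> space ?M"
        then have x: "x \<in> \<Omega>" by simp
        show "(norm (G x))\<^sup>2 \<le> 2 * (indicator B x * k x) + 8 * (indicator ?U x * ((u x)\<^sup>2 * (norm (grad \<zeta> x))\<^sup>2))"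
        proof (cases "x \<in> ?U")
          case True
          have z1: "(\<zeta> x)\<^sup>2 \<le> 1" using \<zeta>(2,3)[of x] by (simp add: power_le_one)
          have "(norm ((\<zeta> x)\<^sup>2 *\<^sub>R g x))\<^sup>2 = (\<zeta> x)\<^sup>2 * (\<zeta> x)\<^sup>2 * (norm (g x))\<^sup>2"
            by (simp add: power2_eq_square)
          also have "\<dots> \<le> 1 * indicator B x * (norm (g x))\<^sup>2"
            using z1 \<zeta>sq[of x] by (intro mult_right_mono mult_mono) auto
          also have "\<dots> \<le> indicator B x * k x"
            using True by (simp add: k_def indicator_def)
          finally have a: "(norm ((\<zeta> x)\<^sup>2 *\<^sub>R g x))\<^sup>2 \<le> indicator B x * k x" .
          have "(norm ((2 * \<zeta> x * u x) *\<^sub>R grad \<zeta> x))\<^sup>2 = 4 * ((\<zeta> x)\<^sup>2 * ((u x)\<^sup>2 * (norm (grad \<zeta> x))\<^sup>2))"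
            by (simp add: power_mult_distrib)
          also have "\<dots> \<le> 4 * (1 * ((u x)\<^sup>2 * (norm (grad \<zeta> x))\<^sup>2))"
            using z1 by (intro mult_left_mono mult_right_mono) auto
          finally have b: "(norm ((2 * \<zeta> x * u x) *\<^sub>R grad \<zeta> x))\<^sup>2 \<le> 4 * ((u x)\<^sup>2 * (norm (grad \<zeta> x))\<^sup>2)" by simp
          have "(norm (G x))\<^sup>2 \<le> 2 * (norm ((\<zeta> x)\<^sup>2 *\<^sub>R g x))\<^sup>2 + 2 * (norm ((2 * \<zeta> x * u x) *\<^sub>R grad \<zeta> x))\<^sup>2"
            using True norm_sq_add_le by (simp add: Geq[OF x] del: norm_scaleR)
          also have "\<dots> \<le> 2 * (indicator B x * k x) + 2 * (4 * ((u x)\<^sup>2 * (norm (grad \<zeta> x))\<^sup>2))"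
            by (intro add_mono mult_left_mono a b) auto
          finally show ?thesis using True by simp
        next
          case False
          then show ?thesis using k0[of x] by (simp add: Geq[OF x])
        qed
      qed (use Hi Ti in auto)
      also have "\<dots> = 2 * H + 8 * T" using Hi Ti by (simp add: H_def T_def)
      also have "\<dots> < 3 * (\<epsilon> / 8)" using False r(3) \<epsilon> unfolding H_def B_def[symmetric] by linarith
      finally have Gsmall: "(LINT x|?M. (norm (G x))\<^sup>2) < 3 * (\<epsilon> / 8)" .
      have uvw: "(\<lambda>y. u y - v y) = w" by (simp add: v_def fun_eq_iff)
      have "(\<integral>\<^sup>+x. ennreal ((norm (weak_grad \<Omega> (\<lambda>y. u y - v y) x))\<^sup>2) \<partial>?M) = (\<integral>\<^sup>+x. ennreal ((norm (G x))\<^sup>2) \<partial>?M)"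
        unfolding uvw using weak_grad_AE_eq[OF \<Omega> wL2 w(4,5)]
        by (intro nn_integral_cong_AE, eventually_elim) simp
      also have "\<dots> = ennreal (LINT x|?M. (norm (G x))\<^sup>2)"
        by (rule nn_integral_eq_integral[OF Gi]) simp
      finally have d1: "(\<integral>\<^sup>+x. ennreal ((norm (weak_grad \<Omega> (\<lambda>y. u y - v y) x))\<^sup>2) \<partial>?M) \<le> ennreal (3 * (\<epsilon> / 8))"
        using Gsmall by (simp add: ennreal_leI)
      have "(\<integral>\<^sup>+x. ennreal \<bar>indicat_real ?U x - indicat_real (pos_set \<Omega> v) x\<bar> \<partial>?M) \<le> (\<integral>\<^sup>+x. indicator B x \<partial>?M)"
      proof (rule nn_integral_mono)
        fix x assume "x \<in> space ?M"
        then have "x \<in> \<Omega>" by simp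
        from Ui[OF this]
        have "\<bar>indicat_real ?U x - indicat_real (pos_set \<Omega> v) x\<bar> = indicator (?U \<inter> {x. \<zeta> x = 1}) x" by simp
        then show "ennreal \<bar>indicat_real ?U x - indicat_real (pos_set \<Omega> v) x\<bar> \<le> indicator B x"
          using \<zeta>(4)[of x] by (simp add: indicator_def)
      qed
      also have "\<dots> = emeasure lebesgue B"
        using BM Bs \<Omega>s by (simp add: emeasure_restrict_space)
      also have "\<dots> = ennreal (measure lebesgue B)"
        using emeasure_eq_measure2[OF lmeasurable_compact[OF Bs(3)]] .
      also have "\<dots> \<le> ennreal (\<epsilon> / 8)"
        using r(4) unfolding B_def[symmetric] by (intro ennreal_leI) simp
      finally have d2: "(\<integral>\<^sup>+x. ennreal \<bar>indicat_real ?U x - indicat_real (pos_set \<Omega> v) x\<bar> \<partial>?M) \<le> ennreal (\<epsilon> / 8)" .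
      have "(\<integral>\<^sup>+x. ennreal ((norm (weak_grad \<Omega> (\<lambda>y. u y - v y) x))\<^sup>2) \<partial>?M) +
        (\<integral>\<^sup>+x. ennreal \<bar>indicat_real ?U x - indicat_real (pos_set \<Omega> v) x\<bar> \<partial>?M) \<le> ennreal (3 * (\<epsilon> / 8)) + ennreal (\<epsilon> / 8)"
        by (intro add_mono d1 d2)
      also have "\<dots> = ennreal (\<epsilon> / 2)" using \<epsilon> by (simp add: ennreal_plus[symmetric] del: ennreal_plus)
      also have "\<dots> < ennreal \<epsilon>" using \<epsilon> by (simp add: ennreal_lessI)
      finally have Jle: "J Q u \<Omega> \<le> J Q v \<Omega>" by (rule min[OF vK])
      define a where "a x = (norm (g x))\<^sup>2 + (Q x)\<^sup>2 * indicat_real ?U x" for x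
      define b where "b x = (norm (g x - G x))\<^sup>2 + (Q x)\<^sup>2 * indicat_real (pos_set \<Omega> v) x" for x
      have ai: "integrable ?M a"
        unfolding a_def using gi integrable_mult_indicator[OF U(3) Qi]
        by (intro Bochner_Integration.integrable_add) (auto simp: mult.commute)
      have bi: "integrable ?M b"
      proof -
        have "integrable ?M (\<lambda>x. (norm (g x - G x))\<^sup>2 + (indicator ?U x *\<^sub>R (Q x)\<^sup>2 - indicator (?U \<inter> {x. \<zeta> x = 1}) x * (Q x)\<^sup>2))"
          using L2_integrable_square[OF gGL2] integrable_mult_indicator[OF U(3) Qi] Fi
          by (intro Bochner_Integration.integrable_add Bochner_Integration.integrable_diff)
        then show ?thesis
          by (subst Bochner_Integration.integrable_cong[OF refl]) (auto simp: b_def Ui algebra_simps)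
      qed
      have "J Q u \<Omega> = (\<integral>\<^sup>+x. ennreal (a x) \<partial>?M)"
        by (simp add: J_def a_def g_def)
      also have "\<dots> = ennreal (LINT x|?M. a x)"
        by (rule nn_integral_eq_integral[OF ai]) (simp add: a_def)
      finally have Ju: "J Q u \<Omega> = ennreal (LINT x|?M. a x)" .
      have "J Q v \<Omega> = (\<integral>\<^sup>+x. ennreal (b x) \<partial>?M)"
        unfolding J_def b_def using weak_grad_AE_eq[OF \<Omega> vL2 gGL2 vwg]
        by (intro nn_integral_cong_AE, eventually_elim) simp
      also have "\<dots> = ennreal (LINT x|?M. b x)"
        by (rule nn_integral_eq_integral[OF bi]) (simp add: b_def)
      finally have Jv: "J Q v \<Omega> = ennreal (LINT x|?M. b x)" .
      have "(LINT x|?M. b x) \<ge> 0" by (rule integral_nonneg_AE) (simp add: b_def)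
      with Jle have ab: "(LINT x|?M. a x) \<le> (LINT x|?M. b x)" by (simp add: Ju Jv)
      \<comment> \<open>The integrand of the claim. On U, \<open>caccioppoli_pointwise\<close>
        bounds it by the energy saved, a - b; off U both are 0. Minimality makes the integral of a -
        b nonpositive.\<close>
      define L where "L x = indicator ?U x * ((\<zeta> x)\<^sup>2 * (norm (g x))\<^sup>2) / 2 + indicator (?U \<inter> {x. \<zeta> x = 1}) x * (Q x)\<^sup>2
          - 12 * (indicator ?U x * ((u x)\<^sup>2 * (norm (grad \<zeta> x))\<^sup>2))" for x
      have Li: "integrable ?M L" unfolding L_def using Di Fi Ti by simp
      have "(LINT x|?M. L x) \<le> (LINT x|?M. a x - b x)"
      proof (rule integral_mono[OF Li])
        fix x assume "x \<in> space ?M"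
        then have x: "x \<in> \<Omega>" by simp
        show "L x \<le> a x - b x"
        proof (cases "x \<in> ?U")
          case True
          have "(\<zeta> x)\<^sup>2 * (norm (g x))\<^sup>2 / 2 - 12 * (u x)\<^sup>2 * (norm (grad \<zeta> x))\<^sup>2 \<le> (norm (g x))\<^sup>2 - (norm (g x - G x))\<^sup>2"
            using caccioppoli_pointwise[OF \<zeta>(2,3), of x "g x" "u x" "grad \<zeta> x"] True by (simp add: Geq[OF x])
          then show ?thesis
            using True by (simp add: L_def a_def b_def Ui[OF x] algebra_simps)
        next
          case False
          then show ?thesis by (simp add: L_def a_def b_def Ui[OF x] Geq[OF x])
        qed
      qed (use ai bi in auto)
      also have "\<dots> \<le> 0" using ai bi ab by simp
      finally have "(LINT x|?M. L x) \<le> 0" .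
      then show ?thesis unfolding L_def using Di Fi Ti by simp
    qed
  qed
  show thesis
    by (rule that[OF r(1,2)]) (rule main[unfolded B_def g_def], assumption+)
qed

section \<open>Cutoffs between concentric squares\<close>

lemma grad_compose_affine:
  fixes l :: "'a::euclidean_space" and \<sigma> :: "real \<Rightarrow> real"
  assumes "\<And>k. C_k k \<sigma>"
  shows "grad (\<lambda>x. \<sigma> (l \<bullet> x + c)) x = frechet_derivative \<sigma> (at (l \<bullet> x + c)) 1 *\<^sub>R l"
proof -
  have der: "(\<sigma> has_derivative frechet_derivative \<sigma> (at t)) (at t)" for t
    using C_k_Suc_has_derivative assms by blast
  have "((\<lambda>x. \<sigma> (l \<bullet> x + c)) has_derivative (\<lambda>h. frechet_derivative \<sigma> (at (l \<bullet> x + c)) (l \<bullet> h))) (at x)"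
    by (rule has_derivative_compose[where g=\<sigma>, OF _ der]) (auto intro!: derivative_eq_intros)
  then have "frechet_derivative (\<lambda>x. \<sigma> (l \<bullet> x + c)) (at x) = (\<lambda>h. frechet_derivative \<sigma> (at (l \<bullet> x + c)) (l \<bullet> h))"
    using frechet_derivative_at by metis
  moreover have "frechet_derivative \<sigma> (at y) t = frechet_derivative \<sigma> (at y) 1 * t" for y t
    using linear_cmul[OF has_derivative_linear[OF der], of y t 1] by simp
  ultimately have "frechet_derivative (\<lambda>x. \<sigma> (l \<bullet> x + c)) (at x)
      = (\<lambda>h. frechet_derivative \<sigma> (at (l \<bullet> x + c)) 1 * (l \<bullet> h))"
    by metis
  then have "grad (\<lambda>x. \<sigma> (l \<bullet> x + c)) x = (\<Sum>b\<in>Basis. frechet_derivative \<sigma> (at (l \<bullet> x + c)) 1 *\<^sub>R ((l \<bullet> b) *\<^sub>R b))"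
    by (simp add: grad_def)
  then show ?thesis
    by (simp only: scaleR_sum_right[symmetric] euclidean_representation)
qed

lemma norm_grad_mult_le:
  fixes f g :: "'a::euclidean_space \<Rightarrow> real"
  assumes "C_k (Suc 0) f" "C_k (Suc 0) g" "\<bar>f x\<bar> \<le> 1" "\<bar>g x\<bar> \<le> 1"
    "norm (grad f x) \<le> A" "norm (grad g x) \<le> B"
  shows "norm (grad (\<lambda>x. f x * g x) x) \<le> A + B"
proof -
  have "frechet_derivative (\<lambda>x. f x * g x) (at x) =
      (\<lambda>h. f x * frechet_derivative g (at x) h + frechet_derivative f (at x) h * g x)"
    using frechet_derivative_at[OF has_derivative_mult[OF C_k_Suc_has_derivative[OF assms(1)]
        C_k_Suc_has_derivative[OF assms(2)]]] by metis
  then have "grad (\<lambda>x. f x * g x) x = f x *\<^sub>R grad g x + g x *\<^sub>R grad f x"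
    by (simp add: grad_def scaleR_sum_right sum.distrib[symmetric] algebra_simps)
  then have "norm (grad (\<lambda>x. f x * g x) x) \<le> \<bar>f x\<bar> * norm (grad g x) + \<bar>g x\<bar> * norm (grad f x)"
    using norm_triangle_ineq[of "f x *\<^sub>R grad g x" "g x *\<^sub>R grad f x"] by simp
  also have "\<dots> \<le> 1 * B + 1 * A"
    using assms by (intro add_mono mult_mono) auto
  finally show ?thesis by simp
qed

text \<open>Squares instead of balls: cutoffs become products of functions of one coordinate, and
  the part of a square close to the axis is a rectangle of known area.\<close>

definition square :: "real \<times> real \<Rightarrow> real \<Rightarrow> (real \<times> real) set" where
  "square p r = {q. \<bar>fst q - fst p\<bar> \<le> r \<and> \<bar>snd q - snd p\<bar> \<le> r}"

lemma square_eq_cbox: "square p r = cbox (p - (r, r)) (p + (r, r))"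
  by (cases p) (auto simp: square_def cbox_def Basis_prod_def abs_le_iff)

lemma compact_square: "compact (square p r)"
  by (simp add: square_eq_cbox)

lemma square_mono: "s \<le> r \<Longrightarrow> square p s \<subseteq> square p r"
  by (auto simp: square_def)

lemma square_subset_cball: "square p r \<subseteq> cball p (2 * r)"
proof
  fix q assume q: "q \<in> square p r"
  have "norm (p - q) \<le> norm (fst (p - q)) + norm (snd (p - q))"
    using norm_Pair_le[of "fst (p - q)" "snd (p - q)"] unfolding prod.collapse .
  with q show "q \<in> cball p (2 * r)"
    by (auto simp: square_def dist_norm)
qed

lemma cball_subset_square: "cball p r \<subseteq> square p r"
proof
  fix q assume q: "q \<in> cball p r"
  have "norm (fst (q - p)) \<le> norm (q - p)" "norm (snd (q - p)) \<le> norm (q - p)"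
    using norm_fst_le[of "fst (q - p)" "snd (q - p)"] norm_snd_le[of "snd (q - p)" "fst (q - p)"]
    by (simp_all only: prod.collapse)
  with q show "q \<in> square p r"
    by (auto simp: square_def dist_norm norm_minus_commute)
qed

text \<open>One transition per side of the square, multiplied together. All factors lie between 0
  and 1, so the gradient bounds just add up: four times M / (r - s), whence the constant
  \<open>(4 * M)\<^sup>2\<close>.\<close>

lemma square_cutoff:
  obtains C :: real where "C > 0"
    "\<And>p s r. s < r \<Longrightarrow> \<exists>\<zeta>. \<zeta> \<in> test_functions UNIV \<and> (\<forall>x. 0 \<le> \<zeta> x) \<and> (\<forall>x. \<zeta> x \<le> 1) \<and>
      (\<forall>x\<in>square p s. \<zeta> x = 1) \<and> (\<forall>x. x \<notin> square p r \<longrightarrow> \<zeta> x = 0) \<and>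
      (\<forall>x. (norm (grad \<zeta> x))\<^sup>2 \<le> C / (r - s)\<^sup>2)"
proof -
  obtain \<sigma> :: "real \<Rightarrow> real" and M where \<sigma>: "\<And>k. C_k k \<sigma>" "\<And>t. 0 \<le> \<sigma> t" "\<And>t. \<sigma> t \<le> 1"
    "\<And>t. t \<le> 0 \<Longrightarrow> \<sigma> t = 0" "\<And>t. t \<ge> 1 \<Longrightarrow> \<sigma> t = 1"
    and M: "M > 0" "\<And>t. \<bar>frechet_derivative \<sigma> (at t) 1\<bar> \<le> M"
    using smooth_transition by blast
  show thesis
  proof (rule that[of "(4 * M)\<^sup>2"])
    fix p :: "real \<times> real" and s r :: real assume sr: "s < r"
    define d where "d = r - s"
    have d: "d > 0" using sr by (simp add: d_def)
    \<comment> \<open>For l a signed unit vector divided by d, the argument of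
      \<open>\<sigma>\<close> is r plus or minus a coordinate of x - p, divided by d. It is at most
      0 beyond the corresponding side of the large square and at least 1 in the small one.\<close>
    define S where "S l x = \<sigma> (l \<bullet> x + (r / d - l \<bullet> p))" for l x :: "real \<times> real"
    define \<zeta> where "\<zeta> x = (S (1 / d, 0) x * S (- 1 / d, 0) x) * (S (0, 1 / d) x * S (0, - 1 / d) x)" for x
    have SC: "C_k k (S l)" for k l
      unfolding S_def[abs_def] by (rule C_k_compose_affine[OF \<sigma>(1)])
    have S01: "0 \<le> S l x" "S l x \<le> 1" for l x by (simp_all add: S_def \<sigma>)
    have Sgrad: "norm (grad (S l) x) \<le> M * norm l" for l x
      unfolding S_def[abs_def] grad_compose_affine[OF \<sigma>(1)] using M(2) by (simp add: mult_right_mono)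
    have arg: "(a / d, b / d) \<bullet> x + (r / d - (a / d, b / d) \<bullet> p) = (r + a * (fst x - fst p) + b * (snd x - snd p)) / d"
      for a b x using d by (simp add: inner_prod_def field_simps)
    have val: "S (1 / d, 0) x = \<sigma> ((r + (fst x - fst p)) / d)" "S (- 1 / d, 0) x = \<sigma> ((r - (fst x - fst p)) / d)"
      "S (0, 1 / d) x = \<sigma> ((r + (snd x - snd p)) / d)" "S (0, - 1 / d) x = \<sigma> ((r - (snd x - snd p)) / d)" for x
    proof -
      have eqs: "r + (fst p - fst x) = r - (fst x - fst p)" "r + (snd p - snd x) = r - (snd x - snd p)" by simp_all
      show "S (1 / d, 0) x = \<sigma> ((r + (fst x - fst p)) / d)" "S (- 1 / d, 0) x = \<sigma> ((r - (fst x - fst p)) / d)"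
        "S (0, 1 / d) x = \<sigma> ((r + (snd x - snd p)) / d)" "S (0, - 1 / d) x = \<sigma> ((r - (snd x - snd p)) / d)"
        using arg[of 1 0 x] arg[of "-1" 0 x] arg[of 0 1 x] arg[of 0 "-1" x] by (simp_all add: S_def eqs)
    qed
    have C: "C_k k \<zeta>" for k
      unfolding \<zeta>_def[abs_def] by (intro C_k_mult SC)
    have out: "\<zeta> x = 0" if "x \<notin> square p r" for x
    proof -
      have "r + (fst x - fst p) \<le> 0 \<or> r - (fst x - fst p) \<le> 0 \<or> r + (snd x - snd p) \<le> 0 \<or> r - (snd x - snd p) \<le> 0"
        using that by (auto simp: square_def abs_le_iff)
      then have "(r + (fst x - fst p)) / d \<le> 0 \<or> (r - (fst x - fst p)) / d \<le> 0
        \<or> (r + (snd x - snd p)) / d \<le> 0 \<or> (r - (snd x - snd p)) / d \<le> 0"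
        using d by (simp add: divide_le_0_iff)
      then show ?thesis unfolding \<zeta>_def val using \<sigma>(4) by auto
    qed
    have one: "\<zeta> x = 1" if "x \<in> square p s" for x
    proof -
      have "d \<le> r + (fst x - fst p)" "d \<le> r - (fst x - fst p)" "d \<le> r + (snd x - snd p)" "d \<le> r - (snd x - snd p)"
        using that by (auto simp: square_def abs_le_iff d_def)
      then have "1 \<le> (r + (fst x - fst p)) / d" "1 \<le> (r - (fst x - fst p)) / d"
        "1 \<le> (r + (snd x - snd p)) / d" "1 \<le> (r - (snd x - snd p)) / d"
        using d by (simp_all add: le_divide_eq)
      then show ?thesis unfolding \<zeta>_def val using \<sigma>(5) by simp
    qed
    have test: "\<zeta> \<in> test_functions UNIV"
      unfolding test_functions_iff using C compact_square[of p r] out by blast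
    have prod01: "0 \<le> S l x * S l' x" "S l x * S l' x \<le> 1" for l l' x
      using S01[of l x] S01[of l' x] by (auto intro: mult_le_one)
    have abs1: "\<bar>S l x\<bar> \<le> 1" "\<bar>S l x * S l' x\<bar> \<le> 1" for l l' x
      using S01[of l x] prod01[of l x l'] by auto
    have "norm (grad \<zeta> x) \<le> (M * norm (1 / d, 0::real) + M * norm (- 1 / d, 0::real))
      + (M * norm (0::real, 1 / d) + M * norm (0::real, - 1 / d))" for x
      unfolding \<zeta>_def[abs_def]
      by (intro norm_grad_mult_le C_k_mult SC abs1 Sgrad)
    then have g: "norm (grad \<zeta> x) \<le> 4 * M / d" for x
      using d by (simp add: norm_Pair)
    have "(norm (grad \<zeta> x))\<^sup>2 \<le> (4 * M / d)\<^sup>2" for x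
      using power_mono[OF g norm_ge_zero, of x 2] .
    then have "(norm (grad \<zeta> x))\<^sup>2 \<le> (4 * M)\<^sup>2 / (r - s)\<^sup>2" for x
      by (simp add: power_divide d_def)
    moreover have "0 \<le> \<zeta> x" "\<zeta> x \<le> 1" for x
      using prod01[of "(1 / d, 0)" x "(- 1 / d, 0)"] prod01[of "(0, 1 / d)" x "(0, - 1 / d)"]
      by (auto simp: \<zeta>_def intro: mult_le_one)
    ultimately show "\<exists>\<zeta>. \<zeta> \<in> test_functions UNIV \<and> (\<forall>x. 0 \<le> \<zeta> x) \<and> (\<forall>x. \<zeta> x \<le> 1) \<and>
      (\<forall>x\<in>square p s. \<zeta> x = 1) \<and> (\<forall>x. x \<notin> square p r \<longrightarrow> \<zeta> x = 0) \<and>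
      (\<forall>x. (norm (grad \<zeta> x))\<^sup>2 \<le> (4 * M)\<^sup>2 / (r - s)\<^sup>2)"
      using test one out by blast
  qed (use M in simp)
qed

text \<open>One cutoff serves both estimates. \<open>caccioppoli\<close> bounds the
  \<open>Q\<^sup>2\<close> mass and the gradient energy D by T, the integral of
  \<open>u\<^sup>2\<close> against the squared gradient of the cutoff. The Sobolev inequality for
  the positive part of \<open>\<zeta> x * u x\<close> then gains the area of the set where its
  gradient can live.\<close>

lemma square_estimates:
  fixes u Q :: "real \<times> real \<Rightarrow> real"
  assumes \<Omega>: "open \<Omega>" and lm: "local_minimizer Q \<Omega> u" and cu: "continuous_on \<Omega> u"
    and Qi: "integrable (lebesgue_on \<Omega>) (\<lambda>x. (Q x)\<^sup>2)"
    and p: "p \<in> \<Omega>"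
  defines "V \<equiv> \<lambda>r. LINT x|lebesgue_on \<Omega>. indicator (pos_set \<Omega> u \<inter> square p r) x * (u x)\<^sup>2"
    and "F \<equiv> \<lambda>r. LINT x|lebesgue_on \<Omega>. indicator (pos_set \<Omega> u \<inter> square p r) x * (Q x)\<^sup>2"
  obtains r0 C where "r0 > 0" "C > 0" "square p r0 \<subseteq> \<Omega>"
    "\<And>s r. s < r \<Longrightarrow> r \<le> r0 \<Longrightarrow> F s \<le> C / (r - s)\<^sup>2 * V r"
    "\<And>s r. s < r \<Longrightarrow> r \<le> r0 \<Longrightarrow> V s \<le> C / (r - s)\<^sup>2 * measure lebesgue (pos_set \<Omega> u \<inter> square p r) * V r"
proof -
  let ?M = "lebesgue_on \<Omega>" and ?U = "pos_set \<Omega> u"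
  define g where "g = weak_grad \<Omega> u"
  have \<Omega>s: "\<Omega> \<in> sets lebesgue" using \<Omega> by auto
  note W = weak_grad_props[OF local_minimizerD(1)[OF lm], folded g_def]
  note U = pos_set_lebesgue[OF \<Omega> cu]
  obtain r1 where r1: "r1 > 0" "cball p r1 \<subseteq> \<Omega>" and cacc:
    "\<And>\<zeta>. \<zeta> \<in> test_functions UNIV \<Longrightarrow> (\<And>x. 0 \<le> \<zeta> x) \<Longrightarrow> (\<And>x. \<zeta> x \<le> 1) \<Longrightarrow>
      (\<And>x. x \<notin> cball p r1 \<Longrightarrow> \<zeta> x = 0) \<Longrightarrow>
      (LINT x|?M. indicator ?U x * ((\<zeta> x)\<^sup>2 * (norm (g x))\<^sup>2)) / 2 +
      (LINT x|?M. indicator (?U \<inter> {x. \<zeta> x = 1}) x * (Q x)\<^sup>2) \<le>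
      12 * (LINT x|?M. indicator ?U x * ((u x)\<^sup>2 * (norm (grad \<zeta> x))\<^sup>2))"
    using caccioppoli[OF \<Omega> lm cu Qi p, folded g_def] by blast
  obtain C0 :: real where C0: "C0 > 0" and cut:
    "\<And>p s r. s < r \<Longrightarrow> \<exists>\<zeta>. \<zeta> \<in> test_functions UNIV \<and> (\<forall>x. 0 \<le> \<zeta> x) \<and> (\<forall>x. \<zeta> x \<le> 1) \<and>
      (\<forall>x\<in>square p s. \<zeta> x = 1) \<and> (\<forall>x. x \<notin> square p r \<longrightarrow> \<zeta> x = 0) \<and>
      (\<forall>x. (norm (grad \<zeta> x))\<^sup>2 \<le> C0 / (r - s)\<^sup>2)"
    using square_cutoff by blast
  \<comment> \<open>A square of half-width r0 lies in the ball of radius 2 r0, which is the ball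
    where the energy estimate holds.\<close>
  define r0 where "r0 = r1 / 2"
  have sub0: "square p r0 \<subseteq> cball p r1"
    using square_subset_cball[of p r0] by (simp add: r0_def)
  have Ssets: "?U \<inter> square p r \<in> sets lebesgue" "?U \<inter> square p r \<in> sets ?M" for r
  proof -
    show s: "?U \<inter> square p r \<in> sets lebesgue"
      using U(2) compact_imp_lebesgue[OF compact_square] by (rule sets.Int)
    show "?U \<inter> square p r \<in> sets ?M"
      using s \<Omega>s by (subst sets_restrict_space_iff) (auto simp: pos_set_def)
  qed
  have u2: "integrable ?M (\<lambda>x. (u x)\<^sup>2)" using L2_integrable_square[OF W(3)] by simp
  have Vi: "integrable ?M (\<lambda>x. indicator (?U \<inter> square p r) x * (u x)\<^sup>2)" for r
    using integrable_mult_indicator[OF Ssets(2) u2] by simp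
  \<comment> \<open>The energy estimate gives F s <= 12 T and D <= 24 T, and the squared gradient of
    the cut-off function integrates to at most 2 D + 2 T, that is 50 T. The larger constant serves
    both bounds.\<close>
  have key: "F s \<le> 50 * C0 / (r - s)\<^sup>2 * V r \<and>
      V s \<le> 50 * C0 / (r - s)\<^sup>2 * measure lebesgue (?U \<inter> square p r) * V r"
    if sr: "s < r" "r \<le> r0" for s r
  proof -
    obtain \<zeta> where \<zeta>: "\<zeta> \<in> test_functions UNIV" "\<And>x. 0 \<le> \<zeta> x" "\<And>x. \<zeta> x \<le> 1"
      "\<And>x. x \<in> square p s \<Longrightarrow> \<zeta> x = 1" "\<And>x. x \<notin> square p r \<Longrightarrow> \<zeta> x = 0"
      "\<And>x. (norm (grad \<zeta> x))\<^sup>2 \<le> C0 / (r - s)\<^sup>2"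
      using cut[OF sr(1), of p] by blast
    have \<zeta>1: "\<bar>\<zeta> x\<bar> \<le> 1" for x using \<zeta>(2,3)[of x] by simp
    have sq_sub: "square p r \<subseteq> cball p r1" "square p r \<subseteq> \<Omega>"
      using square_mono[OF sr(2), of p] sub0 r1(2) by blast+
    have "\<zeta> x = 0" if "x \<notin> cball p r1" for x
      by (rule \<zeta>(5)) (use that sq_sub(1) in blast)
    note ca = cacc[OF \<zeta>(1-3) this]
    define T where "T = (LINT x|?M. indicator ?U x * ((u x)\<^sup>2 * (norm (grad \<zeta> x))\<^sup>2))"
    define D where "D = (LINT x|?M. indicator ?U x * ((\<zeta> x)\<^sup>2 * (norm (g x))\<^sup>2))"
    have Ti: "integrable ?M (\<lambda>x. indicator ?U x * ((u x)\<^sup>2 * (norm (grad \<zeta> x))\<^sup>2))"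
      by (rule L2_indicator_norm_sq_integrable[OF L2_mult_grad[OF \<zeta>(1) \<zeta>1 \<Omega>s W(3)] U(3)])
         (simp add: power_mult_distrib)
    have Di: "integrable ?M (\<lambda>x. indicator ?U x * ((\<zeta> x)\<^sup>2 * (norm (g x))\<^sup>2))"
      by (rule L2_indicator_norm_sq_integrable[OF L2_mult_cutoff[OF \<zeta>(1) \<zeta>1 \<Omega>s W(1)] U(3)])
         (simp add: power_mult_distrib)
    have Z: "?U \<inter> {x. \<zeta> x = 1} \<in> sets ?M"
    proof -
      have "closed {x. \<zeta> x = 1}"
        using test_function_continuous[OF \<zeta>(1)] by (intro closed_Collect_eq continuous_on_const)
      then show ?thesis
        using U(2) \<Omega>s by (subst sets_restrict_space_iff) (auto simp: pos_set_def)
    qed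
    have gr0: "grad \<zeta> x = 0" if "x \<notin> square p r" for x
    proof -
      have "frechet_derivative \<zeta> (at x) = (\<lambda>h. 0)"
        using derivative_zero_outside[OF test_function_derivative(1)[OF \<zeta>(1)]
            compact_imp_closed[OF compact_square] \<zeta>(5) that] .
      then show ?thesis by (simp add: grad_def)
    qed
    have "T \<le> (LINT x|?M. C0 / (r - s)\<^sup>2 * (indicator (?U \<inter> square p r) x * (u x)\<^sup>2))"
      unfolding T_def
    proof (rule integral_mono[OF Ti])
      fix x
      show "indicator ?U x * ((u x)\<^sup>2 * (norm (grad \<zeta> x))\<^sup>2) \<le> C0 / (r - s)\<^sup>2 * (indicator (?U \<inter> square p r) x * (u x)\<^sup>2)"
      proof (cases "x \<in> ?U \<inter> square p r")
        case True
        then show ?thesis using mult_left_mono[OF \<zeta>(6)[of x], of "(u x)\<^sup>2"] by (simp add: mult.commute)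
      next
        case False
        then show ?thesis using gr0[of x] by (auto simp: indicator_def)
      qed
    qed (use Vi in auto)
    then have TV: "T \<le> C0 / (r - s)\<^sup>2 * V r" by (simp add: V_def)
    have T0: "T \<ge> 0" unfolding T_def by (rule integral_nonneg_AE) simp
    have D0: "D \<ge> 0" unfolding D_def by (rule integral_nonneg_AE) simp
    have Z0: "(LINT x|?M. indicator (?U \<inter> {x. \<zeta> x = 1}) x * (Q x)\<^sup>2) \<ge> 0" by (rule integral_nonneg_AE) simp
    have "F s \<le> (LINT x|?M. indicator (?U \<inter> {x. \<zeta> x = 1}) x * (Q x)\<^sup>2)"
      unfolding F_def
    proof (rule integral_mono)
      show "integrable ?M (\<lambda>x. indicator (?U \<inter> square p s) x * (Q x)\<^sup>2)"
        using integrable_mult_indicator[OF Ssets(2) Qi] by simp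
      show "integrable ?M (\<lambda>x. indicator (?U \<inter> {x. \<zeta> x = 1}) x * (Q x)\<^sup>2)"
        using integrable_mult_indicator[OF Z Qi] by simp
    qed (use \<zeta>(4) in \<open>auto simp: indicator_def\<close>)
    then have FT: "F s \<le> 12 * T" using ca D0 unfolding T_def D_def by linarith
    have DT: "D \<le> 24 * T" using ca Z0 unfolding T_def D_def by linarith
    define w where "w x = max 0 (\<zeta> x * u x)" for x
    define G where "G x = (if \<zeta> x * u x > 0 then \<zeta> x *\<^sub>R g x + u x *\<^sub>R grad \<zeta> x else 0)" for x
    note w0 = pos_part_cutoff_weak_gradient[OF \<Omega> W(3) cu W(1,2) \<zeta>(1,2,5) compact_square sq_sub(2), folded w_def G_def]
    have w: "continuous_on UNIV w" "\<And>x. x \<notin> square p r \<Longrightarrow> w x = 0" "\<And>x. x \<notin> square p r \<Longrightarrow> G x = 0"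
      "G \<in> L2 \<Omega>" "has_weak_gradient \<Omega> w G"
      by (rule w0, assumption+)+
    have A: "?U \<inter> square p r \<in> lmeasurable"
      using fmeasurable_Int_fmeasurable[OF lmeasurable_compact[OF compact_square] U(2)] by (simp add: Int_commute)
    have GA: "G x = 0" if "x \<notin> ?U \<inter> square p r" for x
    proof (cases "x \<in> square p r")
      case True
      with that sq_sub have "\<not> u x > 0" by (auto simp: pos_set_def)
      then show ?thesis using \<zeta>(2)[of x] by (auto simp: G_def zero_less_mult_iff)
    qed (rule w(3))
    have out: "w x = 0" "G x = 0" if "x \<notin> \<Omega>" for x
      using w(2,3) that sq_sub(2) by blast+
    have "(LINT x|lebesgue. (w x)\<^sup>2) \<le> measure lebesgue (?U \<inter> square p r) * (LINT x|lebesgue. (norm (G x))\<^sup>2)"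
      by (rule sobolev_compact_support[OF \<Omega> w(1,2,4,3,5) compact_square sq_sub(2) A GA])
    then have sob: "(LINT x|?M. (w x)\<^sup>2) \<le> measure lebesgue (?U \<inter> square p r) * (LINT x|?M. (norm (G x))\<^sup>2)"
      using integral_lebesgue_on_zero_outside[OF \<Omega>s, of "\<lambda>x. (w x)\<^sup>2"]
        integral_lebesgue_on_zero_outside[OF \<Omega>s, of "\<lambda>x. (norm (G x))\<^sup>2"] out by simp
    have "V s \<le> (LINT x|?M. (w x)\<^sup>2)"
      unfolding V_def
    proof (rule integral_mono[OF Vi])
      show "integrable ?M (\<lambda>x. (w x)\<^sup>2)"
        using L2_integrable_square[OF L2_compact_support[OF w(1) compact_square w(2) \<Omega>s]] by simp
      show "indicator (?U \<inter> square p s) x * (u x)\<^sup>2 \<le> (w x)\<^sup>2" for x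
        using \<zeta>(4)[of x] by (cases "x \<in> ?U \<inter> square p s") (auto simp: w_def pos_set_def)
    qed
    note Vw = this
    have "(LINT x|?M. (norm (G x))\<^sup>2) \<le> (LINT x|?M. 2 * (indicator ?U x * ((\<zeta> x)\<^sup>2 * (norm (g x))\<^sup>2))
        + 2 * (indicator ?U x * ((u x)\<^sup>2 * (norm (grad \<zeta> x))\<^sup>2)))"
    proof (rule integral_mono[OF L2_integrable_square[OF w(4)]])
      fix x
      show "(norm (G x))\<^sup>2 \<le> 2 * (indicator ?U x * ((\<zeta> x)\<^sup>2 * (norm (g x))\<^sup>2))
        + 2 * (indicator ?U x * ((u x)\<^sup>2 * (norm (grad \<zeta> x))\<^sup>2))"
      proof (cases "x \<in> ?U")
        case True
        have "(norm (G x))\<^sup>2 \<le> (norm (\<zeta> x *\<^sub>R g x + u x *\<^sub>R grad \<zeta> x))\<^sup>2" by (simp add: G_def)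
        also have "\<dots> \<le> 2 * (norm (\<zeta> x *\<^sub>R g x))\<^sup>2 + 2 * (norm (u x *\<^sub>R grad \<zeta> x))\<^sup>2" by (rule norm_sq_add_le)
        finally show ?thesis using True by (simp add: power_mult_distrib)
      next
        case False
        then show ?thesis using GA[of x] by simp
      qed
    qed (use Ti Di in auto)
    also have "\<dots> = 2 * D + 2 * T" using Ti Di by (simp add: D_def T_def)
    also have "\<dots> \<le> 50 * T" using DT by simp
    finally have "measure lebesgue (?U \<inter> square p r) * (LINT x|?M. (norm (G x))\<^sup>2)
        \<le> measure lebesgue (?U \<inter> square p r) * (50 * T)"
      by (intro mult_left_mono) auto
    with Vw sob have VT: "V s \<le> measure lebesgue (?U \<inter> square p r) * (50 * T)" by linarith
    have "measure lebesgue (?U \<inter> square p r) * (50 * T) \<le> measure lebesgue (?U \<inter> square p r) * (50 * (C0 / (r - s)\<^sup>2 * V r))"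
      using TV by (intro mult_left_mono) auto
    with VT have "V s \<le> 50 * C0 / (r - s)\<^sup>2 * measure lebesgue (?U \<inter> square p r) * V r"
      by (simp add: mult_ac)
    moreover have "F s \<le> 50 * (C0 / (r - s)\<^sup>2 * V r)"
      using FT TV T0 by linarith
    ultimately show ?thesis by simp
  qed
  show thesis
  proof (rule that[of r0 "50 * C0"])
    show "r0 > 0" using r1 by (simp add: r0_def)
    show "square p r0 \<subseteq> \<Omega>" using sub0 r1(2) by blast
  qed (use key C0 in auto)
qed

section \<open>De Giorgi iteration\<close>

text \<open>The hypothesis on A makes the estimate for V superlinear: if V is small, so is A, and V
  shrinks by the factor \<open>\<mu>\<close> in each round, although the inverse squares of the gaps
  between radii grow like 16 ^ k. The threshold scales like the fourth power of r times
  \<open>r powr (2 * \<gamma>)\<close>, so \<open>\<delta>\<close> is the same for all r.\<close>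

lemma de_giorgi_iteration:
  fixes V F A :: "real \<Rightarrow> real"
  assumes \<gamma>: "\<gamma> > 0" and C: "C > 0" and r0: "r0 > 0"
    and V0: "\<And>r. V r \<ge> 0" and Vmono: "\<And>s r. s \<le> r \<Longrightarrow> V s \<le> V r"
    and F: "\<And>s r. s < r \<Longrightarrow> r \<le> r0 \<Longrightarrow> F s \<le> C / (r - s)\<^sup>2 * V r"
    and V: "\<And>s r. s < r \<Longrightarrow> r \<le> r0 \<Longrightarrow> V s \<le> C / (r - s)\<^sup>2 * A r * V r"
    and A: "\<And>r t. 0 < r \<Longrightarrow> r \<le> r0 \<Longrightarrow> 0 < t \<Longrightarrow> A r \<le> 4 * r * t + t powr (- (2 * \<gamma>)) * F r"
  obtains \<delta> where "\<delta> > 0" "\<And>r. 0 < r \<Longrightarrow> r \<le> r0 \<Longrightarrow> V r \<le> \<delta> * r ^ 4 * r powr (2 * \<gamma>) \<Longrightarrow> V (r / 2) = 0"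
proof -
  \<comment> \<open>In round k the gaps cost s = 16 ^ k, and \<open>s powr (2 * \<gamma>)\<close> is
    b ^ k. The choice \<open>b * \<mu> = 1 / 256\<close> makes \<open>(b * \<mu>) ^ k\<close> equal
    to 1 / (s * s): one factor s pays for the gap in F, the other for the gap in V.
    \<open>\<tau>\<close> and \<open>\<delta>\<close> are tuned so that the two terms bounding A are
    each at most \<open>\<mu> * r\<^sup>2 / (128 * C * s)\<close>.\<close>
  define b :: real where "b = 16 powr (2 * \<gamma>)"
  define \<mu> where "\<mu> = 1 / (256 * b)"
  define \<tau> where "\<tau> = \<mu> / (512 * C)"
  define \<delta> where "\<delta> = \<mu> * \<tau> powr (2 * \<gamma>) / (2048 * C\<^sup>2)"
  have b: "b \<ge> 1" unfolding b_def using \<gamma> by (intro ge_one_powr_ge_zero) auto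
  have \<mu>: "\<mu> > 0" "\<mu> < 1" using b by (auto simp: \<mu>_def divide_less_eq)
  have \<tau>: "\<tau> > 0" using \<mu> C by (simp add: \<tau>_def)
  have \<delta>: "\<delta> > 0" using \<mu> \<tau> C by (simp add: \<delta>_def)
  have "V (r / 2) = 0" if r: "0 < r" "r \<le> r0" and small: "V r \<le> \<delta> * r ^ 4 * r powr (2 * \<gamma>)" for r
  proof -
    define R where "R = r powr (2 * \<gamma>)"
    have R: "R > 0" using r by (simp add: R_def)
    define q where "q k = r / 2 * (1 + (1 / 2) ^ k)" for k :: nat
    have q0: "q 0 = r" by (simp add: q_def)
    have qge: "q k > r / 2" for k using r by (simp add: q_def)
    have qle: "q k \<le> r" for k
    proof -
      have "(1 / 2 :: real) ^ k \<le> 1" by (rule power_le_one) auto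
      then show ?thesis using r mult_left_mono[of "1 + (1 / 2) ^ k" 2 "r / 2"] by (simp add: q_def)
    qed
    have qd: "q k - q (Suc k) = r * (1 / 2) ^ (k + 2)" for k
      by (simp add: q_def field_simps)
    have qlt: "q (Suc k) < q k" for k using qd[of k] r by (smt (verit) zero_less_mult_iff zero_less_power zero_less_divide_1_iff)
    \<comment> \<open>Each round spends two gaps: the first passes from V to F, hence to A, and the
      second from the product of A and V back to V. Therefore only even indices appear.\<close>
    have decay: "V (q (2 * k)) \<le> \<delta> * r ^ 4 * R * \<mu> ^ k" for k
    proof (induction k)
      case 0
      then show ?case using small by (simp add: q0 R_def)
    next
      case (Suc k)
      define s where "s = (16::real) ^ k"
      have s: "s > 0" by (simp add: s_def)
      define W where "W = V (q (2 * k))"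
      have d1: "(q (2 * k) - q (Suc (2 * k)))\<^sup>2 = r\<^sup>2 / (16 * s)"
        unfolding qd s_def by (simp add: power_mult_distrib power_add power_mult power2_eq_square power_divide power_commutes flip: power_mult_distrib)
      have d2: "(q (Suc (2 * k)) - q (Suc (Suc (2 * k))))\<^sup>2 = r\<^sup>2 / (64 * s)"
        unfolding qd s_def by (simp add: power_mult_distrib power_add power_mult power2_eq_square power_divide power_commutes flip: power_mult_distrib)
      have F1: "F (q (Suc (2 * k))) \<le> 16 * C * s / r\<^sup>2 * W"
        using F[OF qlt[of "2 * k"]] qle[of "2 * k"] r unfolding d1 W_def by (simp add: mult_ac)
      \<comment> \<open>The strip is thinned in each round, so that its area 4 r t decays like 1/s
        and compensates the factor s from the gap.\<close>
      define t where "t = \<tau> * r / s"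
      have t: "t > 0" using \<tau> r s by (simp add: t_def)
      have bk: "s powr (2 * \<gamma>) = b ^ k"
        by (simp add: s_def b_def powr_realpow[symmetric] powr_powr mult.commute)
      have tp: "t powr (- (2 * \<gamma>)) = b ^ k / (\<tau> powr (2 * \<gamma>) * R)"
        unfolding t_def R_def using \<tau> r s
        by (simp add: powr_minus powr_divide powr_mult bk inverse_eq_divide)
      have qpos: "q (Suc (2 * k)) > 0" using qge[of "Suc (2 * k)"] r by simp
      have A1: "A (q (Suc (2 * k))) \<le> 4 * r * t + t powr (- (2 * \<gamma>)) * (16 * C * s / r\<^sup>2 * W)"
      proof -
        have "A (q (Suc (2 * k))) \<le> 4 * q (Suc (2 * k)) * t + t powr (- (2 * \<gamma>)) * F (q (Suc (2 * k)))"
          by (rule A[OF qpos _ t]) (use qle[of "Suc (2 * k)"] r in linarith)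
        also have "\<dots> \<le> 4 * r * t + t powr (- (2 * \<gamma>)) * (16 * C * s / r\<^sup>2 * W)"
          using qle[of "Suc (2 * k)"] t by (intro add_mono mult_right_mono mult_left_mono F1) auto
        finally show ?thesis .
      qed
      have W0: "W \<ge> 0" by (simp add: W_def V0)
      have IH: "W \<le> \<delta> * r ^ 4 * R * \<mu> ^ k" using Suc.IH by (simp add: W_def)
      have "t powr (- (2 * \<gamma>)) * (16 * C * s / r\<^sup>2 * W)
          \<le> t powr (- (2 * \<gamma>)) * (16 * C * s / r\<^sup>2 * (\<delta> * r ^ 4 * R * \<mu> ^ k))"
        using IH C s r by (intro mult_left_mono) auto
      also have "\<dots> = 16 * C * \<delta> / (\<tau> powr (2 * \<gamma>)) * s * r\<^sup>2 * (b * \<mu>) ^ k"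
        unfolding tp using r R \<tau> by (simp add: field_simps power_mult_distrib power4_eq_xxxx power2_eq_square)
      also have "(b * \<mu>) ^ k = 1 / (s * s)"
        using b by (simp add: \<mu>_def s_def power_one_over flip: power_mult_distrib)
      also have "16 * C * \<delta> / (\<tau> powr (2 * \<gamma>)) = \<mu> / (128 * C)"
        unfolding \<delta>_def using \<tau> C by (simp add: field_simps power2_eq_square)
      also have "\<mu> / (128 * C) * s * r\<^sup>2 * (1 / (s * s)) = \<mu> * r\<^sup>2 / (128 * C * s)"
        using s by (simp add: field_simps)
      finally have A2: "t powr (- (2 * \<gamma>)) * (16 * C * s / r\<^sup>2 * W) \<le> \<mu> * r\<^sup>2 / (128 * C * s)" .
      have "4 * r * t = \<mu> * r\<^sup>2 / (128 * C * s)"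
        unfolding t_def \<tau>_def using C s by (simp add: field_simps power2_eq_square)
      with A1 A2 have A3: "A (q (Suc (2 * k))) \<le> \<mu> * r\<^sup>2 / (64 * C * s)" by (simp add: field_simps)
      have "V (q (2 * Suc k)) \<le> C / (r\<^sup>2 / (64 * s)) * A (q (Suc (2 * k))) * V (q (Suc (2 * k)))"
        using V[OF qlt[of "Suc (2 * k)"]] qle[of "Suc (2 * k)"] r unfolding d2 by simp
      also have "\<dots> \<le> C / (r\<^sup>2 / (64 * s)) * (\<mu> * r\<^sup>2 / (64 * C * s)) * V (q (Suc (2 * k)))"
        using A3 C s r V0 by (intro mult_right_mono mult_left_mono) auto
      also have "\<dots> = \<mu> * V (q (Suc (2 * k)))" using C s r by (simp add: field_simps)
      also have "\<dots> \<le> \<mu> * (\<delta> * r ^ 4 * R * \<mu> ^ k)"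
        using Vmono[of "q (Suc (2 * k))" "q (2 * k)"] qlt[of "2 * k"] IH \<mu> by (intro mult_left_mono) (auto simp: W_def)
      finally show ?case by (simp add: mult_ac)
    qed
    have "(\<lambda>k. \<delta> * r ^ 4 * R * \<mu> ^ k) \<longlonglongrightarrow> \<delta> * r ^ 4 * R * 0"
      using \<mu> by (intro tendsto_intros LIMSEQ_power_zero) auto
    moreover have "V (r / 2) \<le> \<delta> * r ^ 4 * R * \<mu> ^ k" for k
      using Vmono[of "r / 2" "q (2 * k)"] qge[of "2 * k"] decay[of k] by linarith
    ultimately have "V (r / 2) \<le> 0"
      using LIMSEQ_le_const by fastforce
    then show ?thesis using V0[of "r / 2"] by simp
  qed
  with \<delta> that show thesis by blast
qed

text \<open>At density zero A is at most a small multiple of the squared radius, so V decreases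
  under halving by as small a factor as desired. A factor below that of the iteration threshold lets
  V fall under the threshold after finitely many halvings.\<close>

lemma vanishing_at_density_zero:
  fixes V F A :: "real \<Rightarrow> real"
  assumes \<gamma>: "\<gamma> > 0" and C: "C > 0" and r0: "r0 > 0"
    and V0: "\<And>r. V r \<ge> 0" and Vmono: "\<And>s r. s \<le> r \<Longrightarrow> V s \<le> V r"
    and F: "\<And>s r. s < r \<Longrightarrow> r \<le> r0 \<Longrightarrow> F s \<le> C / (r - s)\<^sup>2 * V r"
    and V: "\<And>s r. s < r \<Longrightarrow> r \<le> r0 \<Longrightarrow> V s \<le> C / (r - s)\<^sup>2 * A r * V r"
    and A: "\<And>r t. 0 < r \<Longrightarrow> r \<le> r0 \<Longrightarrow> 0 < t \<Longrightarrow> A r \<le> 4 * r * t + t powr (- (2 * \<gamma>)) * F r"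
    and density: "\<And>e. e > 0 \<Longrightarrow> \<exists>r1>0. \<forall>r. 0 < r \<and> r \<le> r1 \<longrightarrow> A r \<le> e * r\<^sup>2"
  obtains \<rho> where "\<rho> > 0" "V \<rho> = 0"
proof -
  obtain \<delta> where \<delta>: "\<delta> > 0"
    "\<And>r. 0 < r \<Longrightarrow> r \<le> r0 \<Longrightarrow> V r \<le> \<delta> * r ^ 4 * r powr (2 * \<gamma>) \<Longrightarrow> V (r / 2) = 0"
    by (rule de_giorgi_iteration[OF \<gamma> C r0 V0 Vmono F V A]) (assumption | rule that)+
  define b :: real where "b = 2 powr (2 * \<gamma>)"
  have b: "b > 0" by (simp add: b_def)
  \<comment> \<open>Halving gives the factor 4 C e, which is 1 / (32 b). The threshold itself scales
    by 1 / (16 b) under halving, with b here equal to \<open>2 powr (2 * \<gamma>)\<close>; the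
    remaining factor 1/2 per step wins.\<close>
  define e where "e = 1 / (128 * C * b)"
  have e: "e > 0" using C b by (simp add: e_def)
  obtain r1 where r1: "r1 > 0" "\<And>r. 0 < r \<Longrightarrow> r \<le> r1 \<Longrightarrow> A r \<le> e * r\<^sup>2"
    using density[OF e] by blast
  define r2 where "r2 = min r0 r1"
  have r2: "r2 > 0" "r2 \<le> r0" "r2 \<le> r1" using r0 r1 by (auto simp: r2_def)
  have half: "V (r / 2) \<le> 1 / (32 * b) * V r" if r: "0 < r" "r \<le> r2" for r
  proof -
    have "V (r / 2) \<le> C / (r - r / 2)\<^sup>2 * A r * V r" by (rule V) (use r r2 in auto)
    also have "\<dots> \<le> C / (r - r / 2)\<^sup>2 * (e * r\<^sup>2) * V r"
      using r r2 r1(2)[of r] C V0[of r] by (intro mult_right_mono mult_left_mono) auto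
    also have "\<dots> = 1 / (32 * b) * V r"
      using r C b by (simp add: e_def field_simps power2_eq_square)
    finally show ?thesis .
  qed
  define rr where "rr n = r2 / 2 ^ n" for n :: nat
  have rr: "rr n > 0" "rr n \<le> r2" for n
    using r2(1) by (auto simp: rr_def divide_le_eq mult_le_cancel_left1)
  have dec: "V (rr n) \<le> (1 / (32 * b)) ^ n * V r2" for n
  proof (induction n)
    case (Suc n)
    have "V (rr (Suc n)) \<le> 1 / (32 * b) * V (rr n)"
      using half[OF rr(1,2)[of n]] by (simp add: rr_def mult.commute)
    also have "\<dots> \<le> 1 / (32 * b) * ((1 / (32 * b)) ^ n * V r2)"
      using Suc b by (intro mult_left_mono) auto
    finally show ?case by simp
  qed (simp add: rr_def)
  have pw: "rr n ^ 4 * rr n powr (2 * \<gamma>) = (r2 ^ 4 * r2 powr (2 * \<gamma>)) * (1 / (16 * b)) ^ n" for n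
  proof -
    have "(2 ^ n :: real) powr (2 * \<gamma>) = b ^ n"
      by (simp add: b_def powr_realpow[symmetric] powr_powr mult.commute)
    moreover have "((2::real) ^ n) ^ 4 = 16 ^ n" by (simp add: power_mult[symmetric] mult.commute[of n] power_mult)
    ultimately show ?thesis
      using r2(1) by (simp add: rr_def powr_divide power_divide power_mult_distrib)
  qed
  define c where "c = \<delta> * (r2 ^ 4 * r2 powr (2 * \<gamma>))"
  have c: "c > 0" using \<delta>(1) r2(1) by (simp add: c_def)
  have "(\<lambda>n. (1 / 2) ^ n * V r2) \<longlonglongrightarrow> 0 * V r2"
    by (intro tendsto_intros LIMSEQ_power_zero) auto
  then have "\<forall>\<^sub>F n in sequentially. (1 / 2) ^ n * V r2 < c"
    using c by (intro order_tendstoD(2)) auto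
  then obtain n where n: "(1 / 2) ^ n * V r2 < c" by (auto simp: eventually_sequentially)
  have "V (rr n) \<le> (1 / (16 * b)) ^ n * ((1 / 2) ^ n * V r2)"
    using dec[of n] by (simp add: power_mult_distrib[symmetric] mult.assoc[symmetric])
  also have "\<dots> \<le> (1 / (16 * b)) ^ n * c"
    using n b by (intro mult_left_mono) auto
  also have "\<dots> = \<delta> * rr n ^ 4 * rr n powr (2 * \<gamma>)"
    using pw[of n] by (simp add: c_def mult_ac)
  finally have "V (rr n / 2) = 0"
    using \<delta>(2)[of "rr n"] rr[of n] r2(2) by linarith
  then show thesis using that[of "rr n / 2"] rr(1)[of n] by simp
qed

section \<open>The degenerate weight and the conclusion\<close>

lemma degenerate_measure_bound:
  fixes Q :: "real \<times> real \<Rightarrow> real"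
  assumes Q: "Q = (\<lambda>(x, y). \<bar>y\<bar> powr \<gamma>)" and \<Omega>: "\<Omega> \<in> sets lebesgue"
    and Qi: "integrable (lebesgue_on \<Omega>) (\<lambda>x. (Q x)\<^sup>2)"
    and U: "U \<in> sets lebesgue" "U \<subseteq> \<Omega>" and p: "snd p = 0" and "r > 0" "t > 0" "\<gamma> > 0"
  shows "measure lebesgue (U \<inter> square p r) \<le> 4 * r * t +
    t powr (- (2 * \<gamma>)) * (LINT x|lebesgue_on \<Omega>. indicator (U \<inter> square p r) x * (Q x)\<^sup>2)"
proof -
  let ?S = "U \<inter> square p r"
  have S: "?S \<in> sets lebesgue" using U(1) compact_imp_lebesgue[OF compact_square] by (rule sets.Int)
  have SM: "?S \<in> lmeasurable"
    using fmeasurable_Int_fmeasurable[OF lmeasurable_compact[OF compact_square] U(1)] by (simp add: Int_commute)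
  \<comment> \<open>The rectangle of height 2 t around the axis is counted in full. The rest of the
    square satisfies |y| > t, where \<open>Q\<^sup>2\<close> times
    \<open>t powr (- (2 * \<gamma>))\<close> is at least 1. The height stays free so that the
    iteration can adapt it to each round.\<close>
  define B where "B = cbox (p - (r, t)) (p + (r, t))"
  have Bm: "measure lebesgue B = 4 * r * t"
  proof -
    have "B = cbox (fst p - r, - t) (fst p + r, t)"
      using p by (cases p) (simp add: B_def)
    moreover have "measure lborel (cbox (fst p - r, - t) (fst p + r, t)) = 4 * r * t"
      using \<open>r > 0\<close> \<open>t > 0\<close>
      by (subst measure_lborel_cbox_eq) (auto simp: Basis_prod_def prod.union_disjoint inner_prod_def)
    ultimately show ?thesis by simp
  qed
  have out: "indicator ?S x * (Q x)\<^sup>2 = 0" if "x \<notin> \<Omega>" for x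
    using contra_subsetD[OF U(2) that] by simp
  have Qs: "integrable lebesgue (\<lambda>x. indicator ?S x * (Q x)\<^sup>2)"
  proof -
    have "?S \<in> sets (lebesgue_on \<Omega>)" using S U \<Omega> by (subst sets_restrict_space_iff) auto
    from integrable_mult_indicator[OF this Qi] show ?thesis
      using integrable_lebesgue_on_zero_outside[OF \<Omega> out] by simp
  qed
  have "measure lebesgue ?S = (LINT x|lebesgue. indicator ?S x)" by simp
  also have "\<dots> \<le> (LINT x|lebesgue. indicator B x + t powr (- (2 * \<gamma>)) * (indicator ?S x * (Q x)\<^sup>2))"
  proof (rule integral_mono)
    show "integrable lebesgue (indicat_real ?S)"
      using SM unfolding fmeasurable_def by (intro integrable_real_indicator) auto
    show "integrable lebesgue (\<lambda>x. indicator B x + t powr (- (2 * \<gamma>)) * (indicator ?S x * (Q x)\<^sup>2))"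
      using Qs lmeasurable_compact[of B]
      by (intro Bochner_Integration.integrable_add integrable_mult_right) (auto simp: B_def fmeasurable_def)
    fix x :: "real \<times> real"
    show "indicat_real ?S x \<le> indicator B x + t powr (- (2 * \<gamma>)) * (indicator ?S x * (Q x)\<^sup>2)"
    proof (cases "x \<in> ?S \<and> x \<notin> B")
      case True
      obtain a c where x: "x = (a, c)" by (cases x)
      have "\<bar>c\<bar> > t"
        using True p unfolding x by (cases p) (auto simp: B_def square_def cbox_def Basis_prod_def abs_le_iff)
      then have "t powr (2 * \<gamma>) \<le> \<bar>c\<bar> powr (2 * \<gamma>)"
        using \<open>t > 0\<close> \<open>\<gamma> > 0\<close> by (intro powr_mono2) auto
      moreover have "(Q x)\<^sup>2 = \<bar>c\<bar> powr (2 * \<gamma>)"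
        using \<open>\<bar>c\<bar> > t\<close> \<open>t > 0\<close> by (simp add: Q x power2_eq_square powr_add[symmetric])
      ultimately have "1 \<le> t powr (- (2 * \<gamma>)) * (Q x)\<^sup>2"
        using \<open>t > 0\<close> by (simp add: powr_minus field_simps)
      with True show ?thesis by simp
    next
      case False
      then show ?thesis by (auto simp: indicator_def)
    qed
  qed
  also have "\<dots> = 4 * r * t + t powr (- (2 * \<gamma>)) * (LINT x|lebesgue. indicator ?S x * (Q x)\<^sup>2)"
    using Qs lmeasurable_compact[of B] Bm
    by (subst Bochner_Integration.integral_add) (auto simp: B_def fmeasurable_def)
  also have "(LINT x|lebesgue. indicator ?S x * (Q x)\<^sup>2) = (LINT x|lebesgue_on \<Omega>. indicator ?S x * (Q x)\<^sup>2)"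
    by (rule integral_lebesgue_on_zero_outside[OF \<Omega> out, symmetric])
  finally show ?thesis .
qed

theorem theorem1p2:
  fixes \<gamma> :: real and \<Gamma> :: "(real \<times> real) set"
    and Q :: "real \<times> real \<Rightarrow> real" and u :: "real \<times> real \<Rightarrow> real"
  assumes "\<gamma> > 0"
    and "\<Gamma> = {(x, 0) |x. x \<in> UNIV}"
    and "Q = (\<lambda>(x, y). \<bar>y\<bar> powr \<gamma>)"
    and "local_minimizer Q (ball 0 2) u"
    and "continuous_on (ball 0 2) u"
    and "pos_set (ball 0 2) u \<inter> \<Gamma> = {}"
  shows "cusp_set (ball 0 2) \<Gamma> u = {}"
proof (rule ccontr)
  assume "cusp_set (ball 0 2) \<Gamma> u \<noteq> {}"
  define \<Omega> :: "(real \<times> real) set" where "\<Omega> = ball 0 2"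
  define U where "U = pos_set \<Omega> u"
  from \<open>cusp_set (ball 0 2) \<Gamma> u \<noteq> {}\<close> obtain p where p: "p \<in> frontier U" "p \<in> \<Gamma>" "p \<in> \<Omega>"
    and lim: "((\<lambda>r. measure lebesgue (ball p r \<inter> U) / (pi * r\<^sup>2)) \<longlongrightarrow> 0) (at_right 0)"
    by (auto simp: cusp_set_def U_def \<Omega>_def)
  have \<Omega>: "open \<Omega>" "\<Omega> \<in> sets lebesgue" by (auto simp: \<Omega>_def)
  have lm: "local_minimizer Q \<Omega> u" and cu: "continuous_on \<Omega> u"
    using assms(4,5) by (simp_all add: \<Omega>_def)
  note Us = pos_set_lebesgue[OF \<Omega>(1) cu, folded U_def]
  have Usub: "U \<subseteq> \<Omega>" by (auto simp: U_def pos_set_def)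
  \<comment> \<open>Continuity on the axis, where the base of \<open>powr\<close> is 0, rests on the
    positive exponent.\<close>
  have cQ: "continuous_on UNIV Q"
    unfolding assms(3) case_prod_beta using assms(1) by (intro continuous_on_powr' continuous_intros) auto
  have Qi: "integrable (lebesgue_on \<Omega>) (\<lambda>x. (Q x)\<^sup>2)"
  proof -
    have "integrable lborel (\<lambda>x. indicator (cball 0 2) x *\<^sub>R (Q x)\<^sup>2)"
      by (intro borel_integrable_compact compact_cball continuous_intros continuous_on_subset[OF cQ]) auto
    then have "integrable lebesgue (\<lambda>x. indicator (cball 0 2) x *\<^sub>R (Q x)\<^sup>2)"
      by (subst integrable_completion) auto
    from integrable_mult_indicator[OF \<Omega>(2) this]
    have "integrable lebesgue (\<lambda>x. indicator \<Omega> x *\<^sub>R (Q x)\<^sup>2)"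
      by (rule back_subst[where P="integrable lebesgue"]) (auto simp: \<Omega>_def indicator_def)
    then show ?thesis using \<Omega>(2) by (subst integrable_restrict_space) auto
  qed
  define V where "V r = (LINT x|lebesgue_on \<Omega>. indicator (U \<inter> square p r) x * (u x)\<^sup>2)" for r
  define F where "F r = (LINT x|lebesgue_on \<Omega>. indicator (U \<inter> square p r) x * (Q x)\<^sup>2)" for r
  define A where "A r = measure lebesgue (U \<inter> square p r)" for r
  obtain r0 C where r0: "r0 > 0" "C > 0" "square p r0 \<subseteq> \<Omega>"
    and FV: "\<And>s r. s < r \<Longrightarrow> r \<le> r0 \<Longrightarrow> F s \<le> C / (r - s)\<^sup>2 * V r"
    and VV: "\<And>s r. s < r \<Longrightarrow> r \<le> r0 \<Longrightarrow> V s \<le> C / (r - s)\<^sup>2 * A r * V r"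
    by (rule square_estimates[OF \<Omega>(1) lm cu Qi p(3), folded U_def, folded V_def F_def A_def])
       (assumption | rule that)+
  have u2: "integrable (lebesgue_on \<Omega>) (\<lambda>x. (u x)\<^sup>2)"
    using L2_integrable_square[OF weak_grad_props(3)[OF local_minimizerD(1)[OF lm]]] by simp
  have Vi: "integrable (lebesgue_on \<Omega>) (\<lambda>x. indicator (U \<inter> square p r) x * (u x)\<^sup>2)" for r
  proof -
    have "U \<inter> square p r \<in> sets (lebesgue_on \<Omega>)"
      using sets.Int[OF Us(2) compact_imp_lebesgue[OF compact_square]] \<Omega>(2) Usub
      by (subst sets_restrict_space_iff) auto
    from integrable_mult_indicator[OF this u2] show ?thesis by simp
  qed
  have V0: "V r \<ge> 0" for r unfolding V_def by (rule integral_nonneg_AE) simp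
  have Vmono: "V s \<le> V r" if "s \<le> r" for s r
    unfolding V_def using square_mono[OF that, of p]
    by (intro integral_mono Vi) (auto simp: indicator_def)
  have AF: "A r \<le> 4 * r * t + t powr (- (2 * \<gamma>)) * F r" if "0 < r" "r \<le> r0" "0 < t" for r t
    unfolding A_def F_def using p(2) assms(2)
    by (intro degenerate_measure_bound[OF assms(3) \<Omega>(2) Qi Us(2) Usub _ that(1,3) assms(1)]) auto
  have density: "\<exists>r1>0. \<forall>r. 0 < r \<and> r \<le> r1 \<longrightarrow> A r \<le> e * r\<^sup>2" if "e > 0" for e
  proof -
    \<comment> \<open>The square of half-width r lies in the ball of radius 3 r, whose normalized
      area contributes the factor 9. Taking r <= r1/4 later ensures 3 r < r1.\<close>
    have "\<forall>\<^sub>F r in at_right 0. measure lebesgue (ball p r \<inter> U) / (pi * r\<^sup>2) < e / (9 * pi)"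
      using lim that by (intro order_tendstoD(2)) auto
    then obtain r1 where r1: "r1 > 0"
      "\<And>r. 0 < r \<Longrightarrow> r < r1 \<Longrightarrow> measure lebesgue (ball p r \<inter> U) / (pi * r\<^sup>2) < e / (9 * pi)"
      by (auto simp: eventually_at_right_field)
    have "A r \<le> e * r\<^sup>2" if r: "0 < r" "r \<le> r1 / 4" for r
    proof -
      have "square p r \<subseteq> ball p (3 * r)"
      proof
        fix q assume "q \<in> square p r"
        then have "dist p q \<le> 2 * r" using square_subset_cball[of p r] by auto
        then show "q \<in> ball p (3 * r)" using r by (simp only: mem_ball)
      qed
      then have "A r \<le> measure lebesgue (ball p (3 * r) \<inter> U)"
        unfolding A_def using Us(2)
        by (intro measure_mono_fmeasurable fmeasurable_Int_fmeasurable sets.Int compact_imp_lebesgue[OF compact_square]) auto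
      also have "\<dots> < e * r\<^sup>2"
        using r1(2)[of "3 * r"] r r1(1) by (simp add: field_simps power2_eq_square)
      finally show ?thesis by simp
    qed
    then show ?thesis using r1(1) by (intro exI[of _ "r1 / 4"]) auto
  qed
  obtain \<rho> where \<rho>: "\<rho> > 0" "V \<rho> = 0"
    by (rule vanishing_at_density_zero[OF assms(1) r0(2,1) V0 Vmono FV VV AF density]) (assumption | rule that)+
  \<comment> \<open>Since u > 0 on U, a vanishing V forces U to be null near p. An open null set is
    empty, which contradicts p lying in the closure of U.\<close>
  have "AE x in lebesgue_on \<Omega>. indicator (U \<inter> square p \<rho>) x * (u x)\<^sup>2 = 0"
    using integral_nonneg_eq_0_iff_AE[OF Vi, of \<rho>] \<rho>(2) by (simp add: V_def)
  then have "AE x in lebesgue_on \<Omega>. x \<notin> U \<inter> ball p \<rho>"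
  proof eventually_elim
    case (elim x)
    then show ?case
      using subsetD[OF cball_subset_square[of p \<rho>], of x] by (auto simp: U_def pos_set_def indicator_def split: if_splits)
  qed
  then have "AE x in lebesgue. x \<notin> U \<inter> ball p \<rho>"
    using Usub \<Omega>(2) by (subst (asm) AE_restrict_space_iff) auto
  then have "negligible (U \<inter> ball p \<rho>)"
    unfolding negligible_iff_null_sets using Us(2) by (subst AE_iff_null_sets) auto
  then have "U \<inter> ball p \<rho> = {}"
    using open_not_negligible[OF open_Int[OF Us(1) open_ball]] by blast
  moreover have "p \<in> closure U" using p(1) by (simp add: frontier_def)
  ultimately show False
    using \<rho>(1) by (auto simp: closure_approachable dist_commute disjoint_iff)
qed

end
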